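(* Let $n\ge 1$, let $f:\mathbb{D}^n \to \mathbb{D}$ be a rational inner function in the Agler class, and write $f = q/p$ with $q,p \in \mathbb{C}[z_1,\dots,z_n]$, where $p$ has no zeros on $\mathbb{D}^n$. Assume that $q$ and $p$ each have degree at most $d_j$ in the variable $z_j$ for $j=1,\dots,n$. Then: (1) Whenever $N_1,\dots,N_n\ge 0$ are integers and $A_{j,k}\in\mathbb{C}[z_1,\dots,z_n]$ ($1\le j\le n$, $1\le k\le N_j$) are polynomials satisfying, for all $z\in\mathbb{C}^n$, \[ |p(z)|^2 - |q(z)|^2 = \sum_{j=1}^{n} (1-|z_j|^2) \sum_{k=1}^{N_j} |A_{j,k}(z)|^2, \qquad ( * ) \] each $A_{j,k}$ satisfies \[ \deg_{z_i} A_{j,k} \leq \begin{cases} d_i & i \ne j \\ d_i-1 & i = j. \end{cases} \] As a result, there exists a decomposition of the form $( * )$ in which \[ N_j \leq d_j \prod_{k\ne j} (d_k+1) \quad \text{for } j=1,\dots,n. \] (2) $f$ has a transfer function realization whose Hilbert space blocks $\mathcal{H}_1,\dots,\mathcal{H}_n$ satisfy \[ \dim \mathcal{H}_j \leq d_j \prod_{k\ne j} (d_k+1) \quad \text{for } j=1,\dots,n. \] In particular, $f$ has a transfer function realization of size \[ \sum_{j=1}^{n} d_j \prod_{k\ne j} (d_k+1). \]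
   Context: $\mathbb{D}$ is the open unit disk in $\mathbb{C}$, $\mathbb{T}$ the unit circle, $\mathbb{D}^n$ the polydisk, $\mathbb{T}^n$ the $n$-torus. $\deg_{z_i}$ denotes degree in the variable $z_i$; the zero polynomial has degree $-\infty$. Empty sums equal $0$ and empty products equal $1$. A rational inner function on $\mathbb{D}^n$ is a rational function $f=q/p$ with $q,p\in\mathbb{C}[z_1,\dots,z_n]$, where $p$ has no zeros on $\mathbb{D}^n$ and $|f|=1$ a.e. on $\mathbb{T}^n$. A holomorphic function $f:\mathbb{D}^n\to\mathbb{D}$ is in the Agler class (Schur-Agler class) if $\|f(T)\|\le 1$ for all commuting $n$-tuples $T=(T_1,\dots,T_n)$ of strict contractions on a Hilbert space. By a theorem of Agler this is equivalent to the existence of an Agler decomposition: positive semi-definite kernels $K_j:\mathbb{D}^n\times\mathbb{D}^n\to\mathbb{C}$, $j=1,\dots,n$, with $1-f(z)\overline{f(\zeta)} = \sum_{j=1}^n (1-z_j\bar{\zeta}_j)K_j(z,\zeta)$. It is also equivalent to the existence of a transfer function realization as defined next (with the Hilbert spaces possibly infinite dimensional). A function $f:\mathbb{D}^n\to\mathbb{D}$ has a transfer function realization if there is a Hilbert space with an orthogonal decomposition $\mathcal{H}=\mathcal{H}_1\oplus\cdots\oplus\mathcal{H}_n$ and an isometric operator $V=\begin{bmatrix} A & B\\ C& D\end{bmatrix}$ on $\mathbb{C}\oplus\mathcal{H}$ (so $A:\mathbb{C}\to\mathbb{C}$, $B:\mathcal{H}\to\mathbb{C}$, $C:\mathbb{C}\to\mathcal{H}$,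 $D:\mathcal{H}\to\mathcal{H}$ are bounded) such that $f(z)=A+BE(z)(I-DE(z))^{-1}C$ for $z\in\mathbb{D}^n$, where $E(z)$ is the block diagonal operator on $\mathcal{H}$ with diagonal blocks $z_1I_{\mathcal{H}_1},\dots,z_nI_{\mathcal{H}_n}$. Zero-dimensional summands are allowed. When the $\mathcal{H}_j$ are finite dimensional, the size of the realization is $\sum_{j=1}^n\dim\mathcal{H}_j$. *)

theory Defs
  imports
    "HOL-Analysis.Analysis"
    "HOL-Library.Poly_Mapping"
    "HOL-Library.Function_Algebras"
begin

section \<open>Polynomials in the variables \<open>z\<^sub>i\<close>, \<open>i :: 'n\<close>\<close>

text \<open>
  The index type \<open>'n\<close> plays the role of \<open>{1,\<dots>,n}\<close>. A multi-index has type \<open>'n \<Rightarrow>\<^sub>0 nat\<close>, and a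
  polynomial is a finitely supported family of complex coefficients.
\<close>

type_synonym 'n multi_index = "'n \<Rightarrow>\<^sub>0 nat"
type_synonym 'n cpoly = "'n multi_index \<Rightarrow>\<^sub>0 complex"

definition monomial_at :: "complex ^ 'n::finite \<Rightarrow> 'n multi_index \<Rightarrow> complex" where
  "monomial_at z m = (\<Prod>i\<in>UNIV. (z $ i) ^ Poly_Mapping.lookup m i)"

definition peval :: "'n::finite cpoly \<Rightarrow> complex ^ 'n \<Rightarrow> complex" where
  "peval P z = (\<Sum>m\<in>Poly_Mapping.keys P. Poly_Mapping.lookup P m * monomial_at z m)"

text \<open>The supremum of the empty set in \<^typ>\<open>ereal\<close> is \<open>-\<infinity>\<close>, which is thus the degree of \<open>0\<close>.\<close>

definition deg_in :: "'n \<Rightarrow> 'n cpoly \<Rightarrow> ereal" where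
  "deg_in i P = (SUP m\<in>Poly_Mapping.keys P. ereal (real (Poly_Mapping.lookup m i)))"


section \<open>Rational inner functions on the polydisk\<close>

definition polydisk :: "(complex ^ 'n::finite) set" where
  "polydisk = {z. \<forall>j. cmod (z $ j) < 1}"

text \<open>Product arc-length measure on the torus, not normalized; only its null sets matter.\<close>

definition torus_measure :: "(complex ^ 'n::finite) measure" where
  "torus_measure =
     distr (restrict_space lborel (cbox 0 (\<chi> j. 2 * pi) :: (real ^ 'n) set)) borel
       (\<lambda>t. \<chi> j. cis (t $ j))"

lemma measurable_cis_vec [measurable]:
  "(\<lambda>t. \<chi> j. cis (t $ j)) \<in>
     measurable (restrict_space lborel (cbox 0 (\<chi> j. 2 * pi) :: (real ^ 'n::finite) set)) borel"
proof -
  have "continuous_on UNIV (\<lambda>t :: real ^ 'n. \<chi> j. cis (t $ j))"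
    unfolding cis_conv_exp by (intro continuous_intros)
  then show ?thesis
    by (intro measurable_restrict_space1) (simp add: borel_measurable_continuous_onI)
qed

definition rational_inner :: "(complex ^ 'n::finite \<Rightarrow> complex) \<Rightarrow> bool" where
  "rational_inner f \<longleftrightarrow>
     (\<exists>q p. (\<forall>z\<in>polydisk. peval p z \<noteq> 0)
          \<and> (\<forall>z\<in>polydisk. f z = peval q z / peval p z)
          \<and> (AE z in torus_measure. cmod (peval q z / peval p z) = 1))"


section \<open>Complex Hilbert spaces\<close>

text \<open>
  A Hilbert space is a linear subspace \<open>H\<close> of the complex vector space \<open>\<complex>\<^sup>\<nat>\<close> of all sequences (with
  pointwise operations) together with an arbitrary complete inner product \<open>ip\<close> on \<open>H\<close>. The
  inner product is unrelated to the coordinates: \<open>\<complex>\<^sup>\<nat>\<close> has algebraic dimension \<open>2\<^sup>\<aleph>\<^sub>0\<close> and only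
  serves as a universe that contains an isomorphic copy of every Hilbert space of at most that
  algebraic dimension, in particular of every separable one. Sums and zero of sequences are
  those of \<^theory>\<open>HOL-Library.Function_Algebras\<close>.
\<close>

type_synonym cseq = "nat \<Rightarrow> complex"

definition cscale :: "complex \<Rightarrow> cseq \<Rightarrow> cseq" where
  "cscale c x = (\<lambda>i. c * x i)"

global_interpretation cvec: vector_space cscale
  by unfold_locales (auto simp: cscale_def algebra_simps)

definition ip_norm :: "(cseq \<Rightarrow> cseq \<Rightarrow> complex) \<Rightarrow> cseq \<Rightarrow> real" where
  "ip_norm ip x = sqrt (Re (ip x x))"

definition hilbert_space :: "cseq set \<Rightarrow> (cseq \<Rightarrow> cseq \<Rightarrow> complex) \<Rightarrow> bool" where
  "hilbert_space H ip \<longleftrightarrow>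
     cvec.subspace H
   \<and> (\<forall>x\<in>H. \<forall>y\<in>H. ip y x = cnj (ip x y))
   \<and> (\<forall>x\<in>H. \<forall>y\<in>H. \<forall>z\<in>H. ip (x + y) z = ip x z + ip y z)
   \<and> (\<forall>c. \<forall>x\<in>H. \<forall>y\<in>H. ip (cscale c x) y = c * ip x y)
   \<and> (\<forall>x\<in>H. x \<noteq> 0 \<longrightarrow> 0 < Re (ip x x))
   \<and> (\<forall>s. (\<forall>n. s n \<in> H)
          \<and> (\<forall>e>0. \<exists>N. \<forall>m\<ge>N. \<forall>n\<ge>N. ip_norm ip (s m - s n) < e)
          \<longrightarrow> (\<exists>l\<in>H. (\<lambda>n. ip_norm ip (s n - l)) \<longlonglongrightarrow> 0))"

definition finite_dimensional :: "cseq set \<Rightarrow> bool" where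
  "finite_dimensional S \<longleftrightarrow> (\<exists>B. finite B \<and> cvec.span B = S)"

definition linear_op :: "cseq set \<Rightarrow> (cseq \<Rightarrow> cseq) \<Rightarrow> bool" where
  "linear_op H T \<longleftrightarrow>
     (\<forall>x\<in>H. T x \<in> H)
   \<and> (\<forall>x\<in>H. \<forall>y\<in>H. T (x + y) = T x + T y)
   \<and> (\<forall>c. \<forall>x\<in>H. T (cscale c x) = cscale c (T x))"

definition bounded_op :: "cseq set \<Rightarrow> (cseq \<Rightarrow> cseq \<Rightarrow> complex) \<Rightarrow> (cseq \<Rightarrow> cseq) \<Rightarrow> bool" where
  "bounded_op H ip T \<longleftrightarrow>
     linear_op H T \<and> (\<exists>c. \<forall>x\<in>H. ip_norm ip (T x) \<le> c * ip_norm ip x)"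

definition op_norm :: "cseq set \<Rightarrow> (cseq \<Rightarrow> cseq \<Rightarrow> complex) \<Rightarrow> (cseq \<Rightarrow> cseq) \<Rightarrow> real" where
  "op_norm H ip T = (SUP x\<in>{x \<in> H. ip_norm ip x \<le> 1}. ip_norm ip (T x))"

definition strict_contraction :: "cseq set \<Rightarrow> (cseq \<Rightarrow> cseq \<Rightarrow> complex) \<Rightarrow> (cseq \<Rightarrow> cseq) \<Rightarrow> bool" where
  "strict_contraction H ip T \<longleftrightarrow> bounded_op H ip T \<and> op_norm H ip T < 1"


section \<open>The Agler class\<close>

definition holomorphic_on_polydisk :: "(complex ^ 'n::finite \<Rightarrow> complex) \<Rightarrow> bool" where
  "holomorphic_on_polydisk f \<longleftrightarrow>
     (\<forall>z\<in>polydisk. \<exists>f'. (f has_derivative f') (at z) \<and> (\<forall>c v. f' (c *s v) = c * f' v))"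

text \<open>
  \<open>T\<^sup>m = \<Prod>\<^sub>i T\<^sub>i\<^bsup>m\<^sub>i\<^esup>\<close>, composed in the order of the index type; for commuting tuples the order is
  irrelevant on the Hilbert space.
\<close>

definition op_power :: "('n::{finite,linorder} \<Rightarrow> cseq \<Rightarrow> cseq) \<Rightarrow> 'n multi_index \<Rightarrow> cseq \<Rightarrow> cseq" where
  "op_power T m =
     foldr (\<lambda>i F. (T i ^^ Poly_Mapping.lookup m i) \<circ> F) (sorted_list_of_set UNIV) id"

text \<open>
  \<open>F\<close> is the operator \<open>f(T) = \<Sum>\<^sub>m a\<^sub>m T\<^sup>m\<close>, where \<open>f(z) = \<Sum>\<^sub>m a\<^sub>m z\<^sup>m\<close> on the polydisk. The operator
  series converges unconditionally in operator norm for commuting strict contractions, so such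
  an \<open>F\<close> exists for every holomorphic \<open>f\<close> and is unique on \<open>H\<close>.
\<close>

definition is_fun_of_ops ::
  "cseq set \<Rightarrow> (cseq \<Rightarrow> cseq \<Rightarrow> complex) \<Rightarrow> (complex ^ 'n::{finite,linorder} \<Rightarrow> complex)
     \<Rightarrow> ('n \<Rightarrow> cseq \<Rightarrow> cseq) \<Rightarrow> (cseq \<Rightarrow> cseq) \<Rightarrow> bool" where
  "is_fun_of_ops H ip f T F \<longleftrightarrow>
     bounded_op H ip F
   \<and> (\<exists>a :: 'n multi_index \<Rightarrow> complex.
        (\<forall>z\<in>polydisk. ((\<lambda>m. a m * monomial_at z m) has_sum f z) UNIV)
      \<and> ((\<lambda>S. op_norm H ip (\<lambda>x. F x - (\<Sum>m\<in>S. cscale (a m) (op_power T m x)))) \<longlongrightarrow> 0)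
          (finite_subsets_at_top UNIV))"

definition agler_class :: "(complex ^ 'n::{finite,linorder} \<Rightarrow> complex) \<Rightarrow> bool" where
  "agler_class f \<longleftrightarrow>
     holomorphic_on_polydisk f
   \<and> (\<forall>z\<in>polydisk. cmod (f z) < 1)
   \<and> (\<forall>H ip T.
        hilbert_space H ip
        \<and> (\<forall>i. strict_contraction H ip (T i))
        \<and> (\<forall>i j. \<forall>x\<in>H. T i (T j x) = T j (T i x))
        \<longrightarrow> (\<exists>F. is_fun_of_ops H ip f T F \<and> op_norm H ip F \<le> 1))"


section \<open>Transfer function realizations\<close>

definition orthogonal_decomposition ::
  "cseq set \<Rightarrow> (cseq \<Rightarrow> cseq \<Rightarrow> complex) \<Rightarrow> ('n::finite \<Rightarrow> cseq set) \<Rightarrow> bool" where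
  "orthogonal_decomposition H ip Hs \<longleftrightarrow>
     (\<forall>j. cvec.subspace (Hs j) \<and> Hs j \<subseteq> H)
   \<and> (\<forall>i j. i \<noteq> j \<longrightarrow> (\<forall>x\<in>Hs i. \<forall>y\<in>Hs j. ip x y = 0))
   \<and> (\<forall>x\<in>H. \<exists>u. (\<forall>j. u j \<in> Hs j) \<and> x = (\<Sum>j\<in>UNIV. u j))"

definition components :: "('n::finite \<Rightarrow> cseq set) \<Rightarrow> cseq \<Rightarrow> 'n \<Rightarrow> cseq" where
  "components Hs x = (THE u. (\<forall>j. u j \<in> Hs j) \<and> x = (\<Sum>j\<in>UNIV. u j))"

definition block_diag :: "('n::finite \<Rightarrow> cseq set) \<Rightarrow> complex ^ 'n \<Rightarrow> cseq \<Rightarrow> cseq" where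
  "block_diag Hs z x = (\<Sum>j\<in>UNIV. cscale (z $ j) (components Hs x j))"

text \<open>
  The operator \<open>A\<close> on \<open>\<complex>\<close> is identified with a number. Boundedness of the blocks
  follows from the isometry condition.
\<close>

definition transfer_realization ::
  "(complex ^ 'n::finite \<Rightarrow> complex) \<Rightarrow> cseq set \<Rightarrow> (cseq \<Rightarrow> cseq \<Rightarrow> complex) \<Rightarrow> ('n \<Rightarrow> cseq set)
     \<Rightarrow> complex \<Rightarrow> (cseq \<Rightarrow> complex) \<Rightarrow> (complex \<Rightarrow> cseq) \<Rightarrow> (cseq \<Rightarrow> cseq) \<Rightarrow> bool" where
  "transfer_realization f H ip Hs A B C D \<longleftrightarrow>
     hilbert_space H ip
   \<and> orthogonal_decomposition H ip Hs
   \<and> (\<forall>x\<in>H. \<forall>y\<in>H. B (x + y) = B x + B y)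
   \<and> (\<forall>c. \<forall>x\<in>H. B (cscale c x) = c * B x)
   \<and> (\<forall>a. C a \<in> H)
   \<and> (\<forall>a b. C (a + b) = C a + C b)
   \<and> (\<forall>c a. C (c * a) = cscale c (C a))
   \<and> linear_op H D
   \<and> (\<forall>a. \<forall>x\<in>H. (cmod (A * a + B x))\<^sup>2 + (ip_norm ip (C a + D x))\<^sup>2
                    = (cmod a)\<^sup>2 + (ip_norm ip x)\<^sup>2)
   \<and> (\<forall>z\<in>polydisk.
        bij_betw (\<lambda>x. x - D (block_diag Hs z x)) H H
      \<and> f z = A + B (block_diag Hs z (inv_into H (\<lambda>x. x - D (block_diag Hs z x)) (C 1))))"


section \<open>Sums of squares decompositions\<close>

definition sos_decomposition ::
  "'n::finite cpoly \<Rightarrow> 'n cpoly \<Rightarrow> ('n \<Rightarrow> nat) \<Rightarrow> ('n \<Rightarrow> nat \<Rightarrow> 'n cpoly) \<Rightarrow> bool" where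
  "sos_decomposition p q N A \<longleftrightarrow>
     (\<forall>z. (cmod (peval p z))\<^sup>2 - (cmod (peval q z))\<^sup>2
        = (\<Sum>j\<in>UNIV. (1 - (cmod (z $ j))\<^sup>2) * (\<Sum>k=1..N j. (cmod (peval (A j k) z))\<^sup>2)))"

end

theory Submission
  imports Defs
begin

text \<open>
The whole argument takes place on coefficients. Write \<open>p\<^sub>m\<close>, \<open>q\<^sub>m\<close> for the coefficients of \<open>p\<close> and
\<open>q\<close>, and \<open>e\<^sub>j\<close> for the \<open>j\<close>-th unit multi-index. A decomposition of \<open>|p|\<^sup>2 - |q|\<^sup>2\<close> is a family of
positive semidefinite matrices \<open>G\<^sub>j(m, n)\<close> indexed by multi-indices such that
\<open>\<Sum>\<^sub>j (G\<^sub>j(m, n) - G\<^sub>j(m - e\<^sub>j, n - e\<^sub>j)) = p\<^sub>m \<cdot> cnj p\<^sub>n - q\<^sub>m \<cdot> cnj q\<^sub>n\<close>,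
because multiplication by \<open>1 - z\<^sub>j \<cdot> cnj \<zeta>\<^sub>j\<close> shifts the coefficient matrix along the diagonal. The
left-hand side is called the \<^emph>\<open>defect\<close> of \<open>G\<close> below.

Two facts do most of the work.

\<^item> Innerness gives \<open>\<Sum>\<^sub>m |p\<^sub>m|\<^sup>2 = \<Sum>\<^sub>m |q\<^sub>m|\<^sup>2\<close> (\<open>inner_coefficient_norms_eq\<close>): both sums are the mean square
of \<open>|p| = |q|\<close> over the torus.

\<^item> Summing the diagonal of the defect against a weight \<open>\<phi>\<close> telescopes to
\<open>\<Sum>\<^sub>j \<Sum>\<^sub>m G\<^sub>j(m, m) (\<phi>(m) - \<phi>(m + e\<^sub>j))\<close> (\<open>weighted_trace\<close>). For decreasing \<open>\<phi>\<close> every term is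
nonnegative, so if the total vanishes then so does every term.

The degree bounds of part (1) are two applications of these facts
(\<open>degree_bounds_of_diagonal\<close>). The weight \<open>\<phi>(m) = [m\<^sub>i \<le> k]\<close> with \<open>k \<ge> d\<^sub>i\<close> sees all
of \<open>\<Sum>\<^sub>m |p\<^sub>m|\<^sup>2 - |q\<^sub>m|\<^sup>2 = 0\<close> and leaves only the terms of \<open>G\<^sub>i\<close> with \<open>m\<^sub>i = k\<close>; the weight
\<open>- |m| [m\<^sub>i > d\<^sub>i]\<close> sees no coefficient of \<open>p\<close> and \<open>q\<close> at all and kills the remaining \<open>G\<^sub>j\<close> beyond degree
\<open>d\<^sub>i\<close>.

Existence of \<open>G\<close> (\<open>exists_agler_kernels\<close>) is a finite dimensional form of Agler's separation argument.
Only multi-indices \<open>m \<le> d\<close> are kept, that is, one works modulo the monomials outside this box. Among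
all positive semidefinite \<open>G\<close>, one whose defect is closest to the desired matrix exists
by compactness. Let \<open>W\<close> be the remaining error. Minimality says that the Hermitian form \<open>S\<close> with matrix
\<open>cnj W\<close> decreases under multiplication by each \<open>z\<^sub>j\<close>; since these multiplications are nilpotent in the
truncated algebra, \<open>S\<close> is positive semidefinite. After adding a multiple of the identity, \<open>S\<close> is an inner
product for which the \<open>z\<^sub>j\<close> are commuting contractions. The Agler class property for \<open>r z\<^sub>j\<close>, applied to the
vector \<open>p(r z)\<close> that \<open>f(r z)\<close> maps to \<open>q(r z)\<close>, yields \<open>S(q, q) \<le> S(p, p)\<close> as \<open>r \<rightarrow> 1\<close>
(\<open>agler_qform_le\<close>). By minimality \<open>S(p, p) - S(q, q) \<le> - \<Sum> |W|\<^sup>2\<close>, hence \<open>W = 0\<close>.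

Within the box, the weight \<open>\<phi> = 1\<close> shows that \<open>G\<^sub>j\<close> vanishes where \<open>m\<^sub>j = d\<^sub>j\<close>. So truncation loses
nothing, the identity holds as one between polynomials, and \<open>G\<^sub>j\<close> lives on \<open>d\<^sub>j \<Prod>\<^sub>k\<^sub>\<noteq>\<^sub>j (d\<^sub>k + 1)\<close> indices. A Cholesky
factorization (\<open>psd_on_gram\<close>) writes it as a Gram matrix of that many polynomials \<open>A\<^sub>j\<^sub>k\<close>. The
defect equation then says that the coefficient vectors of \<open>(p, z\<^sub>j A\<^sub>j\<^sub>k)\<close> and of \<open>(q, A\<^sub>j\<^sub>k)\<close> have equal
Gram matrices, so an isometry \<open>V\<close> of \<open>\<complex> \<oplus> \<complex>\<^sup>N\<close> maps the former to the latter (\<open>isometry_from_equal_gram\<close>).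
Preservation of norms by \<open>V\<close> is the sum of squares decomposition; the block entries of \<open>V\<close> are the
transfer function realization (\<open>transfer_realization_of_isometry\<close>).
\<close>

section \<open>Polynomials in several variables\<close>

abbreviation cf :: "('a \<Rightarrow>\<^sub>0 'b::zero) \<Rightarrow> 'a \<Rightarrow> 'b" where
  "cf \<equiv> Poly_Mapping.lookup"

definition unit_index :: "'n \<Rightarrow> 'n multi_index" where
  "unit_index j = Poly_Mapping.single j 1"

definition index_box :: "('n \<Rightarrow> nat) \<Rightarrow> 'n multi_index set" where
  "index_box b = {m. \<forall>i. cf m i < b i}"

lemma bij_betw_index_box: "bij_betw cf (index_box b) (PiE UNIV (\<lambda>i::'n::finite. {..<b i}))"
proof (rule bij_betwI[where g = Abs_poly_mapping])
  show "cf \<in> index_box b \<rightarrow> PiE UNIV (\<lambda>i. {..<b i})"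
    by (auto simp: index_box_def)
  show "Abs_poly_mapping \<in> PiE UNIV (\<lambda>i. {..<b i}) \<rightarrow> index_box b"
    by (auto simp: index_box_def PiE_def Pi_def)
qed (simp_all add: lookup_inverse)

lemma finite_index_box [simp]: "finite (index_box (b :: 'n::finite \<Rightarrow> nat))"
  using bij_betw_finite[OF bij_betw_index_box[of b]] by (simp add: finite_PiE)

lemma card_index_box: "card (index_box (b :: 'n::finite \<Rightarrow> nat)) = (\<Prod>i\<in>UNIV. b i)"
  using bij_betw_same_card[OF bij_betw_index_box[of b]] by (simp add: card_PiE)

lemma finite_subset_index_box:
  assumes "finite (S :: 'n::finite multi_index set)"
  obtains K where "S \<subseteq> index_box (\<lambda>_. K)"
proof
  show "S \<subseteq> index_box (\<lambda>_. Suc (\<Sum>m\<in>S. \<Sum>i\<in>UNIV. cf m i))"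
  proof
    fix m assume m: "m \<in> S"
    have "cf m i \<le> (\<Sum>m\<in>S. \<Sum>i\<in>UNIV. cf m i)" for i
    proof -
      have "cf m i \<le> (\<Sum>i\<in>UNIV. cf m i)"
        by (rule member_le_sum) auto
      also have "\<dots> \<le> (\<Sum>m\<in>S. \<Sum>i\<in>UNIV. cf m i)"
        using m assms by (intro member_le_sum) auto
      finally show ?thesis .
    qed
    then show "m \<in> index_box (\<lambda>_. Suc (\<Sum>m\<in>S. \<Sum>i\<in>UNIV. cf m i))"
      by (simp add: index_box_def less_Suc_eq_le)
  qed
qed

lemma lookup_unit_index: "cf (unit_index j) i = (if i = j then 1 else 0)"
  by (simp add: unit_index_def lookup_single when_def)

lemma index_diff_add:
  assumes "\<forall>i. cf m i \<le> cf (n :: 'n multi_index) i"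
  shows "m + (n - m) = n"
  using assms by (intro poly_mapping_eqI) (simp add: lookup_add lookup_minus)

lemma unit_index_diff_add:
  assumes "cf (n :: 'n multi_index) j > 0"
  shows "n - unit_index j + unit_index j = n"
  using assms
  by (intro poly_mapping_eqI) (auto simp: lookup_add lookup_minus lookup_unit_index)

lemma poly_mapping_sum_single:
  assumes "finite S" "Poly_Mapping.keys P \<subseteq> S"
  shows "P = (\<Sum>m\<in>S. Poly_Mapping.single m (cf P m))"
proof (rule poly_mapping_eqI)
  fix k
  have "cf (\<Sum>m\<in>S. Poly_Mapping.single m (cf P m)) k = (\<Sum>m\<in>S. if m = k then cf P k else 0)"
    by (auto simp: lookup_sum lookup_single when_def intro!: sum.cong)
  also have "\<dots> = cf P k"
    using assms by (auto simp: in_keys_iff)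
  finally show "cf P k = cf (\<Sum>m\<in>S. Poly_Mapping.single m (cf P m)) k" by simp
qed

lemma lookup_single_times:
  fixes P :: "'n multi_index \<Rightarrow>\<^sub>0 'b::semiring_0"
  shows "cf (Poly_Mapping.single m a * P) n =
           (if \<forall>i. cf m i \<le> cf n i then a * cf P (n - m) else 0)"
proof -
  have eq: "m + l = n \<longleftrightarrow> (\<forall>i. cf m i \<le> cf n i) \<and> l = n - m" for l
  proof
    assume "m + l = n"
    then show "(\<forall>i. cf m i \<le> cf n i) \<and> l = n - m"
      by (auto simp: lookup_add)
  next
    assume "(\<forall>i. cf m i \<le> cf n i) \<and> l = n - m"
    then show "m + l = n" using index_diff_add by blast
  qed
  have "Poly_Mapping.single m a * P =
          (\<Sum>l\<in>Poly_Mapping.keys P. Poly_Mapping.single (m + l) (a * cf P l))"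
    using arg_cong[OF poly_mapping_sum_single[of "Poly_Mapping.keys P" P], of "\<lambda>x. Poly_Mapping.single m a * x"]
    by (simp add: sum_distrib_left mult_single)
  then have "cf (Poly_Mapping.single m a * P) n =
          (\<Sum>l\<in>Poly_Mapping.keys P. if m + l = n then a * cf P l else 0)"
    by (simp add: lookup_sum lookup_single when_def)
  also have "\<dots> = (if \<forall>i. cf m i \<le> cf n i then a * cf P (n - m) else 0)"
    unfolding eq
    by (cases "\<forall>i. cf m i \<le> cf n i") (auto simp: in_keys_iff if_distrib cong: if_cong)
  finally show ?thesis .
qed

lemma lookup_unit_index_times:
  fixes P :: "'n multi_index \<Rightarrow>\<^sub>0 'b::semiring_0"
  shows "cf (Poly_Mapping.single (unit_index j) a * P) n =
           (if cf n j > 0 then a * cf P (n - unit_index j) else 0)"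
proof -
  have "(\<forall>i. cf (unit_index j) i \<le> cf n i) \<longleftrightarrow> cf n j > 0"
    by (auto simp: lookup_unit_index)
  then show ?thesis by (simp add: lookup_single_times)
qed

lemma peval_superset:
  assumes "finite S" "Poly_Mapping.keys P \<subseteq> S"
  shows "peval P z = (\<Sum>m\<in>S. cf P m * monomial_at z m)"
  unfolding peval_def using assms
  by (intro sum.mono_neutral_left) (auto simp: in_keys_iff)

lemma peval_zero [simp]: "peval 0 z = 0"
  by (simp add: peval_def)

lemma peval_add: "peval (P + Q) z = peval P z + peval Q z"
proof -
  let ?S = "Poly_Mapping.keys P \<union> Poly_Mapping.keys Q"
  have "peval (P + Q) z = (\<Sum>m\<in>?S. cf (P + Q) m * monomial_at z m)"
    by (rule peval_superset) (use Poly_Mapping.keys_add[of P Q] in auto)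
  moreover have "peval P z = (\<Sum>m\<in>?S. cf P m * monomial_at z m)"
    "peval Q z = (\<Sum>m\<in>?S. cf Q m * monomial_at z m)"
    by (rule peval_superset; auto)+
  ultimately show ?thesis
    by (simp add: lookup_add algebra_simps sum.distrib)
qed

lemma peval_diff: "peval (P - Q) z = peval P z - peval Q z"
  using peval_add[of "P - Q" Q z] by simp

lemma peval_sum: "peval (sum F S) z = (\<Sum>x\<in>S. peval (F x) z)"
  by (induction S rule: infinite_finite_induct) (auto simp: peval_add)

lemma peval_single [simp]: "peval (Poly_Mapping.single m c) z = c * monomial_at z m"
  by (simp add: peval_def)

lemma monomial_at_add: "monomial_at z (m + n) = monomial_at z m * monomial_at z n"
  by (simp add: monomial_at_def lookup_add power_add prod.distrib)

lemma monomial_at_unit_index [simp]: "monomial_at z (unit_index j) = z $ j"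
proof -
  have "monomial_at z (unit_index j) = (\<Prod>i\<in>UNIV. if i = j then z $ j else 1)"
    unfolding monomial_at_def by (intro prod.cong) (auto simp: lookup_unit_index)
  then show ?thesis by simp
qed

lemma peval_mult: "peval (P * Q) z = peval P z * peval Q z"
proof -
  have "P * Q = (\<Sum>m\<in>Poly_Mapping.keys P. \<Sum>n\<in>Poly_Mapping.keys Q.
                   Poly_Mapping.single (m + n) (cf P m * cf Q n))"
    using arg_cong2[OF poly_mapping_sum_single[of "Poly_Mapping.keys P" P]
        poly_mapping_sum_single[of "Poly_Mapping.keys Q" Q], of "(*)"]
    by (simp add: sum_product mult_single)
  then have "peval (P * Q) z = (\<Sum>m\<in>Poly_Mapping.keys P. \<Sum>n\<in>Poly_Mapping.keys Q.
                   cf P m * cf Q n * monomial_at z (m + n))"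
    by (simp add: peval_sum)
  also have "\<dots> = peval P z * peval Q z"
    by (simp add: peval_def sum_product monomial_at_add mult_ac)
  finally show ?thesis .
qed

text \<open>
Induction on the set of variables that occur: for fixed values of the other variables the sum is a
one-variable polynomial with infinitely many zeros, so each of its coefficients vanishes, and
these coefficients are sums of the same form in fewer variables. The statement keeps the whole fibre of
indices that agree on \<open>J\<close>, because variables outside \<open>J\<close> do not separate indices.
\<close>

lemma vanishing_polynomial_fibre_sums:
  fixes A :: "complex set"
  assumes "finite J" "infinite A" "finite S"
    and "\<And>z :: 'n \<Rightarrow> complex. (\<forall>i. z i \<in> A) \<Longrightarrow> (\<Sum>m\<in>S. c m * (\<Prod>i\<in>J. z i ^ cf m i)) = 0"
  shows "(\<Sum>m\<in>{m\<in>S. \<forall>i\<in>J. cf m i = cf \<alpha> i}. c m) = 0"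
  using assms(1,3,4)
proof (induction J arbitrary: S rule: finite_induct)
  case empty
  from \<open>infinite A\<close> obtain a where "a \<in> A" by (metis finite.emptyI ex_in_conv)
  with empty.prems(2)[of "\<lambda>_. a"] show ?case by simp
next
  case (insert j J)
  let ?S = "{m\<in>S. cf m j = cf \<alpha> j}"
  have "(\<Sum>m\<in>?S. c m * (\<Prod>i\<in>J. z i ^ cf m i)) = 0" if z: "\<forall>i. z i \<in> A" for z :: "'n \<Rightarrow> complex"
  proof -
    define p where "p = (\<Sum>m\<in>S. Polynomial.monom (c m * (\<Prod>i\<in>J. z i ^ cf m i)) (cf m j))"
    have "poly p s = 0" if "s \<in> A" for s
    proof -
      have "poly p s = (\<Sum>m\<in>S. c m * (\<Prod>i\<in>insert j J. (z(j := s)) i ^ cf m i))"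
        unfolding p_def poly_sum poly_monom
      proof (intro sum.cong refl)
        fix m
        have "(\<Prod>i\<in>J. (z(j := s)) i ^ cf m i) = (\<Prod>i\<in>J. z i ^ cf m i)"
          using insert.hyps by (intro prod.cong) auto
        then show "c m * (\<Prod>i\<in>J. z i ^ cf m i) * s ^ cf m j =
                   c m * (\<Prod>i\<in>insert j J. (z(j := s)) i ^ cf m i)"
          using insert.hyps by simp
      qed
      also have "\<dots> = 0"
        by (rule insert.prems(2)) (use z that in auto)
      finally show ?thesis .
    qed
    then have "A \<subseteq> {s. poly p s = 0}" by blast
    with \<open>infinite A\<close> have "p = 0"
      using poly_roots_finite[of p] finite_subset by blast
    then have "0 = Polynomial.coeff p (cf \<alpha> j)" by simp
    also have "\<dots> = (\<Sum>m\<in>?S. c m * (\<Prod>i\<in>J. z i ^ cf m i))"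
      unfolding p_def coeff_sum coeff_monom using insert.prems(1)
      by (subst sum.inter_filter) auto
    finally show ?thesis by simp
  qed
  with insert.IH[of ?S] insert.prems(1)
  have "(\<Sum>m\<in>{m\<in>?S. \<forall>i\<in>J. cf m i = cf \<alpha> i}. c m) = 0" by simp
  then show ?case by (simp add: conj_assoc)
qed

lemma poly_identity:
  fixes P :: "'n::finite cpoly"
  assumes "infinite A" and "\<And>z. (\<forall>i. z $ i \<in> A) \<Longrightarrow> peval P z = 0"
  shows "P = 0"
proof (rule poly_mapping_eqI)
  fix \<alpha>
  have "(\<Sum>m\<in>Poly_Mapping.keys P. cf P m * (\<Prod>i\<in>UNIV. z i ^ cf m i)) = 0"
    if "\<forall>i. z i \<in> A" for z :: "'n \<Rightarrow> complex"
    using assms(2)[of "\<chi> i. z i"] that by (simp add: peval_def monomial_at_def)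
  then have "(\<Sum>m\<in>{m\<in>Poly_Mapping.keys P. \<forall>i\<in>UNIV. cf m i = cf \<alpha> i}. cf P m) = 0"
    using assms(1) by (intro vanishing_polynomial_fibre_sums) auto
  moreover have "{m\<in>Poly_Mapping.keys P. \<forall>i\<in>UNIV. cf m i = cf \<alpha> i} =
                   (if \<alpha> \<in> Poly_Mapping.keys P then {\<alpha>} else {})"
    using poly_mapping_eqI[of _ \<alpha>] by auto
  ultimately show "cf P \<alpha> = cf 0 \<alpha>"
    by (auto simp: in_keys_iff split: if_splits)
qed

section \<open>Power series on the polydisk\<close>

lemma power_series_zero_coeffs:
  fixes c :: "nat \<Rightarrow> complex"
  assumes "\<And>t. norm t < 1 \<Longrightarrow> (\<lambda>k. c k * t ^ k) sums 0"
  shows "c k = 0"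
proof -
  have "norm (1/2 :: complex) \<le> conv_radius c"
    by (rule conv_radius_geI) (use assms[of "1/2"] in \<open>auto simp: summable_def\<close>)
  then have pos: "fps_conv_radius (Abs_fps c) > 0"
    unfolding fps_conv_radius_def
    by (metis fps_nth_Abs_fps ext ereal_less(2) less_le_trans norm_divide norm_one
        norm_numeral zero_less_divide_1_iff zero_less_numeral)
  have "eventually (\<lambda>t. eval_fps (Abs_fps c) t = eval_fps 0 t) (nhds 0)"
    unfolding eventually_nhds_metric
    by (rule exI[of _ 1]) (use assms in \<open>auto simp: eval_fps_def sums_iff\<close>)
  then have "Abs_fps c = 0"
    by (intro eval_fps_eqD pos) auto
  then show ?thesis
    by (metis fps_nth_Abs_fps fps_zero_nth)
qed

definition total_degree :: "'n::finite multi_index \<Rightarrow> nat" where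
  "total_degree m = (\<Sum>i\<in>UNIV. cf m i)"

lemma total_degree_add: "total_degree (m + n) = total_degree m + total_degree n"
  by (simp add: total_degree_def lookup_add sum.distrib)

lemma total_degree_unit_index [simp]: "total_degree (unit_index j) = 1"
  by (simp add: total_degree_def lookup_unit_index)

lemma finite_total_degree: "finite {m :: 'n::finite multi_index. total_degree m = k}"
proof (rule finite_subset)
  show "{m :: 'n multi_index. total_degree m = k} \<subseteq> index_box (\<lambda>_. Suc k)"
    unfolding total_degree_def index_box_def
    by (auto simp: less_Suc_eq_le intro!: member_le_sum)
qed simp

lemma monomial_at_scale: "monomial_at (t *s w) m = t ^ total_degree m * monomial_at w m"
  by (simp add: monomial_at_def total_degree_def power_mult_distrib prod.distrib power_sum)

lemma infinite_unit_disc: "infinite {z :: complex. cmod z < 1}"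
proof -
  have "infinite (ball (0::complex) 1)"
    by (intro uncountable_infinite uncountable_ball) simp
  then show ?thesis by (simp add: ball_def dist_norm)
qed

text \<open>
Along a complex line \<open>t \<mapsto> t w\<close> the series becomes a one-variable power series whose coefficients
are the homogeneous components evaluated at \<open>w\<close>. These are polynomials, so the one-variable identity
theorem and \<open>poly_identity\<close> finish the proof.
\<close>

lemma power_series_identity:
  fixes b :: "'n::finite multi_index \<Rightarrow> complex"
  assumes "\<And>z. z \<in> polydisk \<Longrightarrow> ((\<lambda>m. b m * monomial_at z m) has_sum 0) UNIV"
  shows "b m = 0"
proof -
  define L where "L k = {m :: 'n multi_index. total_degree m = k}" for k
  define P where "P k = (\<Sum>m\<in>L k. Poly_Mapping.single m (b m))" for k
  have fin: "finite (L k)" for k unfolding L_def by (rule finite_total_degree)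
  have "peval (P k) w = 0" if w: "\<forall>i. w $ i \<in> {z. cmod z < 1}" for w k
  proof (rule power_series_zero_coeffs)
    fix t :: complex assume t: "norm t < 1"
    have "t *s w \<in> polydisk"
      using w t mult_strict_mono'[of "cmod t" 1 _ 1] by (auto simp: polydisk_def norm_mult)
    then have "((\<lambda>m. b m * monomial_at (t *s w) m) has_sum 0) UNIV" by (rule assms)
    moreover have "bij_betw snd (Sigma UNIV L) (UNIV :: 'n multi_index set)"
      by (rule bij_betwI[where g = "\<lambda>m. (total_degree m, m)"]) (auto simp: L_def)
    ultimately have "((\<lambda>x. b (snd x) * monomial_at (t *s w) (snd x)) has_sum 0) (Sigma UNIV L)"
      using has_sum_reindex_bij_betw by (metis (no_types, lifting) has_sum_cong)
    moreover have "((\<lambda>m. b (snd (k, m)) * monomial_at (t *s w) (snd (k, m)))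
                     has_sum (peval (P k) w * t ^ k)) (L k)" for k
    proof (rule has_sum_finiteI[OF fin])
      show "peval (P k) w * t ^ k = (\<Sum>m\<in>L k. b (snd (k, m)) * monomial_at (t *s w) (snd (k, m)))"
        unfolding P_def peval_sum sum_distrib_right
        by (intro sum.cong) (auto simp: L_def monomial_at_scale)
    qed
    ultimately have "((\<lambda>k. peval (P k) w * t ^ k) has_sum 0) UNIV"
      by (rule has_sum_SigmaD)
    then show "(\<lambda>k. peval (P k) w * t ^ k) sums 0" by (rule has_sum_imp_sums)
  qed
  then have "P (total_degree m) = 0"
    by (rule poly_identity[OF infinite_unit_disc])
  moreover have "cf (P (total_degree m)) m = b m"
    unfolding P_def lookup_sum using fin
    by (simp add: lookup_single when_def L_def)
  ultimately show ?thesis by simp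
qed

section \<open>Mean squares over the torus\<close>

lemma roots_of_unity_orthogonality:
  assumes "a < N" "b < N"
  shows "(\<Sum>k<N. cis (2 * pi * real k / real N) ^ a * cnj (cis (2 * pi * real k / real N) ^ b)) =
           (if a = b then of_nat N else 0)"
proof -
  define x where "x = cis (2 * pi * (real a - real b) / real N)"
  have "cis (2 * pi * real k / real N) ^ a * cnj (cis (2 * pi * real k / real N) ^ b) = x ^ k" for k
    unfolding x_def Complex.DeMoivre cis_cnj cis_mult
    by (rule arg_cong[where f = cis]) (simp add: algebra_simps diff_divide_distrib)
  then have "(\<Sum>k<N. cis (2 * pi * real k / real N) ^ a * cnj (cis (2 * pi * real k / real N) ^ b)) =
          (\<Sum>k<N. x ^ k)" by simp
  also have "\<dots> = (if a = b then of_nat N else 0)"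
  proof (cases "a = b")
    case True then show ?thesis by (simp add: x_def)
  next
    case False
    have "x \<noteq> 1"
    proof
      assume "x = 1"
      then have "cos (2 * pi * (real a - real b) / real N) = 1"
        by (metis x_def cis.sel(1) one_complex.sel(1))
      then obtain n :: int where "2 * pi * (real a - real b) / real N = real_of_int n * 2 * pi"
        unfolding cos_one_2pi_int by blast
      then have "2 * pi * ((real a - real b) / real N) = 2 * pi * n"
        by (simp add: mult_ac)
      then have "(real a - real b) / real N = n" by (simp del: times_divide_eq_right)
      then have "real a - real b = n * real N"
        using assms by (simp add: divide_eq_eq)
      then have n: "int a - int b = n * int N"
        by (metis (mono_tags, opaque_lifting) of_int_diff of_int_eq_iff of_int_mult of_int_of_nat_eq)
      then have "\<bar>n * int N\<bar> < int N" using assms by auto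
      then have "\<bar>n\<bar> * int N < 1 * int N" by (simp add: abs_mult)
      then have "\<bar>n\<bar> < 1" by (rule mult_right_less_imp_less) simp
      then have "n = 0" by simp
      with n False show False by simp
    qed
    moreover have "x ^ N = 1"
    proof -
      have "real N * (2 * pi * (real a - real b) / real N) = 2 * pi * (real a - real b)"
        using assms by (intro nonzero_mult_div_cancel_left[of "real N", unfolded times_divide_eq_right[symmetric]]) auto
      then have "x ^ N = cis (2 * pi * real a) * cnj (cis (2 * pi * real b))"
        by (simp only: x_def Complex.DeMoivre cis_cnj cis_mult) (simp add: right_diff_distrib)
      also have "\<dots> = 1" by (simp add: cis_multiple_2pi)
      finally show ?thesis .
    qed
    ultimately show ?thesis using False by (simp add: geometric_sum)
  qed
  finally show ?thesis .
qed

text \<open>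
Parseval's identity with a finite grid in place of the torus: the \<open>N\<close>-th roots of unity already separate
exponents below \<open>N\<close>, so no integration is involved. The complex radii \<open>r\<close> allow both rotating
the grid and, with real entries, evaluating at arbitrary moduli.
\<close>

lemma mean_square_on_torus_grid:
  fixes P :: "'n::finite cpoly"
  assumes "Poly_Mapping.keys P \<subseteq> index_box (\<lambda>_. N)"
  shows "(\<Sum>k\<in>PiE UNIV (\<lambda>_::'n. {..<N}).
            (cmod (peval P (\<chi> i. r $ i * cis (2 * pi * real (k i) / real N))))\<^sup>2) =
         real N ^ CARD('n) * (\<Sum>m\<in>index_box (\<lambda>_. N). (cmod (cf P m * monomial_at r m))\<^sup>2)"
proof -
  let ?w = "\<lambda>k::nat. cis (2 * pi * real k / real N)"
  let ?B = "index_box (\<lambda>_::'n. N)"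
  let ?K = "PiE UNIV (\<lambda>_::'n. {..<N})"
  let ?c = "\<lambda>m. cf P m * monomial_at r m"
  have ev: "peval P (\<chi> i. r $ i * ?w (k i)) = (\<Sum>m\<in>?B. ?c m * (\<Prod>i\<in>UNIV. ?w (k i) ^ cf m i))" for k
    by (simp add: peval_superset[OF finite_index_box assms] monomial_at_def power_mult_distrib
        prod.distrib mult.assoc)
  have orth: "(\<Sum>k\<in>?K. \<Prod>i\<in>UNIV. ?w (k i) ^ cf m i * cnj (?w (k i) ^ cf n i)) =
                (if m = n then of_nat N ^ CARD('n) else 0)" if "m \<in> ?B" "n \<in> ?B" for m n
  proof -
    have "(\<Sum>k\<in>?K. \<Prod>i\<in>UNIV. ?w (k i) ^ cf m i * cnj (?w (k i) ^ cf n i)) =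
            (\<Prod>i\<in>UNIV. \<Sum>k<N. ?w k ^ cf m i * cnj (?w k ^ cf n i))"
      by (rule prod_sum_PiE[symmetric]) auto
    also have "\<dots> = (\<Prod>i\<in>(UNIV::'n set). if cf m i = cf n i then of_nat N else 0)"
      using that by (intro prod.cong refl roots_of_unity_orthogonality) (auto simp: index_box_def)
    also have "\<dots> = (if m = n then of_nat N ^ CARD('n) else 0)"
    proof (cases "m = n")
      case False
      then obtain i where "cf m i \<noteq> cf n i" using poly_mapping_eqI[of m n] by blast
      then show ?thesis using False by (auto simp: prod_zero_iff)
    qed simp
    finally show ?thesis .
  qed
  have "complex_of_real (\<Sum>k\<in>?K. (cmod (peval P (\<chi> i. r $ i * ?w (k i))))\<^sup>2) =
          (\<Sum>k\<in>?K. \<Sum>m\<in>?B. \<Sum>n\<in>?B. ?c m * cnj (?c n) *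
             (\<Prod>i\<in>UNIV. ?w (k i) ^ cf m i * cnj (?w (k i) ^ cf n i)))"
    unfolding ev of_real_sum complex_norm_square cnj_sum sum_product
    by (simp add: prod.distrib mult_ac)
  also have "\<dots> = (\<Sum>m\<in>?B. \<Sum>n\<in>?B. \<Sum>k\<in>?K. ?c m * cnj (?c n) *
             (\<Prod>i\<in>UNIV. ?w (k i) ^ cf m i * cnj (?w (k i) ^ cf n i)))"
    by (subst sum.swap, intro sum.cong refl, rule sum.swap)
  also have "\<dots> = (\<Sum>m\<in>?B. \<Sum>n\<in>?B. ?c m * cnj (?c n) * (if m = n then of_nat N ^ CARD('n) else 0))"
    by (intro sum.cong refl) (simp only: orth flip: sum_distrib_left)
  also have "\<dots> = (\<Sum>m\<in>?B. ?c m * cnj (?c m) * of_nat N ^ CARD('n))"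
    by (simp add: if_distrib cong: if_cong)
  also have "\<dots> = complex_of_real (real N ^ CARD('n) * (\<Sum>m\<in>?B. (cmod (?c m))\<^sup>2))"
    unfolding of_real_mult of_real_sum complex_norm_square
    by (simp add: sum_distrib_left mult_ac)
  finally show ?thesis using of_real_eq_iff by blast
qed

text \<open>
A nonempty open set of angles has positive measure. Only angles in the interior of the parameter cube
are considered, as they have neighbourhoods inside the cube.
\<close>

lemma continuous_zero_of_AE_torus:
  fixes g :: "complex ^ 'n::finite \<Rightarrow> real"
  assumes ae: "AE z in torus_measure. g z = 0" and g: "continuous_on UNIV g"
    and t: "\<And>j. 0 < t $ j" "\<And>j. t $ j < 2 * pi"
  shows "g (\<chi> j. cis (t $ j)) = 0"
proof (rule ccontr)
  let ?e = "\<lambda>t :: real ^ 'n. (\<chi> j. cis (t $ j)) :: complex ^ 'n"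
  let ?C = "cbox 0 (\<chi> j. 2 * pi) :: (real ^ 'n) set"
  let ?D = "box 0 (\<chi> j. 2 * pi) :: (real ^ 'n) set"
  assume nz: "g (?e t) \<noteq> 0"
  have [measurable]: "g \<in> borel_measurable borel"
    using g by (rule borel_measurable_continuous_onI)
  have cont: "continuous_on UNIV (\<lambda>t. g (?e t))"
    by (rule continuous_on_compose2[OF g]) (auto simp: cis_conv_exp intro!: continuous_intros)
  have "AE t in restrict_space lborel ?C. g (?e t) = 0"
    using ae unfolding torus_measure_def by (subst (asm) AE_distr_iff) auto
  then have ae': "AE t in lborel. t \<in> ?C \<longrightarrow> g (?e t) = 0"
    by (subst (asm) AE_restrict_space_iff) auto
  let ?U = "?D \<inter> {t. g (?e t) \<noteq> 0}"
  have "open {t. g (?e t) \<noteq> 0}"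
    using cont by (intro open_Collect_neq continuous_intros) auto
  then have "open ?U" by (intro open_Int open_box)
  moreover have "t \<in> ?U" using t nz by (auto simp: mem_box_cart)
  ultimately obtain a b where ab: "t \<in> box a b" "box a b \<subseteq> ?U"
    by (metis open_contains_box)
  have "AE t in lborel. t \<notin> box a b"
    using ae' by (rule AE_mp) (use ab(2) box_subset_cbox in \<open>auto intro!: AE_I2\<close>)
  then have "box a b \<in> null_sets lborel"
    by (subst AE_iff_null_sets) auto
  then have "negligible (box a b)"
    by (simp add: negligible_iff_null_sets null_sets_completionI)
  then show False using ab(1) by (simp add: negligible_interval)
qed

lemma continuous_on_peval: "continuous_on UNIV (peval P)"
  unfolding peval_def monomial_at_def by (intro continuous_intros)

text \<open>
The fraction \<open>q/p\<close> may differ from the one that witnesses innerness, but cross-multiplication shows that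
\<open>|p| = |q|\<close> still holds almost everywhere on the torus, hence at each point of a grid that avoids the
angle \<open>0\<close>. Averaging over the grid turns this into the equality of the coefficient norms.
\<close>

lemma inner_coefficient_norms_eq:
  fixes p q :: "'n::finite cpoly"
  assumes inner: "rational_inner f"
    and p_nz: "\<forall>z\<in>polydisk. peval p z \<noteq> 0"
    and f_eq: "\<forall>z\<in>polydisk. f z = peval q z / peval p z"
    and keys: "Poly_Mapping.keys p \<subseteq> S" "Poly_Mapping.keys q \<subseteq> S" "finite S"
  shows "(\<Sum>m\<in>S. (cmod (cf p m))\<^sup>2) = (\<Sum>m\<in>S. (cmod (cf q m))\<^sup>2)"
proof -
  obtain q' p' where p'_nz: "\<forall>z\<in>polydisk. peval p' z \<noteq> 0"
    and f_eq': "\<forall>z\<in>polydisk. f z = peval q' z / peval p' z"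
    and ae: "AE z in torus_measure. cmod (peval q' z / peval p' z) = 1"
    using inner unfolding rational_inner_def by blast
  have "q * p' - q' * p = 0"
  proof (rule poly_identity[OF infinite_unit_disc])
    fix z :: "complex ^ 'n" assume "\<forall>i. z $ i \<in> {z. cmod z < 1}"
    then have z: "z \<in> polydisk" by (simp add: polydisk_def)
    then have "peval q z / peval p z = peval q' z / peval p' z"
      using f_eq f_eq' by auto
    then show "peval (q * p' - q' * p) z = 0"
      using z p_nz p'_nz by (simp add: peval_diff peval_mult field_simps)
  qed
  then have cross: "peval q z * peval p' z = peval q' z * peval p z" for z
    by (metis peval_mult right_minus_eq)
  have ae': "AE z in torus_measure. (cmod (peval p z))\<^sup>2 - (cmod (peval q z))\<^sup>2 = 0"
    using ae
  proof (rule AE_mp, intro AE_I2 impI)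
    fix z :: "complex ^ 'n" assume a: "cmod (peval q' z / peval p' z) = 1"
    then have "peval p' z \<noteq> 0" by auto
    with a have "cmod (peval q' z) = cmod (peval p' z)" "cmod (peval p' z) \<noteq> 0"
      by (auto simp: norm_divide)
    moreover have "cmod (peval q z) * cmod (peval p' z) = cmod (peval q' z) * cmod (peval p z)"
      using cross[of z] by (metis norm_mult)
    ultimately show "(cmod (peval p z))\<^sup>2 - (cmod (peval q z))\<^sup>2 = 0" by simp
  qed
  obtain K where K: "S \<subseteq> index_box (\<lambda>_. K)" using finite_subset_index_box keys(3) by blast
  define N where "N = Suc K"
  have N: "S \<subseteq> index_box (\<lambda>_. N)" using K by (auto simp: N_def index_box_def intro!: less_SucI)
  \<comment> \<open>Half a grid step of rotation keeps all angles strictly between \<open>0\<close> and \<open>2\<pi>\<close>.\<close>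
  define r :: "complex ^ 'n" where "r = (\<chi> i. cis (pi / real N))"
  have rm: "cmod (monomial_at r m) = 1" for m
    by (simp add: monomial_at_def r_def norm_power flip: prod_norm)
  have mean: "(\<Sum>k\<in>PiE UNIV (\<lambda>_::'n. {..<N}).
            (cmod (peval P (\<chi> i. r $ i * cis (2 * pi * real (k i) / real N))))\<^sup>2) =
         real N ^ CARD('n) * (\<Sum>m\<in>S. (cmod (cf P m))\<^sup>2)" if P: "Poly_Mapping.keys P \<subseteq> S" for P
  proof -
    have "(\<Sum>m\<in>S. (cmod (cf P m))\<^sup>2) = (\<Sum>m\<in>index_box (\<lambda>_. N). (cmod (cf P m))\<^sup>2)"
      using P N by (intro sum.mono_neutral_left) (auto simp: in_keys_iff)
    then show ?thesis
      using mean_square_on_torus_grid[of P N r] P N by (simp add: norm_mult rm)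
  qed
  have "(cmod (peval p (\<chi> i. r $ i * cis (2 * pi * real (k i) / real N))))\<^sup>2 =
        (cmod (peval q (\<chi> i. r $ i * cis (2 * pi * real (k i) / real N))))\<^sup>2"
    if k: "k \<in> PiE UNIV (\<lambda>_::'n. {..<N})" for k
  proof -
    define t :: "real ^ 'n" where "t = (\<chi> i. pi * (2 * real (k i) + 1) / real N)"
    have "2 * real (k j) + 1 < 2 * real N" for j
    proof -
      have "k j < N" using k by auto
      then show ?thesis by linarith
    qed
    then have "pi * (2 * real (k j) + 1) < pi * (2 * real N)" for j
      by (intro mult_strict_left_mono) auto
    moreover have "0 < pi * (2 * real (k j) + 1)" for j
      by (intro mult_pos_pos) auto
    ultimately have t: "0 < t $ j" "t $ j < 2 * pi" for j
      by (simp_all add: t_def N_def pos_divide_less_eq mult_ac)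
    have "(cmod (peval p (\<chi> j. cis (t $ j))))\<^sup>2 - (cmod (peval q (\<chi> j. cis (t $ j))))\<^sup>2 = 0"
      by (rule continuous_zero_of_AE_torus[OF ae' _ t])
        (intro continuous_intros continuous_on_peval)
    moreover have "(\<chi> j. cis (t $ j)) = (\<chi> i. r $ i * cis (2 * pi * real (k i) / real N))"
      by (simp add: vec_eq_iff t_def r_def cis_mult add_divide_distrib ring_distribs mult_ac add_ac)
    ultimately show ?thesis by simp
  qed
  then have "real N ^ CARD('n) * (\<Sum>m\<in>S. (cmod (cf p m))\<^sup>2) =
             real N ^ CARD('n) * (\<Sum>m\<in>S. (cmod (cf q m))\<^sup>2)"
    unfolding mean[OF keys(1), symmetric] mean[OF keys(2), symmetric] by (rule sum.cong[OF refl])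
  then show ?thesis by (simp add: N_def)
qed

section \<open>Telescoping sums of diagonal coefficients\<close>

text \<open>
If \<open>G j\<close> is the coefficient matrix of a kernel \<open>K\<^sub>j(z, \<zeta>)\<close>, this is the coefficient matrix of
\<open>\<Sum>\<^sub>j (1 - z\<^sub>j \<cdot> cnj \<zeta>\<^sub>j) K\<^sub>j(z, \<zeta>)\<close>.
\<close>

definition defect ::
  "('n::finite \<Rightarrow> 'n multi_index \<Rightarrow> 'n multi_index \<Rightarrow> complex) \<Rightarrow>
     'n multi_index \<Rightarrow> 'n multi_index \<Rightarrow> complex" where
  "defect G m n = (\<Sum>j\<in>UNIV. G j m n -
     (if 0 < cf m j \<and> 0 < cf n j then G j (m - unit_index j) (n - unit_index j) else 0))"

text \<open>
Summation by parts: the shift \<open>m \<mapsto> m + e\<^sub>j\<close> moves from \<open>g\<close> to \<open>\<phi>\<close>. A shift that leaves the box contributes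
nothing, so \<open>\<phi>\<close> is continued by \<open>0\<close> outside.
\<close>

lemma weighted_trace:
  fixes g :: "'n::finite \<Rightarrow> 'n multi_index \<Rightarrow> 'a::comm_ring_1"
  shows "(\<Sum>m\<in>index_box b. \<phi> m *
            (\<Sum>j\<in>UNIV. g j m - (if 0 < cf m j then g j (m - unit_index j) else 0))) =
         (\<Sum>j\<in>UNIV. \<Sum>m\<in>index_box b. g j m *
            (\<phi> m - (if m + unit_index j \<in> index_box b then \<phi> (m + unit_index j) else 0)))"
proof -
  let ?B = "index_box b"
  have shift: "(\<Sum>m\<in>?B. \<phi> m * (if 0 < cf m j then g j (m - unit_index j) else 0)) =
          (\<Sum>m\<in>?B. g j m * (if m + unit_index j \<in> ?B then \<phi> (m + unit_index j) else 0))" for j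
  proof -
    have "(\<Sum>m\<in>?B. \<phi> m * (if 0 < cf m j then g j (m - unit_index j) else 0)) =
            (\<Sum>m\<in>{m\<in>?B. 0 < cf m j}. \<phi> m * g j (m - unit_index j))"
      by (simp add: sum.inter_filter if_distrib cong: if_cong)
    also have "\<dots> = (\<Sum>m\<in>{m\<in>?B. m + unit_index j \<in> ?B}. g j m * \<phi> (m + unit_index j))"
    proof (rule sum.reindex_bij_witness[where i = "\<lambda>m. m + unit_index j" and j = "\<lambda>m. m - unit_index j"])
      fix m assume m: "m \<in> {m\<in>?B. 0 < cf m j}"
      then show eq: "m - unit_index j + unit_index j = m"
        by (intro unit_index_diff_add) simp
      show "m - unit_index j \<in> {m\<in>?B. m + unit_index j \<in> ?B}"
        using m unfolding mem_Collect_eq eq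
        by (auto simp: index_box_def lookup_minus intro: le_less_trans[OF diff_le_self])
      show "g j (m - unit_index j) * \<phi> (m - unit_index j + unit_index j) = \<phi> m * g j (m - unit_index j)"
        unfolding eq by (rule mult.commute)
    qed (auto simp: lookup_add lookup_unit_index)
    also have "\<dots> = (\<Sum>m\<in>?B. g j m * (if m + unit_index j \<in> ?B then \<phi> (m + unit_index j) else 0))"
      by (simp add: sum.inter_filter if_distrib cong: if_cong)
    finally show ?thesis .
  qed
  have "(\<Sum>m\<in>?B. \<phi> m *
            (\<Sum>j\<in>UNIV. g j m - (if 0 < cf m j then g j (m - unit_index j) else 0))) =
        (\<Sum>j\<in>UNIV. (\<Sum>m\<in>?B. \<phi> m * g j m) -
            (\<Sum>m\<in>?B. \<phi> m * (if 0 < cf m j then g j (m - unit_index j) else 0)))"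
    unfolding sum_distrib_left right_diff_distrib by (subst sum.swap) (simp add: sum_subtractf)
  also have "\<dots> = (\<Sum>j\<in>UNIV. \<Sum>m\<in>?B. g j m *
            (\<phi> m - (if m + unit_index j \<in> ?B then \<phi> (m + unit_index j) else 0)))"
    unfolding shift right_diff_distrib sum_subtractf by (simp add: mult.commute)
  finally show ?thesis .
qed

lemma defect_diagonal:
  "defect G m m = (\<Sum>j\<in>UNIV. G j m m -
     (if 0 < cf m j then G j (m - unit_index j) (m - unit_index j) else 0))"
  by (simp add: defect_def)

lemma scaled_sum_swap:
  fixes w :: "'a::comm_semiring_0"
  shows "(\<Sum>k\<in>S. w * (\<Sum>l\<in>T. X l k)) = w * (\<Sum>l\<in>T. \<Sum>k\<in>S. X l k)"
proof -
  have "(\<Sum>k\<in>S. w * (\<Sum>l\<in>T. X l k)) = w * (\<Sum>k\<in>S. \<Sum>l\<in>T. X l k)"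
    by (simp only: sum_distrib_left)
  also have "(\<Sum>k\<in>S. \<Sum>l\<in>T. X l k) = (\<Sum>l\<in>T. \<Sum>k\<in>S. X l k)" by (rule sum.swap)
  finally show ?thesis .
qed

text \<open>
Averaging the sum of squares identity over tori of all radii \<open>r\<close> leaves only the diagonal
coefficients: both sides become polynomials in \<open>z\<^sub>i = r\<^sub>i\<^sup>2\<close> that agree for all positive \<open>z\<close>, hence have the
same coefficients.
\<close>

lemma sos_decomposition_diagonal_coeffs:
  fixes p q :: "'n::finite cpoly"
  assumes "sos_decomposition p q N A"
  shows "(cmod (cf p m))\<^sup>2 - (cmod (cf q m))\<^sup>2 =
    (\<Sum>j\<in>UNIV. (\<Sum>k=1..N j. (cmod (cf (A j k) m))\<^sup>2) -
       (if 0 < cf m j then \<Sum>k=1..N j. (cmod (cf (A j k) (m - unit_index j)))\<^sup>2 else 0))"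
proof -
  define g where "g j m = (\<Sum>k=1..N j. (cmod (cf (A j k) m))\<^sup>2)" for j m
  define S where "S = insert m (Poly_Mapping.keys p \<union> Poly_Mapping.keys q \<union>
                       (\<Union>j\<in>UNIV. \<Union>k\<in>{1..N j}. Poly_Mapping.keys (A j k)))"
  have "finite S" by (simp add: S_def)
  then obtain K where K: "S \<subseteq> index_box (\<lambda>_. K)" using finite_subset_index_box by blast
  let ?B = "index_box (\<lambda>_::'n. K)"
  have K_pos: "K > 0"
    using K by (auto simp: S_def index_box_def)
  define C where "C = (\<Sum>m\<in>?B. Poly_Mapping.single m (complex_of_real ((cmod (cf p m))\<^sup>2 - (cmod (cf q m))\<^sup>2)))"
  define H where "H j = (\<Sum>m\<in>?B. Poly_Mapping.single m (complex_of_real (g j m)))" for j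
  have "C - (\<Sum>j\<in>UNIV. H j - Poly_Mapping.single (unit_index j) 1 * H j) = 0"
  proof (rule poly_identity)
    show "infinite (complex_of_real ` {0<..})"
      by (simp add: finite_image_iff inj_on_def infinite_Ioi)
    fix z :: "complex ^ 'n" assume z: "\<forall>i. z $ i \<in> complex_of_real ` {0<..}"
    define r :: "complex ^ 'n" where "r = (\<chi> i. complex_of_real (sqrt (Re (z $ i))))"
    have zr: "z $ i = complex_of_real ((cmod (r $ i))\<^sup>2)" for i
    proof -
      from z[rule_format, of i] obtain x where "x > 0" "z $ i = complex_of_real x" by auto
      then show ?thesis by (simp add: r_def)
    qed
    have mono: "complex_of_real ((cmod (monomial_at r m))\<^sup>2) = monomial_at z m" for m
    proof -
      have "(cmod (monomial_at r m))\<^sup>2 = (\<Prod>i\<in>UNIV. (cmod (r $ i) ^ cf m i)\<^sup>2)"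
        unfolding monomial_at_def prod_norm[symmetric] norm_power by (rule prod_power_distrib)
      also have "\<dots> = (\<Prod>i\<in>UNIV. ((cmod (r $ i))\<^sup>2) ^ cf m i)"
        by (intro prod.cong refl) (metis power_mult mult.commute)
      finally show ?thesis by (simp add: monomial_at_def zr)
    qed
    let ?z = "\<lambda>k. \<chi> i. r $ i * cis (2 * pi * real (k i) / real K)"
    let ?G = "PiE UNIV (\<lambda>_::'n. {..<K})"
    let ?D = "complex_of_nat K ^ CARD('n)"
    have mean: "complex_of_real (\<Sum>k\<in>?G. (cmod (peval P (?z k)))\<^sup>2) =
             ?D * (\<Sum>m\<in>?B. complex_of_real ((cmod (cf P m))\<^sup>2) * monomial_at z m)"
      if P: "Poly_Mapping.keys P \<subseteq> S" for P
    proof -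
      have "Poly_Mapping.keys P \<subseteq> ?B" using P K by blast
      then show ?thesis
        by (subst mean_square_on_torus_grid) (simp_all add: norm_mult power_mult_distrib flip: mono)
    qed
    have "complex_of_real (\<Sum>k\<in>?G. (cmod (peval p (?z k)))\<^sup>2 - (cmod (peval q (?z k)))\<^sup>2) =
          complex_of_real (\<Sum>k\<in>?G. \<Sum>j\<in>UNIV. (1 - (cmod (?z k $ j))\<^sup>2) *
             (\<Sum>l=1..N j. (cmod (peval (A j l) (?z k)))\<^sup>2))"
      using assms unfolding sos_decomposition_def by simp
    also have "(\<Sum>k\<in>?G. \<Sum>j\<in>UNIV. (1 - (cmod (?z k $ j))\<^sup>2) *
             (\<Sum>l=1..N j. (cmod (peval (A j l) (?z k)))\<^sup>2)) =
          (\<Sum>j\<in>UNIV. (1 - (cmod (r $ j))\<^sup>2) *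
             (\<Sum>l=1..N j. \<Sum>k\<in>?G. (cmod (peval (A j l) (?z k)))\<^sup>2))"
    proof -
      have "(\<Sum>k\<in>?G. (1 - (cmod (?z k $ j))\<^sup>2) * (\<Sum>l=1..N j. (cmod (peval (A j l) (?z k)))\<^sup>2)) =
              (1 - (cmod (r $ j))\<^sup>2) * (\<Sum>l=1..N j. \<Sum>k\<in>?G. (cmod (peval (A j l) (?z k)))\<^sup>2)" for j
      proof -
        have "cmod (?z k $ j) = cmod (r $ j)" for k by (simp add: norm_mult)
        then show ?thesis by (simp only: scaled_sum_swap)
      qed
      then show ?thesis
        by (rule trans[OF sum.swap sum.cong[OF refl]])
    qed
    also have "complex_of_real \<dots> = (\<Sum>j\<in>UNIV. (1 - z $ j) *
             (\<Sum>l=1..N j. complex_of_real (\<Sum>k\<in>?G. (cmod (peval (A j l) (?z k)))\<^sup>2)))"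
      by (simp add: zr)
    also have "\<dots> = (\<Sum>j\<in>UNIV. (1 - z $ j) * (\<Sum>l=1..N j.
             ?D * (\<Sum>m\<in>?B. complex_of_real ((cmod (cf (A j l) m))\<^sup>2) * monomial_at z m)))"
      by (intro sum.cong refl arg_cong2[where f = "(*)"] mean) (auto simp: S_def)
    also have "\<dots> = ?D * (\<Sum>j\<in>UNIV. (1 - z $ j) * (\<Sum>m\<in>?B. complex_of_real (g j m) * monomial_at z m))"
    proof -
      have "(\<Sum>l=1..N j. ?D * (\<Sum>m\<in>?B. complex_of_real ((cmod (cf (A j l) m))\<^sup>2) * monomial_at z m)) =
              ?D * (\<Sum>m\<in>?B. complex_of_real (g j m) * monomial_at z m)" for j
      proof -
        have "(\<Sum>l=1..N j. \<Sum>m\<in>?B. complex_of_real ((cmod (cf (A j l) m))\<^sup>2) * monomial_at z m) =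
                (\<Sum>m\<in>?B. complex_of_real (g j m) * monomial_at z m)"
          unfolding g_def of_real_sum sum_distrib_right by (rule sum.swap)
        then show ?thesis by (simp only: sum_distrib_left[of ?D, symmetric])
      qed
      then show ?thesis by (simp only: sum_distrib_left[of ?D] mult.left_commute[of ?D])
    qed
    also have "\<dots> = ?D * (\<Sum>j\<in>UNIV. (1 - z $ j) * peval (H j) z)"
      by (simp add: H_def peval_sum)
    finally have eq: "complex_of_real (\<Sum>k\<in>?G. (cmod (peval p (?z k)))\<^sup>2 - (cmod (peval q (?z k)))\<^sup>2) =
        ?D * (\<Sum>j\<in>UNIV. (1 - z $ j) * peval (H j) z)" .
    have "complex_of_real (\<Sum>k\<in>?G. (cmod (peval p (?z k)))\<^sup>2 - (cmod (peval q (?z k)))\<^sup>2) =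
        complex_of_real (\<Sum>k\<in>?G. (cmod (peval p (?z k)))\<^sup>2) -
        complex_of_real (\<Sum>k\<in>?G. (cmod (peval q (?z k)))\<^sup>2)"
      by (simp add: sum_subtractf)
    also have "\<dots> = ?D * (\<Sum>m\<in>?B. complex_of_real ((cmod (cf p m))\<^sup>2) * monomial_at z m) -
        ?D * (\<Sum>m\<in>?B. complex_of_real ((cmod (cf q m))\<^sup>2) * monomial_at z m)"
      by (intro arg_cong2[where f = "(-)"] mean) (auto simp: S_def)
    also have "\<dots> = ?D * peval C z"
      by (simp add: C_def peval_sum sum_subtractf algebra_simps)
    finally have "?D * peval C z = ?D * (\<Sum>j\<in>UNIV. (1 - z $ j) * peval (H j) z)"
      using eq by simp
    then have "peval C z = (\<Sum>j\<in>UNIV. (1 - z $ j) * peval (H j) z)"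
      using K_pos by simp
    then show "peval (C - (\<Sum>j\<in>UNIV. H j - Poly_Mapping.single (unit_index j) 1 * H j)) z = 0"
      by (simp add: peval_diff peval_sum peval_mult algebra_simps)
  qed
  then have "cf C m = cf (\<Sum>j\<in>UNIV. H j - Poly_Mapping.single (unit_index j) 1 * H j) m"
    by simp
  moreover have m: "m \<in> ?B" using K by (auto simp: S_def)
  moreover have "cf C m = complex_of_real ((cmod (cf p m))\<^sup>2 - (cmod (cf q m))\<^sup>2)"
    using m by (simp add: C_def lookup_sum lookup_single when_def)
  moreover have H: "cf (H j) l = complex_of_real (g j l)" if "l \<in> ?B" for j l
    using that by (simp add: H_def lookup_sum lookup_single when_def)
  moreover have "m - unit_index j \<in> ?B" for j
    using m by (auto simp: index_box_def lookup_minus intro: le_less_trans[OF diff_le_self])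
  ultimately have "complex_of_real ((cmod (cf p m))\<^sup>2 - (cmod (cf q m))\<^sup>2) =
      complex_of_real (\<Sum>j\<in>UNIV. g j m - (if 0 < cf m j then g j (m - unit_index j) else 0))"
    by (simp add: lookup_sum lookup_minus lookup_unit_index_times if_distrib cong: if_cong)
  then show ?thesis unfolding g_def of_real_eq_iff .
qed

text \<open>
Here \<open>g j m\<close> stands for the diagonal entry \<open>\<Sum>\<^sub>k |A\<^sub>j\<^sub>k\<^sub>,\<^sub>m|\<^sup>2\<close> and \<open>c m\<close> for \<open>|p\<^sub>m|\<^sup>2 - |q\<^sub>m|\<^sup>2\<close>. Each bound comes from a
weight \<open>\<phi>\<close> that is nonincreasing along all shifts and against which \<open>c\<close> sums to zero: \<open>g j m\<close> must vanish wherever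
\<open>\<phi>\<close> drops strictly from \<open>m\<close> to \<open>m + e\<^sub>j\<close>.
\<close>

lemma degree_bounds_of_diagonal:
  fixes g :: "'n::finite \<Rightarrow> 'n multi_index \<Rightarrow> real"
  assumes nonneg: "\<And>j m. 0 \<le> g j m"
    and fin: "finite {m. \<exists>j. g j m \<noteq> 0}"
    and diag: "\<And>m. c m = (\<Sum>j\<in>UNIV. g j m - (if 0 < cf m j then g j (m - unit_index j) else 0))"
    and supp: "\<And>m. c m \<noteq> 0 \<Longrightarrow> m \<in> index_box (\<lambda>i. d i + 1)"
    and total: "(\<Sum>m\<in>index_box (\<lambda>i. d i + 1). c m) = 0"
    and nz: "g j m \<noteq> 0"
  shows "cf m i < (if i = j then d i else d i + 1)"
proof -
  obtain K0 where K0: "{m. \<exists>j. g j m \<noteq> 0} \<union> index_box (\<lambda>i. d i + 1) \<subseteq> index_box (\<lambda>_. K0)"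
    using finite_subset_index_box fin by (metis finite_Un finite_index_box)
  \<comment> \<open>One more than the support needs, so that no shift of a nonzero entry leaves the box.\<close>
  let ?B = "index_box (\<lambda>_::'n. Suc K0)"
  have sub: "index_box (\<lambda>_. K0) \<subseteq> ?B" by (auto simp: index_box_def less_SucI)
  have interior: "l + unit_index k \<in> ?B" if "g j' l \<noteq> 0" for l k j'
  proof -
    have "l \<in> index_box (\<lambda>_. K0)" using that K0 by blast
    then show ?thesis by (auto simp: index_box_def lookup_add lookup_unit_index less_SucI)
  qed
  have trace: "(\<Sum>m\<in>?B. \<phi> m * c m) = (\<Sum>j\<in>UNIV. \<Sum>m\<in>?B. g j m * (\<phi> m - \<phi> (m + unit_index j)))" for \<phi>
  proof -
    have "(\<Sum>m\<in>?B. \<phi> m * c m) = (\<Sum>j\<in>UNIV. \<Sum>m\<in>?B. g j m *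
            (\<phi> m - (if m + unit_index j \<in> ?B then \<phi> (m + unit_index j) else 0)))"
      unfolding diag by (rule weighted_trace)
    also have "\<dots> = (\<Sum>j\<in>UNIV. \<Sum>m\<in>?B. g j m * (\<phi> m - \<phi> (m + unit_index j)))"
    proof (intro sum.cong refl)
      fix j m
      show "g j m * (\<phi> m - (if m + unit_index j \<in> ?B then \<phi> (m + unit_index j) else 0)) =
            g j m * (\<phi> m - \<phi> (m + unit_index j))"
        by (cases "g j m = 0") (simp_all add: interior)
    qed
    finally show ?thesis .
  qed
  have vanish: "g j m * (\<phi> m - \<phi> (m + unit_index j)) = 0"
    if zero: "(\<Sum>m\<in>?B. \<phi> m * c m) = 0"
      and mono: "\<And>j m. 0 \<le> g j m * (\<phi> m - \<phi> (m + unit_index j))" for \<phi> j m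
  proof (cases "g j m = 0")
    case False
    then have m: "m \<in> ?B" using K0 sub by blast
    have "(\<Sum>j\<in>UNIV. \<Sum>m\<in>?B. g j m * (\<phi> m - \<phi> (m + unit_index j))) = 0"
      using zero trace by simp
    then have "(\<Sum>m\<in>?B. g j m * (\<phi> m - \<phi> (m + unit_index j))) = 0"
      by (subst (asm) sum_nonneg_eq_0_iff) (auto intro!: sum_nonneg mono)
    then show ?thesis
      using m by (subst (asm) sum_nonneg_eq_0_iff) (auto intro!: mono)
  qed simp
  have own: "cf m j < d j" if nz: "g j m \<noteq> 0" for j m
  proof (rule ccontr)
    assume k: "\<not> cf m j < d j"
    define \<phi> :: "'n multi_index \<Rightarrow> real" where "\<phi> l = (if cf l j \<le> cf m j then 1 else 0)" for l
    have "(\<Sum>l\<in>?B. \<phi> l * c l) = (\<Sum>l\<in>?B. c l)"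
    proof (intro sum.cong refl)
      fix l
      have "cf l j \<le> cf m j" if "c l \<noteq> 0"
      proof -
        have "cf l j < d j + 1" using supp[OF that] by (simp add: index_box_def)
        then show ?thesis using k by simp
      qed
      then show "\<phi> l * c l = c l" by (auto simp: \<phi>_def)
    qed
    also have "\<dots> = (\<Sum>l\<in>index_box (\<lambda>i. d i + 1). c l)"
      using supp K0 sub by (intro sum.mono_neutral_right) auto
    finally have zero: "(\<Sum>l\<in>?B. \<phi> l * c l) = 0" using total by simp
    have "g j m * (\<phi> m - \<phi> (m + unit_index j)) = 0"
      by (rule vanish[OF zero])
        (auto simp: \<phi>_def lookup_add intro!: mult_nonneg_nonneg nonneg)
    with nz show False by (simp add: \<phi>_def lookup_add lookup_unit_index)
  qed
  have other: "cf m i < d i + 1" if ij: "i \<noteq> j" and nz: "g j m \<noteq> 0" for i j m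
  proof (rule ccontr)
    assume k: "\<not> cf m i < d i + 1"
    define \<phi> :: "'n multi_index \<Rightarrow> real" where
      "\<phi> l = (if cf l i > d i then - real (total_degree l) else 0)" for l
    have "(\<Sum>l\<in>?B. \<phi> l * c l) = (\<Sum>l\<in>?B. 0)"
    proof (intro sum.cong refl)
      fix l
      have "cf l i < d i + 1" if "c l \<noteq> 0" using supp[OF that] by (simp add: index_box_def)
      then show "\<phi> l * c l = 0" by (force simp: \<phi>_def)
    qed
    then have zero: "(\<Sum>l\<in>?B. \<phi> l * c l) = 0" by simp
    have mono: "0 \<le> g j' l * (\<phi> l - \<phi> (l + unit_index j'))" for j' l
      by (rule mult_nonneg_nonneg[OF nonneg])
        (auto simp: \<phi>_def lookup_add lookup_unit_index total_degree_add)
    have "g j m * (\<phi> m - \<phi> (m + unit_index j)) = 0"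
      by (rule vanish[OF zero mono])
    with nz k ij show False by (simp add: \<phi>_def lookup_add lookup_unit_index total_degree_add)
  qed
  show ?thesis using own[OF nz] other[OF _ nz] by auto
qed

section \<open>Finite dimensional Hilbert spaces of sequences\<close>

definition coord_space :: "nat \<Rightarrow> cseq set" where
  "coord_space N = {x. \<forall>i\<ge>N. x i = 0}"

definition mat_ip :: "nat \<Rightarrow> (nat \<Rightarrow> nat \<Rightarrow> complex) \<Rightarrow> cseq \<Rightarrow> cseq \<Rightarrow> complex" where
  "mat_ip N M x y = (\<Sum>i<N. \<Sum>k<N. M i k * x i * cnj (y k))"

lemma subspace_coord_space: "cvec.subspace (coord_space N)"
  by (auto simp: cvec.subspace_def coord_space_def cscale_def)

text \<open>
Together with coercivity this makes the norm of \<open>mat_ip\<close> equivalent to the Euclidean one, which is what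
boundedness of linear operators rests on.
\<close>

lemma mat_ip_upper_bound:
  "Re (mat_ip N M x x) \<le> (\<Sum>i<N. \<Sum>k<N. cmod (M i k)) * (\<Sum>i<N. (cmod (x i))\<^sup>2)"
proof -
  let ?s = "\<Sum>i<N. (cmod (x i))\<^sup>2"
  have le: "cmod (x i) \<le> sqrt ?s" if "i < N" for i
    by (rule real_le_rsqrt) (use that in \<open>auto intro!: member_le_sum\<close>)
  have s0: "0 \<le> ?s" by (intro sum_nonneg) auto
  have "Re (mat_ip N M x x) \<le> cmod (mat_ip N M x x)" by (rule complex_Re_le_cmod)
  also have "\<dots> \<le> (\<Sum>i<N. \<Sum>k<N. cmod (M i k * x i * cnj (x k)))"
    unfolding mat_ip_def by (intro order_trans[OF norm_sum] sum_mono order_refl)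
  also have "\<dots> \<le> (\<Sum>i<N. \<Sum>k<N. cmod (M i k) * ?s)"
  proof (intro sum_mono)
    fix i k assume ik: "i \<in> {..<N}" "k \<in> {..<N}"
    have "cmod (x i) * cmod (x k) \<le> sqrt ?s * sqrt ?s"
      using ik s0 by (intro mult_mono le) auto
    also have "\<dots> = ?s" using s0 by simp
    finally show "cmod (M i k * x i * cnj (x k)) \<le> cmod (M i k) * ?s"
      by (simp add: norm_mult mult.assoc mult_left_mono)
  qed
  also have "\<dots> = (\<Sum>i<N. \<Sum>k<N. cmod (M i k)) * ?s"
    by (simp add: sum_distrib_right)
  finally show ?thesis .
qed

lemma mat_ip_cscale: "mat_ip N M (cscale c x) (cscale c y) = complex_of_real ((cmod c)\<^sup>2) * mat_ip N M x y"
  unfolding mat_ip_def complex_norm_square sum_distrib_left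
  by (simp add: cscale_def mult_ac)

lemma ip_norm_cscale: "ip_norm (mat_ip N M) (cscale c x) = cmod c * ip_norm (mat_ip N M) x"
  unfolding ip_norm_def mat_ip_cscale by (simp add: real_sqrt_mult)

text \<open>
Coercivity with an explicit constant replaces positive definiteness, since it also yields completeness and
bounded operators.
\<close>

locale coord_hilbert =
  fixes N :: nat and M :: "nat \<Rightarrow> nat \<Rightarrow> complex" and e :: real
  assumes hermitian: "\<And>i k. i < N \<Longrightarrow> k < N \<Longrightarrow> M k i = cnj (M i k)"
    and e_pos: "e > 0"
    and coercive: "\<And>x. e * (\<Sum>i<N. (cmod (x i))\<^sup>2) \<le> Re (mat_ip N M x x)"
begin

lemma Re_nonneg: "0 \<le> Re (mat_ip N M x x)"
  using order_trans[OF _ coercive] e_pos by (simp add: sum_nonneg)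

lemma ip_norm_nonneg: "0 \<le> ip_norm (mat_ip N M) x"
  by (simp add: ip_norm_def Re_nonneg)

lemma ip_norm_square: "(ip_norm (mat_ip N M) x)\<^sup>2 = Re (mat_ip N M x x)"
  by (simp add: ip_norm_def Re_nonneg)

lemma coordinate_le_ip_norm:
  assumes "i < N"
  shows "sqrt e * cmod (x i) \<le> ip_norm (mat_ip N M) x"
proof (rule power2_le_imp_le)
  have "(cmod (x i))\<^sup>2 \<le> (\<Sum>i<N. (cmod (x i))\<^sup>2)"
    using assms by (intro member_le_sum) auto
  then have "e * (cmod (x i))\<^sup>2 \<le> Re (mat_ip N M x x)"
    using coercive[of x] e_pos by (meson mult_left_mono order_trans less_imp_le)
  then show "(sqrt e * cmod (x i))\<^sup>2 \<le> (ip_norm (mat_ip N M) x)\<^sup>2"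
    using e_pos by (simp add: power_mult_distrib ip_norm_square)
qed (rule ip_norm_nonneg)

text \<open>
Completeness reduces to that of \<open>\<complex>\<close>: by coercivity a Cauchy sequence is Cauchy in each coordinate,
and the coordinatewise limit is a limit in norm because only finitely many coordinates occur.
\<close>

lemma hilbert_space_coord_space: "hilbert_space (coord_space N) (mat_ip N M)"
  unfolding hilbert_space_def
proof (intro conjI ballI allI impI)
  show "cvec.subspace (coord_space N)" by (rule subspace_coord_space)
next
  fix x y
  show "mat_ip N M y x = cnj (mat_ip N M x y)"
  proof -
    have "mat_ip N M y x = (\<Sum>k<N. \<Sum>i<N. M i k * y i * cnj (x k))"
      unfolding mat_ip_def by (rule sum.swap)
    also have "\<dots> = (\<Sum>k<N. \<Sum>i<N. cnj (M k i * x k * cnj (y i)))"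
    proof (intro sum.cong refl)
      fix k i assume "k \<in> {..<N}" "i \<in> {..<N}"
      then have "M i k = cnj (M k i)" by (intro hermitian) auto
      then show "M i k * y i * cnj (x k) = cnj (M k i * x k * cnj (y i))" by (simp add: mult_ac)
    qed
    finally show ?thesis by (simp add: mat_ip_def)
  qed
next
  fix x y z
  show "mat_ip N M (x + y) z = mat_ip N M x z + mat_ip N M y z"
    by (simp add: mat_ip_def algebra_simps sum.distrib)
next
  fix c x y
  show "mat_ip N M (cscale c x) y = c * mat_ip N M x y"
    unfolding mat_ip_def sum_distrib_left by (simp add: cscale_def mult_ac)
next
  fix x assume x: "x \<in> coord_space N" "x \<noteq> 0"
  then obtain i where i: "x i \<noteq> 0" by (auto simp: fun_eq_iff)
  with x have "i < N" unfolding coord_space_def using not_less by blast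
  then have "0 < (\<Sum>i<N. (cmod (x i))\<^sup>2)"
    using i by (intro sum_pos2[of _ i]) auto
  with e_pos have "0 < e * (\<Sum>i<N. (cmod (x i))\<^sup>2)" by simp
  then show "0 < Re (mat_ip N M x x)" using coercive[of x] by linarith
next
  fix s :: "nat \<Rightarrow> cseq"
  assume "(\<forall>n. s n \<in> coord_space N) \<and>
    (\<forall>e>0. \<exists>K. \<forall>m\<ge>K. \<forall>n\<ge>K. ip_norm (mat_ip N M) (s m - s n) < e)"
  then have cauchy: "\<exists>K. \<forall>m\<ge>K. \<forall>n\<ge>K. ip_norm (mat_ip N M) (s m - s n) < \<delta>" if "\<delta> > 0" for \<delta>
    using that by blast
  have "Cauchy (\<lambda>n. s n i)" if i: "i < N" for i
    unfolding Cauchy_def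
  proof (intro allI impI)
    fix \<delta> :: real assume "\<delta> > 0"
    then obtain K where K: "\<And>m n. m \<ge> K \<Longrightarrow> n \<ge> K \<Longrightarrow> ip_norm (mat_ip N M) (s m - s n) < sqrt e * \<delta>"
      using cauchy[of "sqrt e * \<delta>"] e_pos by auto
    have "dist (s m i) (s n i) < \<delta>" if "m \<ge> K" "n \<ge> K" for m n
    proof -
      have "sqrt e * cmod ((s m - s n) i) < sqrt e * \<delta>"
        using coordinate_le_ip_norm[OF i, of "s m - s n"] K[OF that] by linarith
      then show ?thesis using e_pos by (simp add: dist_norm)
    qed
    then show "\<exists>K. \<forall>m\<ge>K. \<forall>n\<ge>K. dist (s m i) (s n i) < \<delta>" by blast
  qed
  then have "\<forall>i. \<exists>l. i < N \<longrightarrow> (\<lambda>n. s n i) \<longlonglongrightarrow> l"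
    by (meson Cauchy_convergent convergent_def)
  then obtain l0 where l0: "\<And>i. i < N \<Longrightarrow> (\<lambda>n. s n i) \<longlonglongrightarrow> l0 i" by metis
  define l where "l = (\<lambda>i. if i < N then l0 i else 0)"
  have l: "(\<lambda>n. s n i - l i) \<longlonglongrightarrow> 0" if "i < N" for i
    using l0[OF that] that by (simp add: l_def LIM_zero)
  have "(\<lambda>n. sqrt (Re (\<Sum>i<N. \<Sum>k<N. M i k * (s n i - l i) * cnj (s n k - l k)))) \<longlonglongrightarrow>
        sqrt (Re (\<Sum>i<N. \<Sum>k<N. M i k * 0 * cnj 0))"
    by (intro tendsto_intros l) auto
  then have "(\<lambda>n. ip_norm (mat_ip N M) (s n - l)) \<longlonglongrightarrow> 0"
    by (simp add: ip_norm_def mat_ip_def)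
  moreover have "l \<in> coord_space N" by (simp add: l_def coord_space_def)
  ultimately show "\<exists>l\<in>coord_space N. (\<lambda>n. ip_norm (mat_ip N M) (s n - l)) \<longlonglongrightarrow> 0" by blast
qed

lemma linear_op_imp_bounded_op:
  assumes T: "linear_op (coord_space N) T"
  shows "bounded_op (coord_space N) (mat_ip N M) T"
proof -
  let ?H = "coord_space N"
  define u where "u i = (\<lambda>k. if k = i then 1 else 0 :: complex)" for i :: nat
  have uH: "u i \<in> ?H" if "i < N" for i using that by (auto simp: u_def coord_space_def)
  have sum_apply: "(\<Sum>i\<in>A. cscale (x i) (v i)) k = (\<Sum>i\<in>A. x i * v i k)" for A x v k
    by (induction A rule: infinite_finite_induct) (auto simp: cscale_def)
  have partial: "T (\<Sum>i<n. cscale (x i) (u i)) = (\<Sum>i<n. cscale (x i) (T (u i))) \<and>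
          (\<Sum>i<n. cscale (x i) (u i)) \<in> ?H" if "n \<le> N" for n x
    using that
  proof (induction n)
    case 0
    have "T (cscale 0 0) = cscale 0 (T 0)"
      using T cvec.subspace_0[OF subspace_coord_space] unfolding linear_op_def by blast
    then have "T 0 = 0" by (simp only: cvec.scale_zero_left)
    then show ?case
      by (simp only: lessThan_0 sum.empty cvec.subspace_0[OF subspace_coord_space] simp_thms)
  next
    case (Suc n)
    let ?s = "\<Sum>i<n. cscale (x i) (u i)" and ?v = "cscale (x n) (u n)"
    have un: "u n \<in> ?H" using Suc.prems uH by simp
    have v: "?v \<in> ?H" by (rule cvec.subspace_scale[OF subspace_coord_space un])
    have s: "T ?s = (\<Sum>i<n. cscale (x i) (T (u i)))" "?s \<in> ?H" using Suc by simp_all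
    have "T (?s + ?v) = T ?s + T ?v" using T s(2) v unfolding linear_op_def by blast
    moreover have "T ?v = cscale (x n) (T (u n))" using T un unfolding linear_op_def by blast
    moreover have "?s + ?v \<in> ?H" by (rule cvec.subspace_add[OF subspace_coord_space s(2) v])
    ultimately show ?case by (simp only: sum.lessThan_Suc s simp_thms)
  qed
  have expand: "T x = (\<Sum>i<N. cscale (x i) (T (u i)))" if x: "x \<in> ?H" for x
  proof -
    have "x = (\<Sum>i<N. cscale (x i) (u i))"
    proof
      fix k
      have "(\<Sum>i<N. x i * u i k) = (\<Sum>i<N. if k = i then x i else 0)"
        by (intro sum.cong) (auto simp: u_def)
      then show "x k = (\<Sum>i<N. cscale (x i) (u i)) k"
        using x by (auto simp: sum_apply coord_space_def)
    qed
    then show ?thesis using partial[of N x] by simp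
  qed
  define K where "K = (\<Sum>k<N. (\<Sum>i<N. cmod (T (u i) k))\<^sup>2)"
  define L where "L = (\<Sum>i<N. \<Sum>k<N. cmod (M i k))"
  have K0: "0 \<le> K" and L0: "0 \<le> L" by (auto simp: K_def L_def intro!: sum_nonneg)
  have bound: "ip_norm (mat_ip N M) (T x) \<le> sqrt (L * K / e) * ip_norm (mat_ip N M) x" if x: "x \<in> ?H" for x
  proof (rule power2_le_imp_le)
    let ?s = "\<Sum>i<N. (cmod (x i))\<^sup>2"
    have s0: "0 \<le> ?s" by (intro sum_nonneg) auto
    have le: "cmod (x i) \<le> sqrt ?s" if "i < N" for i
      by (rule real_le_rsqrt) (use that in \<open>auto intro!: member_le_sum\<close>)
    have "(cmod (T x k))\<^sup>2 \<le> (\<Sum>i<N. cmod (T (u i) k))\<^sup>2 * ?s" for k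
    proof -
      have "cmod (T x k) \<le> (\<Sum>i<N. cmod (x i * T (u i) k))"
        unfolding expand[OF x] sum_apply by (rule norm_sum)
      also have "\<dots> \<le> (\<Sum>i<N. sqrt ?s * cmod (T (u i) k))"
        by (intro sum_mono) (simp add: norm_mult le mult_right_mono)
      also have "\<dots> = sqrt ?s * (\<Sum>i<N. cmod (T (u i) k))" by (simp add: sum_distrib_left)
      finally have "(cmod (T x k))\<^sup>2 \<le> (sqrt ?s * (\<Sum>i<N. cmod (T (u i) k)))\<^sup>2"
        by (intro power_mono) auto
      then show ?thesis using s0 by (simp add: power_mult_distrib mult.commute)
    qed
    then have "(\<Sum>k<N. (cmod (T x k))\<^sup>2) \<le> K * ?s"
      unfolding K_def sum_distrib_right by (intro sum_mono)
    then have "Re (mat_ip N M (T x) (T x)) \<le> L * (K * ?s)"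
      using mat_ip_upper_bound[of N M "T x"] L0 unfolding L_def[symmetric]
      by (meson mult_left_mono order_trans)
    also have "\<dots> \<le> L * (K * (Re (mat_ip N M x x) / e))"
      using coercive[of x] e_pos K0 L0
      by (intro mult_left_mono) (auto simp: field_simps)
    finally show "(ip_norm (mat_ip N M) (T x))\<^sup>2 \<le> (sqrt (L * K / e) * ip_norm (mat_ip N M) x)\<^sup>2"
      using K0 L0 e_pos by (simp add: power_mult_distrib ip_norm_square)
  qed (use K0 L0 e_pos ip_norm_nonneg in simp)
  then show ?thesis using T unfolding bounded_op_def by blast
qed

lemma ip_norm_le_op_norm:
  assumes T: "bounded_op (coord_space N) (mat_ip N M) T" and x: "x \<in> coord_space N"
  shows "ip_norm (mat_ip N M) (T x) \<le> op_norm (coord_space N) (mat_ip N M) T * ip_norm (mat_ip N M) x"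
proof -
  let ?H = "coord_space N" and ?n = "ip_norm (mat_ip N M)"
  from T obtain c where lin: "linear_op ?H T" and c: "\<And>x. x \<in> ?H \<Longrightarrow> ?n (T x) \<le> c * ?n x"
    unfolding bounded_op_def by blast
  show ?thesis
  proof (cases "?n x = 0")
    case True
    with c[OF x] show ?thesis by simp
  next
    case False
    then have pos: "?n x > 0" using ip_norm_nonneg[of x] by simp
    let ?y = "cscale (complex_of_real (1 / ?n x)) x"
    have yH: "?y \<in> ?H" using x subspace_coord_space by (rule_tac cvec.subspace_scale)
    have ny: "?n ?y = 1"
      unfolding ip_norm_cscale norm_of_real using pos by simp
    have "bdd_above ((\<lambda>x. ?n (T x)) ` {x \<in> ?H. ?n x \<le> 1})"
    proof (rule bdd_aboveI2)
      fix y assume y: "y \<in> {x \<in> ?H. ?n x \<le> 1}"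
      then have "?n (T y) \<le> c * ?n y" using c by blast
      also have "\<dots> \<le> \<bar>c\<bar> * 1"
        using y ip_norm_nonneg[of y] by (intro mult_mono) auto
      finally show "?n (T y) \<le> \<bar>c\<bar>" by simp
    qed
    then have "?n (T ?y) \<le> op_norm ?H (mat_ip N M) T"
      unfolding op_norm_def using yH ny by (intro cSUP_upper) auto
    moreover have "T ?y = cscale (complex_of_real (1 / ?n x)) (T x)"
      using lin x unfolding linear_op_def by blast
    ultimately show ?thesis
      using pos unfolding ip_norm_cscale norm_of_real
      by (simp add: ip_norm_cscale norm_divide divide_le_eq)
  qed
qed

lemma op_norm_le:
  assumes "0 \<le> c" "\<And>x. x \<in> coord_space N \<Longrightarrow> ip_norm (mat_ip N M) (T x) \<le> c * ip_norm (mat_ip N M) x"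
  shows "op_norm (coord_space N) (mat_ip N M) T \<le> c"
  unfolding op_norm_def
proof (rule cSUP_least)
  have "0 \<in> coord_space N" by (simp add: coord_space_def)
  moreover have "ip_norm (mat_ip N M) 0 = 0" by (simp add: ip_norm_def mat_ip_def)
  ultimately show "{x \<in> coord_space N. ip_norm (mat_ip N M) x \<le> 1} \<noteq> {}" by auto
  fix x assume "x \<in> {x \<in> coord_space N. ip_norm (mat_ip N M) x \<le> 1}"
  then have x: "x \<in> coord_space N" "ip_norm (mat_ip N M) x \<le> 1" by auto
  have "ip_norm (mat_ip N M) (T x) \<le> c * ip_norm (mat_ip N M) x" by (rule assms(2)[OF x(1)])
  also have "\<dots> \<le> c" using x(2) assms(1) by (simp add: mult_left_le)
  finally show "ip_norm (mat_ip N M) (T x) \<le> c" .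
qed

lemma ip_norm_zero_imp_zero:
  assumes "x \<in> coord_space N" "ip_norm (mat_ip N M) x \<le> 0"
  shows "x = 0"
proof
  fix i
  show "x i = 0 i"
  proof (cases "i < N")
    case True
    then have "sqrt e * cmod (x i) \<le> 0" using coordinate_le_ip_norm[of i x] assms(2) by linarith
    then show ?thesis using e_pos by (simp add: mult_le_0_iff)
  next
    case False
    then show ?thesis using assms(1) by (simp add: coord_space_def)
  qed
qed

end

section \<open>The truncated polynomial algebra\<close>

definition qform ::
  "'n multi_index set \<Rightarrow> ('n multi_index \<Rightarrow> 'n multi_index \<Rightarrow> complex) \<Rightarrow>
     ('n multi_index \<Rightarrow> complex) \<Rightarrow> real" where
  "qform I S x = Re (\<Sum>m\<in>I. \<Sum>n\<in>I. S m n * x m * cnj (x n))"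

text \<open>
Multiplication by \<open>z\<^sub>j\<close>, on coefficient families.
\<close>

definition shift :: "'n \<Rightarrow> ('n multi_index \<Rightarrow> complex) \<Rightarrow> 'n multi_index \<Rightarrow> complex" where
  "shift j x m = (if 0 < cf m j then x (m - unit_index j) else 0)"

lemma index_box_diff: "m \<in> index_box b \<Longrightarrow> m - k \<in> index_box b"
  by (auto simp: index_box_def lookup_minus intro: le_less_trans[OF diff_le_self])

text \<open>
The polynomials without coefficients in the box form an ideal, so the quotient by it
is an algebra.
\<close>

lemma mult_cong_on_index_box:
  fixes A P P' :: "'n::finite cpoly"
  assumes "\<And>m. m \<in> index_box b \<Longrightarrow> cf P m = cf P' m" "m \<in> index_box b"
  shows "cf (A * P) m = cf (A * P') m"
proof -
  have expand: "cf (A * P) m = (\<Sum>k\<in>Poly_Mapping.keys A. cf (Poly_Mapping.single k (cf A k) * P) m)" for P :: "'n cpoly"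
    using arg_cong[OF poly_mapping_sum_single[of "Poly_Mapping.keys A" A], of "\<lambda>B. cf (B * P) m"]
    by (simp add: sum_distrib_right lookup_sum)
  show ?thesis
    unfolding expand lookup_single_times
    using assms index_box_diff by (intro sum.cong) auto
qed

lemma power_single_unit_index:
  "Poly_Mapping.single (unit_index i) (r::'b::comm_semiring_1) ^ k = Poly_Mapping.single (Poly_Mapping.single i k) (r ^ k)"
proof (induction k)
  case (Suc k)
  have "unit_index i + Poly_Mapping.single i k = Poly_Mapping.single i (Suc k)"
    by (simp add: unit_index_def flip: single_add)
  with Suc show ?case by (simp add: mult_single)
qed simp

lemma monomial_eq_prod_units:
  fixes m :: "'n::finite multi_index" and r :: "'b::comm_semiring_1"
  shows "(\<Prod>i\<in>UNIV. Poly_Mapping.single (unit_index i) r ^ cf m i) = Poly_Mapping.single m (r ^ total_degree m)"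
proof -
  have "(\<Prod>i\<in>J. Poly_Mapping.single (unit_index i) r ^ cf m i) =
          Poly_Mapping.single (\<Sum>i\<in>J. Poly_Mapping.single i (cf m i)) (r ^ (\<Sum>i\<in>J. cf m i))"
    if "finite J" for J
    using that by (induction J rule: finite_induct) (auto simp: power_single_unit_index mult_single power_add)
  from this[of UNIV] show ?thesis
    using poly_mapping_sum_single[of UNIV m] by (simp add: total_degree_def)
qed

text \<open>
The quotient algebra of polynomials modulo the monomials outside the box, realized on \<open>coord_space N\<close>
through an enumeration \<open>idx\<close> of the box: \<open>emb\<close> is the quotient map, \<open>unemb\<close> picks the
representative supported in the box, and \<open>mult_op r j\<close> is multiplication by \<open>r z\<^sub>j\<close>.
\<close>

locale truncated_model =
  fixes d :: "'n::{finite,linorder} \<Rightarrow> nat" and N :: nat and idx :: "nat \<Rightarrow> 'n multi_index"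
  assumes idx: "bij_betw idx {..<N} (index_box (\<lambda>i. d i + 1))"
begin

abbreviation "I \<equiv> index_box (\<lambda>i. d i + 1)"

definition emb :: "'n cpoly \<Rightarrow> cseq" where
  "emb P = (\<lambda>i. if i < N then cf P (idx i) else 0)"

definition unemb :: "cseq \<Rightarrow> 'n cpoly" where
  "unemb x = (\<Sum>i<N. Poly_Mapping.single (idx i) (x i))"

definition mult_op :: "real \<Rightarrow> 'n \<Rightarrow> cseq \<Rightarrow> cseq" where
  "mult_op r j x = emb (Poly_Mapping.single (unit_index j) (complex_of_real r) * unemb x)"

lemma idx_in: "i < N \<Longrightarrow> idx i \<in> I"
  using idx by (auto simp: bij_betw_def)

lemma emb_in [simp]: "emb P \<in> coord_space N"
  by (simp add: emb_def coord_space_def)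

lemma emb_eq_iff: "emb P = emb Q \<longleftrightarrow> (\<forall>m\<in>I. cf P m = cf Q m)"
proof -
  have "emb P = emb Q \<longleftrightarrow> (\<forall>i\<in>{..<N}. cf P (idx i) = cf Q (idx i))"
    by (auto simp: emb_def fun_eq_iff)
  also have "\<dots> \<longleftrightarrow> (\<forall>m\<in>idx ` {..<N}. cf P m = cf Q m)" by simp
  also have "idx ` {..<N} = I" by (rule bij_betw_imp_surj_on[OF idx])
  finally show ?thesis .
qed

lemma emb_mult_cong: "emb P = emb P' \<Longrightarrow> emb (A * P) = emb (A * P')"
  unfolding emb_eq_iff using mult_cong_on_index_box by blast

lemma emb_unemb [simp]: "x \<in> coord_space N \<Longrightarrow> emb (unemb x) = x"
proof
  fix i assume x: "x \<in> coord_space N"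
  show "emb (unemb x) i = x i"
  proof (cases "i < N")
    case True
    have "cf (unemb x) (idx i) = (\<Sum>k<N. if k = i then x k else 0)"
      unfolding unemb_def lookup_sum lookup_single when_def
      using idx True by (intro sum.cong) (auto simp: bij_betw_def inj_on_def)
    then show ?thesis using True by (simp add: emb_def)
  next
    case False
    then show ?thesis using x by (simp add: emb_def coord_space_def)
  qed
qed

lemma emb_unemb_mult [simp]: "emb (A * unemb (emb P)) = emb (A * P)"
  by (rule emb_mult_cong) simp

lemma emb_add: "emb (P + Q) = emb P + emb Q"
  by (auto simp: emb_def lookup_add)

lemma emb_single_zero_mult: "emb (Poly_Mapping.single 0 c * P) = cscale c (emb P)"
  by (auto simp: emb_def lookup_single_times cscale_def)

lemma emb_sum: "emb (\<Sum>x\<in>A. F x) = (\<Sum>x\<in>A. emb (F x))"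
proof (induction A rule: infinite_finite_induct)
  case (insert x A)
  then show ?case by (simp only: sum.insert[OF insert.hyps] emb_add)
qed (auto simp: emb_def)

lemma mult_op_emb: "mult_op r j (emb P) = emb (Poly_Mapping.single (unit_index j) (complex_of_real r) * P)"
  by (simp add: mult_op_def)

lemma linear_op_mult:
  assumes T: "\<And>x. x \<in> coord_space N \<Longrightarrow> T x = emb (A * unemb x)"
  shows "linear_op (coord_space N) T"
proof -
  have "T (emb P + emb Q) = T (emb P) + T (emb Q)" for P Q
  proof -
    have "T (emb P + emb Q) = T (emb (P + Q))" by (simp only: emb_add)
    also have "\<dots> = emb (A * P + A * Q)" by (simp only: T emb_in emb_unemb_mult distrib_left)
    also have "\<dots> = T (emb P) + T (emb Q)" by (simp only: T emb_in emb_unemb_mult emb_add)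
    finally show ?thesis .
  qed
  moreover have "T (cscale c (emb P)) = cscale c (T (emb P))" for c P
  proof -
    have "T (cscale c (emb P)) = T (emb (Poly_Mapping.single 0 c * P))"
      by (simp only: emb_single_zero_mult)
    also have "\<dots> = emb (Poly_Mapping.single 0 c * (A * P))"
      by (simp only: T emb_in emb_unemb_mult mult.left_commute)
    also have "\<dots> = cscale c (T (emb P))"
      by (simp only: T emb_in emb_unemb_mult emb_single_zero_mult)
    finally show ?thesis .
  qed
  moreover have "T x \<in> coord_space N" if "x \<in> coord_space N" for x
    using T[OF that] by simp
  ultimately show ?thesis
    unfolding linear_op_def by (metis emb_unemb)
qed

text \<open>
Monomials in the multiplication operators act as multiplication by the corresponding monomial, which
reduces the functional calculus to the polynomial ring.
\<close>

lemma op_power_emb: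
  "op_power (mult_op r) m (emb P) = emb (Poly_Mapping.single m (complex_of_real r ^ total_degree m) * P)"
proof -
  let ?s = "\<lambda>i. Poly_Mapping.single (unit_index i) (complex_of_real r)"
  have pow: "(mult_op r i ^^ k) (emb P) = emb (?s i ^ k * P)" for i k P
    by (induction k) (simp_all add: mult_op_emb mult.assoc)
  have "foldr (\<lambda>i F. (mult_op r i ^^ cf m i) \<circ> F) xs id (emb P) =
          emb (prod_list (map (\<lambda>i. ?s i ^ cf m i) xs) * P)" for xs
    by (induction xs) (simp_all add: pow mult.assoc)
  moreover have "prod_list (map (\<lambda>i. ?s i ^ cf m i) (sorted_list_of_set UNIV)) =
                   (\<Prod>i\<in>UNIV. ?s i ^ cf m i)"
    by (subst prod.distinct_set_conv_list[symmetric]) auto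
  ultimately show ?thesis by (simp add: op_power_def monomial_eq_prod_units)
qed

text \<open>
Nilpotency: only the finitely many terms with index in the box contribute to the operator
series \<open>f(T)\<close>.
\<close>

lemma emb_single_mult_outside:
  assumes "m \<notin> I"
  shows "emb (Poly_Mapping.single m c * P) = 0"
proof
  fix i
  have "\<not> (\<forall>k. cf m k \<le> cf (idx i) k)" if "i < N"
    using idx_in[OF that] assms by (auto simp: index_box_def intro: le_less_trans)
  then show "emb (Poly_Mapping.single m c * P) i = 0 i"
    by (cases "i < N") (auto simp: emb_def lookup_single_times)
qed

lemma mat_ip_emb:
  "Re (mat_ip N (\<lambda>i k. S (idx i) (idx k)) (emb P) (emb P)) = qform I S (cf P)"
proof -
  have "mat_ip N (\<lambda>i k. S (idx i) (idx k)) (emb P) (emb P) =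
          (\<Sum>i<N. \<Sum>k<N. S (idx i) (idx k) * cf P (idx i) * cnj (cf P (idx k)))"
    by (simp add: mat_ip_def emb_def)
  also have "\<dots> = (\<Sum>m\<in>I. \<Sum>n\<in>I. S m n * cf P m * cnj (cf P n))"
  proof -
    have "(\<Sum>k<N. S m (idx k) * cf P m * cnj (cf P (idx k))) = (\<Sum>n\<in>I. S m n * cf P m * cnj (cf P n))" for m
      by (rule sum.reindex_bij_betw[OF idx])
    then show ?thesis
      using sum.reindex_bij_betw[OF idx, of "\<lambda>m. \<Sum>n\<in>I. S m n * cf P m * cnj (cf P n)"] by (simp only:)
  qed
  finally show ?thesis by (simp add: qform_def)
qed

end

lemma has_sum_finite_sum:
  fixes g :: "'i \<Rightarrow> 'k \<Rightarrow> 'c::topological_comm_monoid_add"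
  assumes "\<And>l. l \<in> L \<Longrightarrow> (g l has_sum s l) A"
  shows "((\<lambda>k. \<Sum>l\<in>L. g l k) has_sum (\<Sum>l\<in>L. s l)) A"
  using assms by (induction L rule: infinite_finite_induct) (auto intro: has_sum_add)

text \<open>
If \<open>f = \<Sum> a\<^sub>m z\<^sup>m\<close>, then \<open>p f = q\<close> on the polydisk and this is the identity of the Taylor coefficients at
index \<open>k\<close>.
\<close>

lemma rational_power_series_coeffs:
  fixes p q :: "'n::finite cpoly"
  assumes p_nz: "\<forall>z\<in>polydisk. peval p z \<noteq> 0"
    and f_eq: "\<forall>z\<in>polydisk. f z = peval q z / peval p z"
    and a: "\<forall>z\<in>polydisk. ((\<lambda>m. a m * monomial_at z m) has_sum f z) UNIV"
  shows "(\<Sum>l\<in>Poly_Mapping.keys p. if \<forall>i. cf l i \<le> cf k i then cf p l * a (k - l) else 0) = cf q k"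
proof -
  define b where "b k = (\<Sum>l\<in>Poly_Mapping.keys p. if \<forall>i. cf l i \<le> cf k i then cf p l * a (k - l) else 0)" for k
  have "b k - cf q k = 0"
  proof (rule power_series_identity[of "\<lambda>k. b k - cf q k"])
    fix z :: "complex ^ 'n" assume z: "z \<in> polydisk"
    have "((\<lambda>k. (if \<forall>i. cf l i \<le> cf k i then cf p l * a (k - l) else 0) * monomial_at z k)
             has_sum (cf p l * monomial_at z l * f z)) UNIV" for l
    proof -
      have inj: "inj ((+) l)" by (simp add: inj_on_def)
      have ran: "range ((+) l) = {k. \<forall>i. cf l i \<le> cf k i}"
      proof (intro set_eqI iffI)
        fix k assume "k \<in> {k. \<forall>i. cf l i \<le> cf k i}"
        then have "l + (k - l) = k" by (intro index_diff_add) simp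
        then show "k \<in> range ((+) l)" by (metis rangeI)
      qed (auto simp: lookup_add)
      have "((\<lambda>m. cf p l * monomial_at z l * (a m * monomial_at z m)) has_sum
               (cf p l * monomial_at z l * f z)) UNIV"
        using a z by (intro has_sum_cmult_right) blast
      then have "((\<lambda>k. cf p l * a (k - l) * monomial_at z k) has_sum
               (cf p l * monomial_at z l * f z)) (range ((+) l))"
        unfolding has_sum_reindex[OF inj] by (simp add: o_def monomial_at_add mult_ac)
      then show ?thesis
        unfolding ran by (rule iffD1[OF has_sum_cong_neutral, rotated -1]) auto
    qed
    then have "((\<lambda>k. \<Sum>l\<in>Poly_Mapping.keys p.
            (if \<forall>i. cf l i \<le> cf k i then cf p l * a (k - l) else 0) * monomial_at z k) has_sum
          (\<Sum>l\<in>Poly_Mapping.keys p. cf p l * monomial_at z l * f z)) UNIV"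
      by (intro has_sum_finite_sum) auto
    also have "(\<Sum>l\<in>Poly_Mapping.keys p. cf p l * monomial_at z l * f z) = peval p z * f z"
      by (simp add: peval_def sum_distrib_right)
    also have "\<dots> = peval q z" using z p_nz f_eq by simp
    finally have "((\<lambda>k. b k * monomial_at z k) has_sum peval q z) UNIV"
      by (simp add: b_def sum_distrib_right)
    moreover have "((\<lambda>k. cf q k * monomial_at z k) has_sum peval q z) UNIV"
    proof -
      have "((\<lambda>k. cf q k * monomial_at z k) has_sum peval q z) (Poly_Mapping.keys q)"
        unfolding peval_def by (rule has_sum_finite) simp
      then show ?thesis
        by (rule iffD1[OF has_sum_cong_neutral, rotated -1]) (auto simp: in_keys_iff)
    qed
    ultimately have "((\<lambda>k. b k * monomial_at z k + - (cf q k * monomial_at z k)) has_sum (peval q z + - peval q z)) UNIV"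
      by (intro has_sum_add) (simp_all add: has_sum_uminus)
    then show "((\<lambda>k. (b k - cf q k) * monomial_at z k) has_sum 0) UNIV"
      by (simp add: algebra_simps)
  qed
  then show ?thesis by (simp add: b_def)
qed

section \<open>The von Neumann inequality in the truncated algebra\<close>

lemma qform_scale: "qform I S (\<lambda>m. complex_of_real r * x m) = r\<^sup>2 * qform I S x"
proof -
  have "(\<Sum>m\<in>I. \<Sum>n\<in>I. S m n * (complex_of_real r * x m) * cnj (complex_of_real r * x n)) =
          complex_of_real (r\<^sup>2) * (\<Sum>m\<in>I. \<Sum>n\<in>I. S m n * x m * cnj (x n))"
    by (simp add: sum_distrib_left mult_ac power2_eq_square)
  then show ?thesis by (simp add: qform_def)
qed

text \<open>
By coercivity, \<open>S\<close> makes the truncated algebra a Hilbert space, and by \<open>contr\<close> the operators \<open>r z\<^sub>j\<close>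
with \<open>r < 1\<close> are commuting strict contractions on it. The function \<open>f\<close> of these operators is multiplication by the
truncated power series of \<open>f(r z)\<close>, which takes the vector \<open>p(r z)\<close> to \<open>q(r z)\<close>. As this operator has norm at most
one, the inequality holds for \<open>p(r z)\<close> and \<open>q(r z)\<close>, and \<open>r \<rightarrow> 1\<close> gives the claim.
\<close>

lemma agler_qform_le:
  fixes f :: "complex ^ 'n::{finite,linorder} \<Rightarrow> complex" and d :: "'n \<Rightarrow> nat"
  defines "J \<equiv> index_box (\<lambda>i. d i + 1)"
  assumes agler: "agler_class f"
    and p_nz: "\<forall>z\<in>polydisk. peval p z \<noteq> 0"
    and f_eq: "\<forall>z\<in>polydisk. f z = peval q z / peval p z"
    and hermitian: "\<And>m n. m \<in> J \<Longrightarrow> n \<in> J \<Longrightarrow> S n m = cnj (S m n)"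
    and e_pos: "e > 0"
    and coercive: "\<And>x. e * (\<Sum>m\<in>J. (cmod (x m))\<^sup>2) \<le> qform J S x"
    and contr: "\<And>j x. qform J S (shift j x) \<le> qform J S x"
  shows "qform J S (cf q) \<le> qform J S (cf p)"
proof -
  obtain idx where idx: "bij_betw idx {..<card J} J"
    using ex_bij_betw_nat_finite[of J] by (auto simp: J_def atLeast0LessThan)
  define N where "N = card J"
  interpret truncated_model d N idx
    using idx by unfold_locales (simp add: N_def J_def)
  have J: "I = J" by (simp add: J_def)
  define M where "M = (\<lambda>i k. S (idx i) (idx k))"
  have mat_emb: "Re (mat_ip N M (emb P) (emb P)) = qform J S (cf P)" for P
    unfolding M_def mat_ip_emb J ..
  interpret coord_hilbert N M e
  proof
    show "M k i = cnj (M i k)" if "i < N" "k < N" for i k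
      using that idx_in unfolding M_def J by (intro hermitian) auto
    show "e > 0" by (rule e_pos)
    fix x :: cseq
    define y where "y = (\<lambda>i. if i < N then x i else 0)"
    have y: "emb (unemb y) = y" by (rule emb_unemb) (simp add: coord_space_def y_def)
    have "(\<Sum>i<N. (cmod (x i))\<^sup>2) = (\<Sum>i<N. (cmod (emb (unemb y) i))\<^sup>2)"
      unfolding y by (simp add: y_def)
    also have "\<dots> = (\<Sum>i<N. (cmod (cf (unemb y) (idx i)))\<^sup>2)"
      by (simp add: emb_def)
    also have "\<dots> = (\<Sum>m\<in>J. (cmod (cf (unemb y) m))\<^sup>2)"
      unfolding J[symmetric] by (rule sum.reindex_bij_betw[OF idx])
    finally have "e * (\<Sum>i<N. (cmod (x i))\<^sup>2) \<le> qform J S (cf (unemb y))"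
      using coercive by simp
    also have "\<dots> = Re (mat_ip N M y y)" by (simp only: mat_emb[symmetric] y)
    also have "mat_ip N M y y = mat_ip N M x x" by (simp add: mat_ip_def y_def)
    finally show "e * (\<Sum>i<N. (cmod (x i))\<^sup>2) \<le> Re (mat_ip N M x x)" .
  qed
  let ?H = "coord_space N" and ?ip = "mat_ip N M"
  have scaled: "qform J S (\<lambda>m. complex_of_real r ^ total_degree m * cf q m) \<le>
                qform J S (\<lambda>m. complex_of_real r ^ total_degree m * cf p m)"
    if r: "0 < r" "r < 1" for r
  proof -
    have contraction: "ip_norm ?ip (mult_op r j x) \<le> r * ip_norm ?ip x" if x: "x \<in> ?H" for j x
    proof (rule power2_le_imp_le)
      define P where "P = unemb x"
      have xP: "x = emb P" using x by (simp add: P_def)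
      have "(ip_norm ?ip (mult_op r j x))\<^sup>2 =
              qform J S (cf (Poly_Mapping.single (unit_index j) (complex_of_real r) * P))"
        unfolding xP mult_op_emb ip_norm_square by (rule mat_emb)
      also have "cf (Poly_Mapping.single (unit_index j) (complex_of_real r) * P) =
                   (\<lambda>m. complex_of_real r * shift j (cf P) m)"
        by (auto simp: lookup_unit_index_times shift_def)
      also have "qform J S \<dots> \<le> r\<^sup>2 * qform J S (cf P)"
        unfolding qform_scale by (intro mult_left_mono contr) simp
      also have "\<dots> = (r * ip_norm ?ip x)\<^sup>2"
        unfolding power_mult_distrib ip_norm_square xP mat_emb ..
      finally show "(ip_norm ?ip (mult_op r j x))\<^sup>2 \<le> (r * ip_norm ?ip x)\<^sup>2" .
      show "0 \<le> r * ip_norm ?ip x" using r ip_norm_nonneg by simp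
    qed
    have "strict_contraction ?H ?ip (mult_op r j)" for j
    proof -
      have "bounded_op ?H ?ip (mult_op r j)"
        by (intro linear_op_imp_bounded_op linear_op_mult) (rule mult_op_def)
      moreover have "op_norm ?H ?ip (mult_op r j) \<le> r"
        using r contraction by (intro op_norm_le) auto
      ultimately show ?thesis using r by (simp add: strict_contraction_def)
    qed
    moreover have "mult_op r i (mult_op r j x) = mult_op r j (mult_op r i x)" if "x \<in> ?H" for i j x
      by (simp add: mult_op_def mult.left_commute)
    ultimately obtain F where F: "is_fun_of_ops ?H ?ip f (mult_op r) F" "op_norm ?H ?ip F \<le> 1"
      using agler hilbert_space_coord_space unfolding agler_class_def by blast
    then obtain a where F_bounded: "bounded_op ?H ?ip F"
      and a: "\<forall>z\<in>polydisk. ((\<lambda>m. a m * monomial_at z m) has_sum f z) UNIV"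
      and lim: "((\<lambda>A. op_norm ?H ?ip (\<lambda>x. F x - (\<Sum>m\<in>A. cscale (a m) (op_power (mult_op r) m x)))) \<longlongrightarrow> 0)
          (finite_subsets_at_top UNIV)"
      unfolding is_fun_of_ops_def by blast
    define Q where "Q = (\<Sum>m\<in>J. Poly_Mapping.single m (a m * complex_of_real r ^ total_degree m))"
    have term_emb: "cscale (a m) (op_power (mult_op r) m (emb P)) =
            emb (Poly_Mapping.single m (a m * complex_of_real r ^ total_degree m) * P)" for m P
    proof -
      have "cscale (a m) (op_power (mult_op r) m (emb P)) =
              emb (Poly_Mapping.single 0 (a m) * (Poly_Mapping.single m (complex_of_real r ^ total_degree m) * P))"
        by (simp only: op_power_emb emb_single_zero_mult)
      then show ?thesis by (simp add: mult_single flip: mult.assoc)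
    qed
    have partial: "(\<Sum>m\<in>A. cscale (a m) (op_power (mult_op r) m x)) = emb (Q * unemb x)"
      if A: "finite A" "J \<subseteq> A" and x: "x \<in> ?H" for A x
    proof -
      have "(\<Sum>m\<in>A. cscale (a m) (op_power (mult_op r) m (emb (unemb x)))) =
              (\<Sum>m\<in>J. cscale (a m) (op_power (mult_op r) m (emb (unemb x))))"
        using A unfolding term_emb
        by (intro sum.mono_neutral_right) (auto intro!: emb_single_mult_outside[unfolded J])
      also have "\<dots> = emb (Q * unemb x)"
        unfolding term_emb by (simp only: Q_def sum_distrib_right emb_sum)
      finally show ?thesis using x by simp
    qed
    define G where "G = (\<lambda>x. F x - emb (Q * unemb x))"
    \<comment> \<open>The partial sums of the operator series are constant once they contain the box, so their limit is attained.\<close>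
    have op_norm_cong: "op_norm ?H ?ip (\<lambda>x. F x - (\<Sum>m\<in>A. cscale (a m) (op_power (mult_op r) m x))) =
            op_norm ?H ?ip G" if "finite A" "J \<subseteq> A" for A
      unfolding op_norm_def G_def by (intro SUP_cong refl) (simp add: partial[OF that])
    have "eventually (\<lambda>A. op_norm ?H ?ip (\<lambda>x. F x - (\<Sum>m\<in>A. cscale (a m) (op_power (mult_op r) m x))) =
            op_norm ?H ?ip G) (finite_subsets_at_top UNIV)"
      unfolding eventually_finite_subsets_at_top
      by (rule exI[of _ J]) (auto simp: J_def intro!: op_norm_cong[unfolded J_def])
    from tendsto_cong[OF this] lim have "((\<lambda>A :: 'n multi_index set. op_norm ?H ?ip G) \<longlongrightarrow> 0)
        (finite_subsets_at_top UNIV)" by simp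
    then have G0: "op_norm ?H ?ip G = 0"
      by (simp add: tendsto_const_iff)
    have "linear_op ?H G"
    proof -
      have "linear_op ?H (\<lambda>x. emb (Q * unemb x))" by (rule linear_op_mult) simp
      moreover have "linear_op ?H F" using F_bounded by (simp add: bounded_op_def)
      ultimately show ?thesis
        unfolding linear_op_def G_def
        using cvec.subspace_diff[OF subspace_coord_space]
        by (auto simp: cscale_def fun_eq_iff algebra_simps)
    qed
    then have G_bounded: "bounded_op ?H ?ip G" by (rule linear_op_imp_bounded_op)
    have F_eq: "F (emb P) = emb (Q * P)" for P
    proof -
      have "G (emb P) \<in> ?H" using \<open>linear_op ?H G\<close> unfolding linear_op_def by simp
      moreover have "ip_norm ?ip (G (emb P)) \<le> 0"
        using ip_norm_le_op_norm[OF G_bounded, of "emb P"] G0 by simp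
      ultimately have "G (emb P) = 0" by (rule ip_norm_zero_imp_zero)
      then show ?thesis by (simp add: G_def)
    qed
    define P where "P = (\<Sum>l\<in>Poly_Mapping.keys p. Poly_Mapping.single l (complex_of_real r ^ total_degree l * cf p l))"
    have P: "cf P m = complex_of_real r ^ total_degree m * cf p m" for m
      by (simp add: P_def lookup_sum lookup_single when_def in_keys_iff)
    have QP: "cf (Q * P) k = complex_of_real r ^ total_degree k * cf q k" if k: "k \<in> J" for k
    proof -
      have Q: "cf Q m = a m * complex_of_real r ^ total_degree m" if "m \<in> J" for m
        using that by (simp add: Q_def lookup_sum lookup_single when_def J_def)
      have "cf (Q * P) k = cf (P * Q) k" by (simp add: mult.commute)
      also have "\<dots> = (\<Sum>l\<in>Poly_Mapping.keys p. if \<forall>i. cf l i \<le> cf k i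
              then complex_of_real r ^ total_degree l * cf p l * cf Q (k - l) else 0)"
        unfolding P_def sum_distrib_right lookup_sum lookup_single_times ..
      also have "\<dots> = (\<Sum>l\<in>Poly_Mapping.keys p. complex_of_real r ^ total_degree k *
              (if \<forall>i. cf l i \<le> cf k i then cf p l * a (k - l) else 0))"
      proof (intro sum.cong refl)
        fix l
        have "complex_of_real r ^ total_degree l * cf p l * cf Q (k - l) =
              complex_of_real r ^ total_degree k * (cf p l * a (k - l))" if "\<forall>i. cf l i \<le> cf k i"
        proof -
          have "total_degree k = total_degree l + total_degree (k - l)"
            using index_diff_add[OF that] by (metis total_degree_add)
          moreover have "k - l \<in> J" using k unfolding J_def by (rule index_box_diff)
          ultimately show ?thesis by (simp add: Q power_add mult_ac)
        qed
        then show "(if \<forall>i. cf l i \<le> cf k i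
              then complex_of_real r ^ total_degree l * cf p l * cf Q (k - l) else 0) =
            complex_of_real r ^ total_degree k * (if \<forall>i. cf l i \<le> cf k i then cf p l * a (k - l) else 0)"
          by simp
      qed
      also have "\<dots> = complex_of_real r ^ total_degree k * cf q k"
        unfolding sum_distrib_left[symmetric] rational_power_series_coeffs[OF p_nz f_eq a] ..
      finally show ?thesis .
    qed
    have "ip_norm ?ip (F (emb P)) \<le> op_norm ?H ?ip F * ip_norm ?ip (emb P)"
      by (rule ip_norm_le_op_norm[OF F_bounded]) simp
    also have "\<dots> \<le> 1 * ip_norm ?ip (emb P)"
      using F(2) ip_norm_nonneg by (intro mult_right_mono) auto
    finally have "(ip_norm ?ip (emb (Q * P)))\<^sup>2 \<le> (ip_norm ?ip (emb P))\<^sup>2"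
      unfolding F_eq using ip_norm_nonneg by (intro power_mono) auto
    then have "qform J S (cf (Q * P)) \<le> qform J S (cf P)"
      unfolding ip_norm_square mat_emb .
    moreover have "qform J S (cf (Q * P)) = qform J S (\<lambda>m. complex_of_real r ^ total_degree m * cf q m)"
      unfolding qform_def by (simp add: QP)
    ultimately show ?thesis by (simp add: P[abs_def])
  qed
  have lim: "((\<lambda>r. qform J S (\<lambda>m. complex_of_real r ^ total_degree m * cf P m)) \<longlongrightarrow> qform J S (cf P)) (at_left 1)"
    for P :: "'n cpoly"
  proof -
    have "((\<lambda>r. Re (\<Sum>m\<in>J. \<Sum>n\<in>J. S m n * (complex_of_real r ^ total_degree m * cf P m) *
              cnj (complex_of_real r ^ total_degree n * cf P n))) \<longlongrightarrow>
          Re (\<Sum>m\<in>J. \<Sum>n\<in>J. S m n * (complex_of_real 1 ^ total_degree m * cf P m) *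
              cnj (complex_of_real 1 ^ total_degree n * cf P n))) (at_left 1)"
      by (intro tendsto_intros)
    then show ?thesis by (simp add: qform_def)
  qed
  have "eventually (\<lambda>r::real. r \<in> {0<..<1}) (at_left 1)"
    by (rule eventually_at_left_real) simp
  then have "eventually (\<lambda>r. qform J S (\<lambda>m. complex_of_real r ^ total_degree m * cf q m) \<le>
                qform J S (\<lambda>m. complex_of_real r ^ total_degree m * cf p m)) (at_left 1)"
    by eventually_elim (use scaled in auto)
  then show ?thesis
    by (rule tendsto_le[OF _ lim lim, rotated]) simp
qed

section \<open>Positive semidefinite coefficient matrices\<close>

definition psd_on ::
  "'n multi_index set \<Rightarrow> ('n multi_index \<Rightarrow> 'n multi_index \<Rightarrow> complex) \<Rightarrow> bool" where
  "psd_on I A \<longleftrightarrow> (\<forall>m\<in>I. \<forall>n\<in>I. A n m = cnj (A m n)) \<and> (\<forall>x. 0 \<le> qform I A x)"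

lemma qform_two_point:
  assumes "finite I" "m \<in> I" "n \<in> I" "m \<noteq> n" and herm: "A n m = cnj (A m n)"
  shows "qform I A (\<lambda>k. if k = m then a else if k = n then b else 0) =
           (cmod a)\<^sup>2 * Re (A m m) + (cmod b)\<^sup>2 * Re (A n n) + 2 * Re (A m n * a * cnj b)"
proof -
  let ?x = "\<lambda>k. if k = m then a else if k = n then b else 0"
  have "(\<Sum>k\<in>I. \<Sum>l\<in>I. A k l * ?x k * cnj (?x l)) = (\<Sum>k\<in>{m,n}. \<Sum>l\<in>I. A k l * ?x k * cnj (?x l))"
    using assms(1-3) by (intro sum.mono_neutral_right) auto
  also have "\<dots> = (\<Sum>k\<in>{m,n}. \<Sum>l\<in>{m,n}. A k l * ?x k * cnj (?x l))"
    using assms(1-3) by (intro sum.cong sum.mono_neutral_right) auto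
  also have "\<dots> = A m m * (a * cnj a) + A n n * (b * cnj b) + (A m n * a * cnj b + cnj (A m n * a * cnj b))"
    using assms(4) herm by (simp add: algebra_simps)
  finally show ?thesis
    unfolding qform_def complex_norm_square[symmetric] complex_add_cnj by simp
qed

lemma psd_on_diagonal:
  assumes "psd_on I A" "finite I" "m \<in> I"
  shows "0 \<le> Re (A m m)" "A m m = complex_of_real (Re (A m m))"
proof -
  have "qform I A (\<lambda>k. if k = m then 1 else 0) = Re (A m m)"
  proof -
    let ?x = "\<lambda>k. if k = m then 1 else 0 :: complex"
    have "(\<Sum>k\<in>I. \<Sum>l\<in>I. A k l * ?x k * cnj (?x l)) = (\<Sum>k\<in>{m}. \<Sum>l\<in>I. A k l * ?x k * cnj (?x l))"
      using assms(2,3) by (intro sum.mono_neutral_right) auto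
    also have "\<dots> = (\<Sum>k\<in>{m}. \<Sum>l\<in>{m}. A k l * ?x k * cnj (?x l))"
      using assms(2,3) by (intro sum.cong sum.mono_neutral_right) auto
    finally show ?thesis by (simp add: qform_def)
  qed
  then show "0 \<le> Re (A m m)" using assms(1) by (metis psd_on_def)
  have "A m m = cnj (A m m)" using assms unfolding psd_on_def by blast
  then have "Im (A m m) = Im (cnj (A m m))" by (rule arg_cong)
  then show "A m m = complex_of_real (Re (A m m))" by (simp add: complex_eq_iff)
qed

text \<open>
Test the form on the vector with entry \<open>1\<close> at \<open>m\<close> and a unimodular entry at \<open>n\<close> that turns the mixed term into
\<open>- 2 |A m n|\<close>.
\<close>

lemma psd_on_entry_bound:
  assumes A: "psd_on I A" "finite I" and mn: "m \<in> I" "n \<in> I"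
  shows "cmod (A m n) \<le> Re (A m m) + Re (A n n)"
proof (cases "m = n")
  case True
  have "cmod (A m m) = cmod (complex_of_real (Re (A m m)))"
    using psd_on_diagonal(2)[OF A mn(1)] by simp
  then show ?thesis using psd_on_diagonal(1)[OF A mn(1)] True by simp
next
  case False
  let ?b = "- sgn (A m n)"
  have herm: "A n m = cnj (A m n)" using A mn unfolding psd_on_def by blast
  have "0 \<le> qform I A (\<lambda>k. if k = m then 1 else if k = n then ?b else 0)"
    using A by (simp add: psd_on_def)
  also have "\<dots> = Re (A m m) + (cmod ?b)\<^sup>2 * Re (A n n) + 2 * Re (A m n * cnj ?b)"
    by (subst qform_two_point[OF A(2) mn False herm]) simp
  also have "A m n * cnj ?b = - complex_of_real (cmod (A m n))"
    by (cases "A m n = 0")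
      (simp_all add: sgn_eq complex_norm_square[symmetric] power2_eq_square divide_simps mult.assoc
        flip: of_real_mult)
  also have "(cmod ?b)\<^sup>2 * Re (A n n) \<le> 1 * Re (A n n)"
    using psd_on_diagonal(1)[OF A mn(2)] by (intro mult_right_mono) (auto simp: norm_sgn)
  finally show ?thesis using psd_on_diagonal(1)[OF A mn(1)] psd_on_diagonal(1)[OF A mn(2)] norm_ge_zero[of "A m n"]
    by (simp del: norm_ge_zero)
qed

text \<open>
If \<open>A n n = 0\<close>, the form at \<open>(1, b)\<close> is affine in \<open>b\<close> and can be nonnegative only if it does not depend
on \<open>b\<close>. The number \<open>t\<close> in the proof makes it equal to \<open>-1\<close> otherwise.
\<close>

lemma psd_on_zero_diagonal:
  assumes A: "psd_on I A" "finite I" and mn: "m \<in> I" "n \<in> I" and zero: "A n n = 0"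
  shows "A m n = 0"
proof (rule ccontr)
  assume nz: "A m n \<noteq> 0"
  with zero have False: "m \<noteq> n" by auto
  have herm: "A n m = cnj (A m n)" using A mn unfolding psd_on_def by blast
  define t where "t = (Re (A m m) + 1) / (2 * (cmod (A m n))\<^sup>2)"
  let ?b = "- complex_of_real t * A m n"
  have "0 \<le> qform I A (\<lambda>k. if k = m then 1 else if k = n then ?b else 0)"
    using A by (simp add: psd_on_def)
  also have "\<dots> = Re (A m m) + 2 * Re (A m n * cnj ?b)"
    by (subst qform_two_point[OF A(2) mn False herm]) (simp add: zero)
  also have "A m n * cnj ?b = - complex_of_real (t * (cmod (A m n))\<^sup>2)"
    unfolding of_real_mult complex_norm_square by (simp add: mult_ac)
  finally have "2 * (t * (cmod (A m n))\<^sup>2) \<le> Re (A m m)" by simp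
  then show False using nz by (simp add: t_def)
qed

lemma psd_on_cong:
  assumes "\<And>m n. m \<in> I \<Longrightarrow> n \<in> I \<Longrightarrow> A m n = B m n"
  shows "psd_on I A \<longleftrightarrow> psd_on I B"
proof -
  have "qform I A x = qform I B x" for x
    using assms by (simp add: qform_def)
  then show ?thesis using assms by (auto simp: psd_on_def)
qed

lemma qform_add_scaled:
  "qform I (\<lambda>m n. A m n + complex_of_real t * B m n) x = qform I A x + t * qform I B x"
proof -
  have "(\<Sum>m\<in>I. \<Sum>n\<in>I. (A m n + complex_of_real t * B m n) * x m * cnj (x n)) =
          (\<Sum>m\<in>I. \<Sum>n\<in>I. A m n * x m * cnj (x n)) +
          complex_of_real t * (\<Sum>m\<in>I. \<Sum>n\<in>I. B m n * x m * cnj (x n))"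
    by (simp add: algebra_simps sum.distrib sum_distrib_left)
  then show ?thesis by (simp add: qform_def)
qed

lemma psd_on_add_scaled:
  assumes "psd_on I A" "psd_on I B" "0 \<le> t"
  shows "psd_on I (\<lambda>m n. A m n + complex_of_real t * B m n)"
  unfolding psd_on_def
proof (intro conjI ballI allI)
  fix m n assume "m \<in> I" "n \<in> I"
  then have "A n m = cnj (A m n)" "B n m = cnj (B m n)"
    using assms(1,2) unfolding psd_on_def by blast+
  then show "A n m + complex_of_real t * B n m = cnj (A m n + complex_of_real t * B m n)" by simp
next
  fix x show "0 \<le> qform I (\<lambda>m n. A m n + complex_of_real t * B m n) x"
    using assms unfolding psd_on_def qform_add_scaled by simp
qed

lemma psd_on_zero [simp]: "psd_on I (\<lambda>m n. 0)"
  by (simp add: psd_on_def qform_def)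

lemma psd_on_rank_one: "psd_on I (\<lambda>m n. x m * cnj (x n))"
proof -
  have "0 \<le> qform I (\<lambda>m n. x m * cnj (x n)) y" for y
  proof -
    have "(\<Sum>m\<in>I. \<Sum>n\<in>I. x m * cnj (x n) * y m * cnj (y n)) =
            (\<Sum>m\<in>I. x m * y m) * cnj (\<Sum>m\<in>I. x m * y m)"
      by (simp add: sum_product mult_ac)
    also have "\<dots> = complex_of_real ((cmod (\<Sum>m\<in>I. x m * y m))\<^sup>2)"
      by (rule complex_norm_square[symmetric])
    finally show ?thesis by (simp add: qform_def)
  qed
  then show ?thesis by (simp add: psd_on_def mult.commute)
qed

lemma defect_add_scaled:
  "defect (\<lambda>j m n. G j m n + c * D j m n) m n = defect G m n + c * defect D m n"
  unfolding defect_def sum_distrib_left sum.distrib[symmetric]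
  by (intro sum.cong) (auto simp: algebra_simps)

lemma defect_cong:
  assumes "\<And>j m n. m \<in> index_box b \<Longrightarrow> n \<in> index_box b \<Longrightarrow> G j m n = G' j m n"
    and "m \<in> index_box b" "n \<in> index_box b"
  shows "defect G m n = defect G' m n"
  unfolding defect_def by (intro sum.cong refl) (simp add: assms index_box_diff)

text \<open>
Families with a single rank one member generate the cone of all defects. Against a form \<open>S\<close> their defects measure by how much multiplication by \<open>z\<^sub>j\<close>
decreases \<open>S(x, x)\<close>.
\<close>

lemma defect_rank_one:
  "defect (\<lambda>k m n. if k = j then x m * cnj (x n) else 0) m n =
     x m * cnj (x n) - shift j x m * cnj (shift j x n)"
proof -
  have "defect (\<lambda>k m n. if k = j then x m * cnj (x n) else 0) m n =
     (\<Sum>k\<in>UNIV. if k = j then x m * cnj (x n) - shift j x m * cnj (shift j x n) else 0)"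
    unfolding defect_def by (intro sum.cong) (auto simp: shift_def)
  then show ?thesis by simp
qed

lemma defect_hermitian:
  assumes "\<And>j. psd_on (index_box b) (G j)" "m \<in> index_box b" "n \<in> index_box b"
  shows "defect G n m = cnj (defect G m n)"
proof -
  have herm: "G j n m = cnj (G j m n)" if "m \<in> index_box b" "n \<in> index_box b" for j m n
    using assms(1)[of j] that unfolding psd_on_def by blast
  show ?thesis
    unfolding defect_def cnj_sum
  proof (intro sum.cong refl)
    fix j
    have "G j (n - unit_index j) (m - unit_index j) = cnj (G j (m - unit_index j) (n - unit_index j))"
      by (intro herm index_box_diff assms)
    moreover have "G j n m = cnj (G j m n)" by (intro herm assms)
    ultimately show "G j n m - (if 0 < cf n j \<and> 0 < cf m j then G j (n - unit_index j) (m - unit_index j) else 0) =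
        cnj (G j m n - (if 0 < cf m j \<and> 0 < cf n j then G j (m - unit_index j) (n - unit_index j) else 0))"
      by simp
  qed
qed

text \<open>
A bounded defect forces bounded kernels, the source of compactness. In \<open>weighted_trace\<close> take
\<open>\<phi>(m) = |d| + 1 - |m|\<close>: it is at least \<open>1\<close> on the box and drops by \<open>1\<close> under each shift, so that the weighted trace
of the defect dominates the sum of all diagonal entries of \<open>G\<close>. Off-diagonal entries are bounded by
diagonal ones.
\<close>

lemma trace_bound_of_defect:
  fixes d :: "'n::finite \<Rightarrow> nat"
  defines "I \<equiv> index_box (\<lambda>i. d i + 1)"
  assumes psd: "\<And>j. psd_on I (G j)"
    and bound: "\<And>m. m \<in> I \<Longrightarrow> cmod (defect G m m) \<le> \<beta>"
    and mn: "m \<in> I" "n \<in> I"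
  shows "cmod (G j m n) \<le> 2 * (real (card I) * ((real (\<Sum>i\<in>UNIV. d i) + 1) * \<beta>))"
proof -
  define R where "R = (\<Sum>i\<in>UNIV. d i)"
  define \<phi> :: "'n multi_index \<Rightarrow> real" where "\<phi> m = real R + 1 - real (total_degree m)" for m
  define g where "g j m = Re (G j m m)" for j m
  have fin: "finite I" by (simp add: I_def)
  have g0: "0 \<le> g j m" if "m \<in> I" for j m
    unfolding g_def using psd that fin by (intro psd_on_diagonal(1))
  have \<phi>: "1 \<le> \<phi> m" "\<phi> m \<le> real R + 1" if "m \<in> I" for m
  proof -
    have "total_degree m \<le> R"
      unfolding total_degree_def R_def
      using that by (intro sum_mono) (auto simp: I_def index_box_def less_Suc_eq_le)
    then show "1 \<le> \<phi> m" "\<phi> m \<le> real R + 1" by (simp_all add: \<phi>_def)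
  qed
  have "(\<Sum>j\<in>UNIV. \<Sum>m\<in>I. g j m) \<le> (\<Sum>j\<in>UNIV. \<Sum>m\<in>I. g j m *
          (\<phi> m - (if m + unit_index j \<in> I then \<phi> (m + unit_index j) else 0)))"
  proof (intro sum_mono)
    fix j m assume m: "m \<in> I"
    have "g j m * 1 \<le> g j m * (\<phi> m - (if m + unit_index j \<in> I then \<phi> (m + unit_index j) else 0))"
      using g0[OF m] \<phi>[OF m] by (intro mult_left_mono) (auto simp: \<phi>_def total_degree_add)
    then show "g j m \<le> g j m * (\<phi> m - (if m + unit_index j \<in> I then \<phi> (m + unit_index j) else 0))"
      by simp
  qed
  also have "\<dots> = (\<Sum>m\<in>I. \<phi> m *
            (\<Sum>j\<in>UNIV. g j m - (if 0 < cf m j then g j (m - unit_index j) else 0)))"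
    unfolding I_def by (rule weighted_trace[symmetric])
  also have "\<dots> \<le> (\<Sum>m\<in>I. (real R + 1) * \<beta>)"
  proof (intro sum_mono)
    fix m assume m: "m \<in> I"
    have "(\<Sum>j\<in>UNIV. g j m - (if 0 < cf m j then g j (m - unit_index j) else 0)) = Re (defect G m m)"
      unfolding defect_diagonal Re_sum g_def by (intro sum.cong) auto
    also have "\<dots> \<le> \<beta>" using complex_Re_le_cmod bound[OF m] by (rule order_trans)
    finally have "(\<Sum>j\<in>UNIV. g j m - (if 0 < cf m j then g j (m - unit_index j) else 0)) \<le> \<beta>" .
    moreover have "0 \<le> \<beta>" using bound[OF m] norm_ge_zero order_trans by blast
    ultimately show "\<phi> m * (\<Sum>j\<in>UNIV. g j m - (if 0 < cf m j then g j (m - unit_index j) else 0)) \<le> (real R + 1) * \<beta>"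
      using \<phi>[OF m] by (meson mult_left_mono mult_right_mono order_trans le_numeral_extra(1) zero_le_one)
  qed
  finally have total: "(\<Sum>j\<in>UNIV. \<Sum>m\<in>I. g j m) \<le> real (card I) * ((real R + 1) * \<beta>)" by simp
  have le: "g j m \<le> real (card I) * ((real R + 1) * \<beta>)" if "m \<in> I" for m
  proof -
    have "g j m \<le> (\<Sum>m\<in>I. g j m)" using that fin g0 by (intro member_le_sum) auto
    also have "\<dots> \<le> (\<Sum>j\<in>UNIV. \<Sum>m\<in>I. g j m)"
      using g0 by (intro member_le_sum) (auto intro!: sum_nonneg)
    finally show ?thesis using total by linarith
  qed
  have "cmod (G j m n) \<le> g j m + g j n"
    unfolding g_def by (rule psd_on_entry_bound[OF psd fin mn])
  also have "\<dots> \<le> 2 * (real (card I) * ((real R + 1) * \<beta>))"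
    using le[OF mn(1)] le[OF mn(2)] by linarith
  finally show ?thesis by (simp add: R_def)
qed

section \<open>Existence of polynomial Agler kernels\<close>

lemma nonneg_slope_of_quadratic:
  fixes \<alpha> \<beta> :: real
  assumes "\<And>t. 0 < t \<Longrightarrow> t < 1 \<Longrightarrow> 0 \<le> 2 * t * \<alpha> + t\<^sup>2 * \<beta>"
  shows "0 \<le> \<alpha>"
proof -
  have "((\<lambda>t. 2 * \<alpha> + t * \<beta>) \<longlongrightarrow> 2 * \<alpha> + 0 * \<beta>) (at_right 0)"
    by (intro tendsto_intros)
  moreover have "eventually (\<lambda>t. 0 \<le> 2 * \<alpha> + t * \<beta>) (at_right 0)"
  proof -
    have "eventually (\<lambda>t::real. t \<in> {0<..<1}) (at_right 0)"
      by (rule eventually_at_right_real) simp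
    then show ?thesis
    proof eventually_elim
      fix t :: real assume t: "t \<in> {0<..<1}"
      then have "0 \<le> t * (2 * \<alpha> + t * \<beta>)"
        using assms[of t] by (simp add: algebra_simps power2_eq_square)
      then show "0 \<le> 2 * \<alpha> + t * \<beta>" using t by (simp add: zero_le_mult_iff)
    qed
  qed
  ultimately have "0 \<le> 2 * \<alpha> + 0 * \<beta>"
    by (rule tendsto_lowerbound) simp
  then show ?thesis by simp
qed

definition defect_error ::
  "'n::finite multi_index set \<Rightarrow> ('n multi_index \<Rightarrow> 'n multi_index \<Rightarrow> complex) \<Rightarrow>
     ('n \<Rightarrow> 'n multi_index \<Rightarrow> 'n multi_index \<Rightarrow> complex) \<Rightarrow> real" where
  "defect_error I h G = (\<Sum>m\<in>I. \<Sum>n\<in>I. (cmod (defect G m n - h m n))\<^sup>2)"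

text \<open>
A competitor that does at least as well as \<open>G = 0\<close> has a bounded defect, hence bounded entries by
\<open>trace_bound_of_defect\<close>. So the infimum may be taken over positive semidefinite families with entries in a ball of
radius \<open>\<rho>\<close> on the box and zero outside, a compact set in the product topology.
\<close>

lemma exists_minimal_defect_error:
  fixes d :: "'n::finite \<Rightarrow> nat" and h :: "'n multi_index \<Rightarrow> 'n multi_index \<Rightarrow> complex"
  defines "I \<equiv> index_box (\<lambda>i. d i + 1)"
  obtains G0 where "\<And>j. psd_on I (G0 j)"
    and "\<And>G. (\<And>j. psd_on I (G j)) \<Longrightarrow> defect_error I h G0 \<le> defect_error I h G"
proof -
  define cur :: "('n \<times> 'n multi_index \<times> 'n multi_index \<Rightarrow> complex) \<Rightarrow>
      'n \<Rightarrow> 'n multi_index \<Rightarrow> 'n multi_index \<Rightarrow> complex" where "cur g j m n = g (j, m, n)" for g j m n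
  define c where "c = defect_error I h (\<lambda>j m n. 0)"
  define \<rho> where "\<rho> = 2 * (real (card I) * ((real (\<Sum>i\<in>UNIV. d i) + 1) * (2 * sqrt c)))"
  define B where "B = (\<lambda>(j::'n, m, n). if m \<in> I \<and> n \<in> I then cball (0::complex) \<rho> else {0})"
  define K where "K = PiE UNIV B \<inter> {g. \<forall>j. psd_on I (cur g j)}"
  have fin: "finite I" by (simp add: I_def)
  have c_eq: "c = (\<Sum>m\<in>I. \<Sum>n\<in>I. (cmod (h m n))\<^sup>2)"
    by (simp add: c_def defect_error_def defect_def)
  have c0: "0 \<le> c" unfolding c_eq by (intro sum_nonneg) auto
  have "0 \<le> real (\<Sum>i\<in>UNIV. d i) + 1" by (rule add_nonneg_nonneg[OF of_nat_0_le_iff]) simp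
  then have \<rho>0: "0 \<le> \<rho>" unfolding \<rho>_def using c0 by (intro mult_nonneg_nonneg) auto
  have "compactin (product_topology (\<lambda>_. euclidean) UNIV) (PiE UNIV B)"
    unfolding compactin_PiE by (auto simp: B_def)
  then have "compact (PiE UNIV B)"
    by (simp add: euclidean_product_topology)
  moreover have "closed {g. \<forall>j. psd_on I (cur g j)}"
    unfolding psd_on_def qform_def cur_def Ball_def
    by (intro closed_Collect_all closed_Collect_conj closed_Collect_imp open_Collect_const
        closed_Collect_eq closed_Collect_le continuous_intros continuous_on_product_coordinates)
  ultimately have "compact K" unfolding K_def by (rule compact_Int_closed)
  moreover have "(\<lambda>_. 0) \<in> K"
    using \<rho>0 by (auto simp: K_def B_def cur_def[abs_def])
  moreover have "continuous_on K (\<lambda>g. defect_error I h (cur g))"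
  proof (rule continuous_on_subset)
    have "continuous_on UNIV (\<lambda>g. if b then cur g j m n else 0)" for b j m n
      by (cases b) (auto simp: cur_def intro: continuous_on_product_coordinates)
    moreover have "continuous_on UNIV (\<lambda>g. cur g j m n)" for j m n
      by (simp add: cur_def continuous_on_product_coordinates)
    ultimately show "continuous_on UNIV (\<lambda>g. defect_error I h (cur g))"
      unfolding defect_error_def defect_def by (intro continuous_intros)
  qed simp
  ultimately obtain g0 where g0: "g0 \<in> K"
    and min: "\<And>g. g \<in> K \<Longrightarrow> defect_error I h (cur g0) \<le> defect_error I h (cur g)"
    using continuous_attains_inf[of K "\<lambda>g. defect_error I h (cur g)"] by blast
  show ?thesis
  proof (rule that[of "cur g0"])
    show "psd_on I (cur g0 j)" for j using g0 by (simp add: K_def)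
    fix G :: "'n \<Rightarrow> 'n multi_index \<Rightarrow> 'n multi_index \<Rightarrow> complex"
    assume psd: "\<And>j. psd_on I (G j)"
    show "defect_error I h (cur g0) \<le> defect_error I h G"
    proof (cases "defect_error I h G \<le> c")
      case True
      have sq: "(cmod (x m n))\<^sup>2 \<le> (\<Sum>m\<in>I. \<Sum>n\<in>I. (cmod (x m n))\<^sup>2)" if "m \<in> I" "n \<in> I" for x m n
      proof -
        have "(cmod (x m n))\<^sup>2 \<le> (\<Sum>n\<in>I. (cmod (x m n))\<^sup>2)"
          using that fin by (intro member_le_sum) auto
        also have "\<dots> \<le> (\<Sum>m\<in>I. \<Sum>n\<in>I. (cmod (x m n))\<^sup>2)"
          using that fin by (intro member_le_sum[where f = "\<lambda>m. \<Sum>n\<in>I. (cmod (x m n))\<^sup>2"]) (auto intro: sum_nonneg)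
        finally show ?thesis .
      qed
      have "cmod (defect G m m) \<le> 2 * sqrt c" if "m \<in> I" for m
      proof -
        have "(cmod (defect G m m - h m m))\<^sup>2 \<le> c"
          using sq[OF that that, of "\<lambda>m n. defect G m n - h m n"] True
          unfolding defect_error_def by linarith
        then have "cmod (defect G m m - h m m) \<le> sqrt c" by (rule real_le_rsqrt)
        moreover have "cmod (h m m) \<le> sqrt c"
          using sq[OF that that, of h] unfolding c_eq by (intro real_le_rsqrt)
        moreover have "cmod (defect G m m) \<le> cmod (defect G m m - h m m) + cmod (h m m)"
          using norm_triangle_ineq[of "defect G m m - h m m" "h m m"] by simp
        ultimately show ?thesis by linarith
      qed
      then have bound: "cmod (G j m n) \<le> \<rho>" if "m \<in> I" "n \<in> I" for j m n
        using psd that unfolding \<rho>_def I_def by (intro trace_bound_of_defect) auto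
      define g where "g = (\<lambda>(j, m, n). if m \<in> I \<and> n \<in> I then G j m n else 0)"
      have g: "cur g j m n = G j m n" if "m \<in> I" "n \<in> I" for j m n
        using that by (simp add: cur_def g_def)
      have "g \<in> PiE UNIV B"
        using bound by (auto simp: g_def B_def)
      moreover have "psd_on I (cur g j)" for j
        using psd[of j] psd_on_cong[of I "cur g j" "G j"] g by blast
      ultimately have "g \<in> K" by (simp add: K_def)
      then have "defect_error I h (cur g0) \<le> defect_error I h (cur g)" by (rule min)
      also have "defect_error I h (cur g) = defect_error I h G"
      proof -
        have "defect (cur g) m n = defect G m n" if "m \<in> I" "n \<in> I" for m n
          using g that unfolding I_def by (rule defect_cong)
        then show ?thesis by (simp add: defect_error_def)
      qed
      finally show ?thesis .
    next
      case False
      have "defect_error I h (cur g0) \<le> defect_error I h (cur (\<lambda>_. 0))"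
        by (rule min) fact
      also have "\<dots> = c" by (simp add: c_def cur_def[abs_def])
      finally show ?thesis using False by simp
    qed
  qed
qed

text \<open>
Multiplication by \<open>z\<^sub>j\<close> is nilpotent in the truncated algebra.
\<close>

lemma qform_shift_power_vanishes:
  "qform (index_box (\<lambda>i. d i + 1)) S ((shift j ^^ (d j + 1)) x) = 0"
proof -
  have "(shift j ^^ k) x m = 0" if "cf m j < k" for k m
    using that
  proof (induction k arbitrary: m)
    case (Suc k)
    have "(shift j ^^ k) x (m - unit_index j) = 0" if "0 < cf m j"
      using Suc.prems that by (intro Suc.IH) (simp add: lookup_minus lookup_unit_index)
    then show ?case by (simp add: shift_def[of j "(shift j ^^ k) x" m])
  qed simp
  then have "(shift j ^^ (d j + 1)) x m = 0" if "m \<in> index_box (\<lambda>i. d i + 1)" for m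
    using that unfolding index_box_def by blast
  then show ?thesis by (simp add: qform_def del: funpow.simps)
qed

lemma sum_norm_shift_le:
  "(\<Sum>m\<in>index_box b. (cmod (shift j x m))\<^sup>2) \<le> (\<Sum>m\<in>index_box (b :: 'n::finite \<Rightarrow> nat). (cmod (x m))\<^sup>2)"
proof -
  let ?J = "{m \<in> index_box b. 0 < cf m j}"
  have "(\<Sum>m\<in>index_box b. (cmod (shift j x m))\<^sup>2) = (\<Sum>m\<in>?J. (cmod (x (m - unit_index j)))\<^sup>2)"
    by (subst sum.inter_filter) (auto simp: shift_def intro!: sum.cong)
  also have "\<dots> = (\<Sum>m\<in>(\<lambda>m. m - unit_index j) ` ?J. (cmod (x m))\<^sup>2)"
  proof (subst sum.reindex)
    show "inj_on (\<lambda>m. m - unit_index j) ?J"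
      by (rule inj_onI) (metis (mono_tags, lifting) mem_Collect_eq unit_index_diff_add)
  qed simp
  also have "\<dots> \<le> (\<Sum>m\<in>index_box b. (cmod (x m))\<^sup>2)"
    using index_box_diff by (intro sum_mono2) auto
  finally show ?thesis .
qed

lemma qform_identity_weight:
  assumes "finite I"
  shows "qform I (\<lambda>m n. if m = n then 1 else 0) x = (\<Sum>m\<in>I. (cmod (x m))\<^sup>2)"
proof -
  have "(\<Sum>m\<in>I. \<Sum>n\<in>I. (if m = n then 1 else 0) * x m * cnj (x n)) =
          (\<Sum>m\<in>I. \<Sum>n\<in>I. if m = n then x m * cnj (x n) else 0)"
    by (intro sum.cong) auto
  also have "\<dots> = (\<Sum>m\<in>I. x m * cnj (x m))" using assms by simp
  also have "\<dots> = complex_of_real (\<Sum>m\<in>I. (cmod (x m))\<^sup>2)"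
    unfolding of_real_sum complex_norm_square ..
  finally show ?thesis by (simp add: qform_def)
qed

text \<open>
Let \<open>W\<close> be the error of a minimizer \<open>G\<close>, and \<open>\<langle>W, E\<rangle> = Re \<Sum> cnj W \<cdot> E\<close>. The derivative of the error in the direction of a
positive semidefinite family \<open>D\<close> is nonnegative, \<open>0 \<le> \<langle>W, defect D\<rangle>\<close>, and moving from \<open>G\<close> towards \<open>0\<close> gives
\<open>\<langle>W, defect G\<rangle> \<le> 0\<close>. The former for rank one families makes \<open>S = cnj W\<close> decrease under all shifts, as
\<open>agler_qform_le\<close> requires. That lemma bounds \<open>\<langle>W, h\<rangle> = S(p, p) - S(q, q)\<close> from below by
\<open>0\<close>, while \<open>\<langle>W, h\<rangle> = \<langle>W, defect G\<rangle> - \<Sum> |W|\<^sup>2 \<le> - \<Sum> |W|\<^sup>2\<close>.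
\<close>

lemma exists_agler_kernels:
  fixes f :: "complex ^ 'n::{finite,linorder} \<Rightarrow> complex" and d :: "'n \<Rightarrow> nat"
  defines "I \<equiv> index_box (\<lambda>i. d i + 1)"
  assumes agler: "agler_class f"
    and p_nz: "\<forall>z\<in>polydisk. peval p z \<noteq> 0"
    and f_eq: "\<forall>z\<in>polydisk. f z = peval q z / peval p z"
    and norms: "(\<Sum>m\<in>I. (cmod (cf p m))\<^sup>2) = (\<Sum>m\<in>I. (cmod (cf q m))\<^sup>2)"
  obtains G where "\<And>j. psd_on I (G j)"
    and "\<And>m n. m \<in> I \<Longrightarrow> n \<in> I \<Longrightarrow> defect G m n = cf p m * cnj (cf p n) - cf q m * cnj (cf q n)"
proof -
  define h where "h m n = cf p m * cnj (cf p n) - cf q m * cnj (cf q n)" for m n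
  obtain G where psd: "\<And>j. psd_on I (G j)"
    and min: "\<And>G'. (\<And>j. psd_on I (G' j)) \<Longrightarrow> defect_error I h G \<le> defect_error I h G'"
    using exists_minimal_defect_error[of d h] unfolding I_def by metis
  have fin: "finite I" by (simp add: I_def)
  define W where "W m n = defect G m n - h m n" for m n
  define ip where "ip E = Re (\<Sum>m\<in>I. \<Sum>n\<in>I. cnj (W m n) * E m n)" for E
  have slope: "0 \<le> ip (defect D)"
    if D: "\<And>t j. 0 < t \<Longrightarrow> t < 1 \<Longrightarrow> psd_on I (\<lambda>m n. G j m n + complex_of_real t * D j m n)" for D
  proof (rule nonneg_slope_of_quadratic)
    fix t :: real assume t: "0 < t" "t < 1"
    have "defect_error I h (\<lambda>j m n. G j m n + complex_of_real t * D j m n) =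
            (\<Sum>m\<in>I. \<Sum>n\<in>I. (cmod (W m n))\<^sup>2 + 2 * t * Re (cnj (W m n) * defect D m n) +
               t\<^sup>2 * (cmod (defect D m n))\<^sup>2)"
      unfolding defect_error_def defect_add_scaled
    proof (intro sum.cong refl)
      fix m n
      have "defect G m n + complex_of_real t * defect D m n - h m n = W m n + complex_of_real t * defect D m n"
        by (simp add: W_def)
      also have "(cmod (W m n + complex_of_real t * defect D m n))\<^sup>2 =
          (cmod (W m n))\<^sup>2 + 2 * t * Re (cnj (W m n) * defect D m n) + t\<^sup>2 * (cmod (defect D m n))\<^sup>2"
        unfolding cmod_power2 by (simp add: power2_eq_square algebra_simps)
      finally show "(cmod (defect G m n + complex_of_real t * defect D m n - h m n))\<^sup>2 =
          (cmod (W m n))\<^sup>2 + 2 * t * Re (cnj (W m n) * defect D m n) + t\<^sup>2 * (cmod (defect D m n))\<^sup>2" .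
    qed
    also have "\<dots> = defect_error I h G + 2 * t * ip (defect D) + t\<^sup>2 * (\<Sum>m\<in>I. \<Sum>n\<in>I. (cmod (defect D m n))\<^sup>2)"
      unfolding sum.distrib ip_def Re_sum sum_distrib_left defect_error_def W_def ..
    finally have "defect_error I h (\<lambda>j m n. G j m n + complex_of_real t * D j m n) =
            defect_error I h G + 2 * t * ip (defect D) + t\<^sup>2 * (\<Sum>m\<in>I. \<Sum>n\<in>I. (cmod (defect D m n))\<^sup>2)" .
    moreover have "defect_error I h G \<le> defect_error I h (\<lambda>j m n. G j m n + complex_of_real t * D j m n)"
      by (intro min D t)
    ultimately show "0 \<le> 2 * t * ip (defect D) + t\<^sup>2 * (\<Sum>m\<in>I. \<Sum>n\<in>I. (cmod (defect D m n))\<^sup>2)"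
      by linarith
  qed
  have slope_psd: "0 \<le> ip (defect D)" if "\<And>j. psd_on I (D j)" for D
    using that psd by (intro slope psd_on_add_scaled) auto
  have ip_G: "ip (defect G) \<le> 0"
  proof -
    have "0 \<le> ip (defect (\<lambda>j m n. - G j m n))"
    proof (rule slope)
      fix t :: real and j assume t: "0 < t" "t < 1"
      have "psd_on I (\<lambda>m n. 0 + complex_of_real (1 - t) * G j m n)"
        using t by (intro psd_on_add_scaled psd) auto
      then show "psd_on I (\<lambda>m n. G j m n + complex_of_real t * - G j m n)"
        by (simp add: algebra_simps)
    qed
    moreover have "defect (\<lambda>j m n. - G j m n) m n = - defect G m n" for m n
      unfolding defect_def sum_negf[symmetric] by (intro sum.cong) auto
    ultimately show ?thesis by (simp add: ip_def sum_negf)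
  qed
  define S where "S m n = cnj (W m n)" for m n
  have S_contr: "qform I S (shift j x) \<le> qform I S x" for j x
  proof -
    let ?D = "\<lambda>k m n. if k = j then x m * cnj (x n) else 0"
    have "psd_on I (?D k)" for k
      by (cases "k = j") (simp_all add: psd_on_rank_one)
    then have "0 \<le> ip (defect ?D)" by (rule slope_psd)
    also have "ip (defect ?D) = qform I S x - qform I S (shift j x)"
      unfolding ip_def defect_rank_one qform_def S_def
      by (simp add: right_diff_distrib sum_subtractf mult.assoc)
    finally show ?thesis by simp
  qed
  have S_nonneg: "0 \<le> qform I S x" for x
  proof -
    have "qform I S ((shift j ^^ k) x) \<le> qform I S x" for k j
      by (induction k) (auto intro: order_trans[OF S_contr])
    then show ?thesis
      using qform_shift_power_vanishes[of d S _ x] unfolding I_def by metis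
  qed
  \<comment> \<open>Adding the identity makes the form definite; it contributes equally to both sides because of \<open>norms\<close>.\<close>
  define S1 where "S1 m n = S m n + complex_of_real 1 * (if m = n then 1 else 0)" for m n
  have S1: "qform I S1 x = qform I S x + (\<Sum>m\<in>I. (cmod (x m))\<^sup>2)" for x
    unfolding S1_def qform_add_scaled qform_identity_weight[OF fin] by simp
  have "qform I S1 (cf q) \<le> qform I S1 (cf p)"
    unfolding I_def
  proof (rule agler_qform_le[OF agler p_nz f_eq])
    fix m n assume mn: "m \<in> index_box (\<lambda>i. d i + 1)" "n \<in> index_box (\<lambda>i. d i + 1)"
    have "defect G n m = cnj (defect G m n)"
      using psd unfolding I_def by (intro defect_hermitian[OF _ mn])
    then show "S1 n m = cnj (S1 m n)"
      by (auto simp: S1_def S_def W_def h_def)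
  next
    show "(0::real) < 1" by simp
  next
    fix x show "1 * (\<Sum>m\<in>index_box (\<lambda>i. d i + 1). (cmod (x m))\<^sup>2) \<le> qform (index_box (\<lambda>i. d i + 1)) S1 x"
      using S1[of x] S_nonneg[of x] unfolding I_def by linarith
  next
    fix j x show "qform (index_box (\<lambda>i. d i + 1)) S1 (shift j x) \<le> qform (index_box (\<lambda>i. d i + 1)) S1 x"
      using S1[of x] S1[of "shift j x"] S_contr[of j x] sum_norm_shift_le[of j x "\<lambda>i. d i + 1"]
      unfolding I_def by linarith
  qed
  then have "0 \<le> qform I S (cf p) - qform I S (cf q)"
    using S1 norms by simp
  also have "\<dots> = ip h"
    unfolding ip_def h_def qform_def S_def
    by (simp add: right_diff_distrib sum_subtractf mult.assoc)
  also have "\<dots> = ip (defect G) - (\<Sum>m\<in>I. \<Sum>n\<in>I. (cmod (W m n))\<^sup>2)"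
  proof -
    have "cnj (W m n) * h m n = cnj (W m n) * defect G m n - complex_of_real ((cmod (W m n))\<^sup>2)" for m n
      unfolding complex_norm_square by (simp add: W_def algebra_simps)
    then show ?thesis by (simp add: ip_def sum_subtractf)
  qed
  finally have "(\<Sum>m\<in>I. \<Sum>n\<in>I. (cmod (W m n))\<^sup>2) \<le> 0" using ip_G by linarith
  then have "(\<Sum>m\<in>I. \<Sum>n\<in>I. (cmod (W m n))\<^sup>2) = 0"
    by (intro antisym sum_nonneg) auto
  then have W0: "W m n = 0" if "m \<in> I" "n \<in> I" for m n
    using that fin by (simp add: sum_nonneg_eq_0_iff sum_nonneg)
  show ?thesis
    by (rule that[OF psd]) (use W0 in \<open>simp add: W_def h_def\<close>)
qed

text \<open>
With weight \<open>1\<close>, \<open>weighted_trace\<close> picks out exactly the diagonal entries of \<open>G j\<close> with \<open>m\<^sub>j = d\<^sub>j\<close>, those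
whose shift leaves the box. They are nonnegative with sum zero.
\<close>

lemma kernels_vanish_on_top_layer:
  fixes d :: "'n::finite \<Rightarrow> nat"
  defines "I \<equiv> index_box (\<lambda>i. d i + 1)"
  assumes psd: "\<And>j. psd_on I (G j)"
    and trace: "(\<Sum>m\<in>I. defect G m m) = 0"
    and mn: "m \<in> I" "n \<in> I" and top: "cf m j = d j \<or> cf n j = d j"
  shows "G j m n = 0"
proof -
  have fin: "finite I" by (simp add: I_def)
  have diag0: "G j m m = 0" if m: "m \<in> I" "cf m j = d j" for m j
  proof -
    define w where "w j m = Re (G j m m) * (1 - (if m + unit_index j \<in> I then 1 else 0))" for j m
    have w0: "0 \<le> w j m" if "m \<in> I" for j m
      using psd_on_diagonal(1)[OF psd fin that] by (simp add: w_def)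
    have "0 = Re (\<Sum>m\<in>I. 1 * defect G m m)" using trace by simp
    also have "(\<Sum>m\<in>I. 1 * defect G m m) =
        (\<Sum>j\<in>UNIV. \<Sum>m\<in>I. G j m m * (1 - (if m + unit_index j \<in> I then 1 else 0)))"
      unfolding defect_diagonal I_def by (rule weighted_trace)
    also have "Re \<dots> = (\<Sum>j\<in>UNIV. \<Sum>m\<in>I. w j m)"
      unfolding Re_sum w_def by (intro sum.cong) auto
    finally have "(\<Sum>j\<in>UNIV. \<Sum>m\<in>I. w j m) = 0" by simp
    then have "(\<Sum>m\<in>I. w j m) = 0"
      using w0 by (simp add: sum_nonneg_eq_0_iff sum_nonneg)
    then have "w j m = 0" using w0 m fin by (simp add: sum_nonneg_eq_0_iff)
    moreover have "m + unit_index j \<notin> I"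
      using m(2) by (auto simp: I_def index_box_def lookup_add lookup_unit_index intro!: exI[of _ j])
    ultimately have "Re (G j m m) = 0" by (simp add: w_def)
    then show ?thesis using psd_on_diagonal(2)[OF psd fin m(1), of j] by simp
  qed
  show ?thesis
  proof (cases "cf n j = d j")
    case True
    show ?thesis by (rule psd_on_zero_diagonal[OF psd fin mn diag0[OF mn(2) True]])
  next
    case False
    with top have "G j n m = 0"
      using psd_on_zero_diagonal[OF psd fin mn(2,1) diag0[OF mn(1)]] by blast
    moreover have "G j m n = cnj (G j n m)" using psd[of j] mn unfolding psd_on_def by blast
    ultimately show ?thesis by simp
  qed
qed

section \<open>Gram factorization\<close>

lemma psd_on_subset:
  assumes "psd_on I A" "M \<subseteq> I" "finite I"
  shows "psd_on M A"
proof -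
  have "0 \<le> qform M A x" for x
  proof -
    let ?y = "\<lambda>m. if m \<in> M then x m else 0"
    have "(\<Sum>m\<in>I. \<Sum>n\<in>I. A m n * ?y m * cnj (?y n)) = (\<Sum>m\<in>M. \<Sum>n\<in>I. A m n * ?y m * cnj (?y n))"
      using assms by (intro sum.mono_neutral_right) auto
    also have "\<dots> = (\<Sum>m\<in>M. \<Sum>n\<in>M. A m n * ?y m * cnj (?y n))"
      using assms by (intro sum.cong sum.mono_neutral_right) auto
    also have "\<dots> = (\<Sum>m\<in>M. \<Sum>n\<in>M. A m n * x m * cnj (x n))" by simp
    finally have "qform M A x = qform I A ?y" by (simp add: qform_def)
    then show ?thesis using assms(1) unfolding psd_on_def by simp
  qed
  then show ?thesis using assms unfolding psd_on_def by blast
qed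

text \<open>
Minimizing the form over the entry at \<open>s\<close> yields the Schur complement; \<open>y\<close> is the minimizer. For
\<open>A s s = 0\<close> the convention \<open>x / 0 = 0\<close> makes \<open>c\<close> vanish, and the formulas remain correct.
\<close>

lemma schur_complement_psd:
  assumes psd: "psd_on (insert s M) A" and M: "finite M" "s \<notin> M"
  defines "c \<equiv> \<lambda>m. A m s / complex_of_real (sqrt (Re (A s s)))"
  shows "psd_on M (\<lambda>m n. A m n - c m * cnj (c n))"
  unfolding psd_on_def
proof (intro conjI ballI allI)
  fix m n assume "m \<in> M" "n \<in> M"
  then have "A n m = cnj (A m n)" using psd unfolding psd_on_def by blast
  then show "A n m - c n * cnj (c m) = cnj (A m n - c m * cnj (c n))" by (simp add: mult.commute)
next
  fix x
  define \<alpha> where "\<alpha> = Re (A s s)"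
  have \<alpha>: "0 \<le> \<alpha>" "A s s = complex_of_real \<alpha>"
    using psd_on_diagonal[OF psd, of s] M unfolding \<alpha>_def by auto
  define L where "L = (\<Sum>m\<in>M. A m s * x m)"
  define y where "y m = (if m = s then - L / complex_of_real \<alpha> else x m)" for m
  have ys: "y s = - L / complex_of_real \<alpha>" by (simp add: y_def)
  have y: "y m = x m" if "m \<in> M" for m using that M by (auto simp: y_def)
  have sn: "A s n = cnj (A n s)" if "n \<in> M" for n
    using psd that unfolding psd_on_def by blast
  have L': "(\<Sum>n\<in>M. A s n * y s * cnj (x n)) = y s * cnj L"
    unfolding L_def cnj_sum sum_distrib_left by (intro sum.cong) (auto simp: sn)
  have L2: "(\<Sum>m\<in>M. A m s * x m * cnj (y s)) = L * cnj (y s)"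
    unfolding L_def sum_distrib_right ..
  have "(\<Sum>m\<in>insert s M. \<Sum>n\<in>insert s M. A m n * y m * cnj (y n)) =
          (A s s * y s * cnj (y s) + y s * cnj L) +
          (L * cnj (y s) + (\<Sum>m\<in>M. \<Sum>n\<in>M. A m n * x m * cnj (x n)))"
    using M by (simp add: y sum.distrib L' L2)
  also have "\<dots> = (\<Sum>m\<in>M. \<Sum>n\<in>M. A m n * x m * cnj (x n)) - L * cnj L / complex_of_real \<alpha>"
    unfolding ys \<alpha>(2) by (cases "\<alpha> = 0") (auto simp: field_simps)
  finally have "qform (insert s M) A y = Re ((\<Sum>m\<in>M. \<Sum>n\<in>M. A m n * x m * cnj (x n)) - L * cnj L / complex_of_real \<alpha>)"
    by (simp only: qform_def)
  moreover have "(\<Sum>m\<in>M. \<Sum>n\<in>M. (A m n - c m * cnj (c n)) * x m * cnj (x n)) =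
          (\<Sum>m\<in>M. \<Sum>n\<in>M. A m n * x m * cnj (x n)) - L * cnj L / complex_of_real \<alpha>"
  proof -
    have "(\<Sum>m\<in>M. c m * x m) = L / complex_of_real (sqrt \<alpha>)"
      by (simp add: c_def L_def \<alpha>_def sum_divide_distrib)
    moreover have "(\<Sum>m\<in>M. \<Sum>n\<in>M. c m * cnj (c n) * x m * cnj (x n)) =
            (\<Sum>m\<in>M. c m * x m) * cnj (\<Sum>m\<in>M. c m * x m)"
      by (simp add: sum_product mult_ac)
    ultimately have "(\<Sum>m\<in>M. \<Sum>n\<in>M. c m * cnj (c n) * x m * cnj (x n)) = L * cnj L / complex_of_real \<alpha>"
      using \<alpha>(1) by (simp flip: of_real_mult)
    then show ?thesis by (simp add: left_diff_distrib sum_subtractf)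
  qed
  ultimately have "qform M (\<lambda>m n. A m n - c m * cnj (c n)) x = qform (insert s M) A y"
    by (simp only: qform_def)
  then show "0 \<le> qform M (\<lambda>m n. A m n - c m * cnj (c n)) x"
    using psd unfolding psd_on_def by simp
qed

text \<open>
One step of the Cholesky factorization for each index, so that as many vectors suffice as there are
indices.
\<close>

lemma psd_on_gram:
  assumes "finite M" "psd_on M A"
  shows "\<exists>a. \<forall>m\<in>M. \<forall>n\<in>M. A m n = (\<Sum>k<card M. a k m * cnj (a k n))"
  using assms
proof (induction M arbitrary: A rule: finite_induct)
  case (insert s M)
  define c where "c = (\<lambda>m. A m s / complex_of_real (sqrt (Re (A s s))))"
  have fin: "finite (insert s M)" using insert by simp
  have "psd_on M (\<lambda>m n. A m n - c m * cnj (c n))"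
    unfolding c_def by (rule schur_complement_psd) (use insert in auto)
  then obtain a where a: "\<And>m n. m \<in> M \<Longrightarrow> n \<in> M \<Longrightarrow>
      A m n - c m * cnj (c n) = (\<Sum>k<card M. a k m * cnj (a k n))"
    using insert.IH by blast
  define a' where "a' k m = (if k = card M then c m else if m = s then 0 else a k m)" for k m
  have last: "(\<Sum>k<card (insert s M). a' k m * cnj (a' k n)) =
          (\<Sum>k<card M. (if m = s then 0 else a k m) * cnj (if n = s then 0 else a k n)) + c m * cnj (c n)" for m n
    using insert.hyps by (simp add: a'_def)
  have diag: "0 \<le> Re (A s s)" "A s s = complex_of_real (Re (A s s))"
    using psd_on_diagonal[OF insert.prems fin, of s] by auto
  have row: "A m s = c m * cnj (c s)" if "m \<in> insert s M" for m
  proof (cases "Re (A s s) = 0")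
    case True
    then have "A m s = 0"
      using psd_on_zero_diagonal[OF insert.prems fin that, of s] diag(2) by simp
    then show ?thesis by (simp add: c_def)
  next
    case False
    let ?r = "complex_of_real (sqrt (Re (A s s)))"
    have r: "?r * ?r = A s s" "?r \<noteq> 0" using diag False by (simp_all flip: of_real_mult)
    then have "c s = ?r" by (simp add: c_def divide_eq_eq)
    then show ?thesis using r(2) by (simp add: c_def)
  qed
  have "A m n = (\<Sum>k<card (insert s M). a' k m * cnj (a' k n))"
    if mn: "m \<in> insert s M" "n \<in> insert s M" for m n
  proof (cases "m = s \<or> n = s")
    case True
    have "A m n = c m * cnj (c n)"
    proof (cases "n = s")
      case False
      have "A m n = cnj (A n m)" using insert.prems mn unfolding psd_on_def by blast
      then show ?thesis using True False row[OF mn(2)] by simp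
    qed (use row[OF mn(1)] in simp)
    then show ?thesis unfolding last using True by auto
  next
    case False
    then show ?thesis unfolding last using a[of m n] mn by (simp add: algebra_simps)
  qed
  then show ?case by blast
qed simp

section \<open>Isometries from equal Gram matrices\<close>

definition dot :: "nat \<Rightarrow> cseq \<Rightarrow> cseq \<Rightarrow> complex" where
  "dot N x y = (\<Sum>i<N. x i * cnj (y i))"

lemma dot_add_left: "dot N (x + y) z = dot N x z + dot N y z"
  by (simp add: dot_def algebra_simps sum.distrib)

lemma dot_diff_left: "dot N (x - y) z = dot N x z - dot N y z"
  by (simp add: dot_def algebra_simps sum_subtractf)

lemma dot_scale_left: "dot N (cscale c x) z = c * dot N x z"
  by (simp add: dot_def cscale_def sum_distrib_left mult_ac)

lemma dot_commute: "dot N x y = cnj (dot N y x)"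
  by (simp add: dot_def mult.commute)

lemma dot_diff_right: "dot N z (x - y) = dot N z x - dot N z y"
  by (simp add: dot_def algebra_simps sum_subtractf)

lemma dot_scale_right: "dot N z (cscale c x) = cnj c * dot N z x"
  by (simp add: dot_def cscale_def sum_distrib_left mult_ac)

lemma dot_self: "dot N x x = complex_of_real (\<Sum>i<N. (cmod (x i))\<^sup>2)"
  unfolding dot_def of_real_sum complex_norm_square ..

lemma dot_cong:
  assumes "\<And>i. i < N \<Longrightarrow> x i = x' i" "\<And>i. i < N \<Longrightarrow> y i = y' i"
  shows "dot N x y = dot N x' y'"
  using assms by (simp add: dot_def)

definition linear_isometry :: "nat \<Rightarrow> (cseq \<Rightarrow> cseq) \<Rightarrow> bool" where
  "linear_isometry N V \<longleftrightarrow> (\<forall>x y. V (x + y) = V x + V y) \<and> (\<forall>c x. V (cscale c x) = cscale c (V x)) \<and>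
     (\<forall>x y. dot N (V x) (V y) = dot N x y)"

text \<open>
A complex Householder reflection along \<open>\<delta> = w - v\<close>. The coefficient \<open>1 / \<langle>w, \<delta>\<rangle>\<close> in place of
\<open>2 / \<langle>\<delta>, \<delta>\<rangle>\<close> takes care of a nonreal \<open>\<langle>w, v\<rangle>\<close>; the resulting map is still isometric since
\<open>\<langle>\<delta>, \<delta>\<rangle> = 2 Re \<langle>w, \<delta>\<rangle>\<close> for vectors of equal norm.
\<close>

lemma reflection_exists:
  assumes same: "dot N w w = dot N v v"
  obtains R where "linear_isometry N R" "\<And>i. i < N \<Longrightarrow> R w i = v i"
    and "\<And>x. dot N x w = dot N x v \<Longrightarrow> R x = x"
proof -
  define \<delta> where "\<delta> = w - v"
  have "cnj (dot N v v) = dot N v v" by (simp add: dot_self)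
  then have \<delta>\<delta>: "dot N \<delta> \<delta> = dot N w \<delta> + cnj (dot N w \<delta>)"
    using same dot_commute[of N v w]
    unfolding \<delta>_def dot_diff_left dot_diff_right by simp
  show ?thesis
  proof (cases "dot N w \<delta> = 0")
    case True
    have "(\<Sum>i<N. (cmod (\<delta> i))\<^sup>2) = 0"
      using True \<delta>\<delta> unfolding dot_self by (simp only: complex_cnj_zero add_0 of_real_eq_0_iff)
    then have "\<delta> i = 0" if "i < N" for i
      using that by (simp add: sum_nonneg_eq_0_iff)
    then show ?thesis
      by (intro that[of id]) (auto simp: linear_isometry_def \<delta>_def)
  next
    case False
    define c where "c = 1 / dot N w \<delta>"
    define R where "R x = x - cscale (c * dot N x \<delta>) \<delta>" for x
    have c: "c + cnj c = c * cnj c * dot N \<delta> \<delta>"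
      unfolding \<delta>\<delta> c_def using False by (simp add: field_simps)
    have "dot N (R x) (R y) = dot N x y" for x y
    proof -
      have "dot N (R x) (R y) = dot N x y - (c + cnj c) * (dot N x \<delta> * cnj (dot N y \<delta>)) +
              c * cnj c * dot N \<delta> \<delta> * (dot N x \<delta> * cnj (dot N y \<delta>))"
        unfolding R_def dot_diff_left dot_diff_right dot_scale_left dot_scale_right
        using dot_commute[of N \<delta> y] by (simp add: algebra_simps)
      then show ?thesis by (simp add: c)
    qed
    moreover have "R (x + y) = R x + R y" for x y
      by (rule ext) (simp add: R_def dot_add_left cscale_def algebra_simps)
    moreover have "R (cscale b x) = cscale b (R x)" for b x
      unfolding R_def dot_scale_left by (rule ext) (simp add: cscale_def algebra_simps)
    ultimately have "linear_isometry N R" unfolding linear_isometry_def by blast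
    moreover have "R w = v"
      using False by (rule_tac ext) (simp add: R_def c_def cscale_def \<delta>_def)
    moreover have "R x = x" if "dot N x w = dot N x v" for x
    proof -
      have "dot N x \<delta> = 0" using that by (simp only: \<delta>_def dot_diff_right diff_self)
      then show ?thesis by (rule_tac ext) (simp add: R_def cscale_def)
    qed
    ultimately show ?thesis by (intro that[of R]) auto
  qed
qed

text \<open>
Treat the vectors one at a time. If \<open>V\<close> is correct on \<open>S\<close>, the reflection that takes \<open>V (u s)\<close> to \<open>v s\<close> fixes
all \<open>v t\<close> with \<open>t\<close> in \<open>S\<close>, because \<open>V (u s) - v s\<close> is orthogonal to them by equality of the Gram matrices. This
extends to the whole space without comparing dimensions of complements.
\<close>

lemma isometry_from_equal_gram:
  assumes "finite S" and "\<And>s t. s \<in> S \<Longrightarrow> t \<in> S \<Longrightarrow> dot N (u s) (u t) = dot N (v s) (v t)"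
  shows "\<exists>V. linear_isometry N V \<and> (\<forall>s\<in>S. \<forall>i<N. V (u s) i = v s i)"
  using assms
proof (induction S rule: finite_induct)
  case empty
  have "linear_isometry N id" by (simp add: linear_isometry_def)
  then show ?case by blast
next
  case (insert s S)
  then obtain V where V: "linear_isometry N V" and Vu: "\<And>t i. t \<in> S \<Longrightarrow> i < N \<Longrightarrow> V (u t) i = v t i"
    by (metis insertCI)
  have dotV: "dot N (V x) (V y) = dot N x y" for x y
    using V unfolding linear_isometry_def by blast
  have "dot N (V (u s)) (V (u s)) = dot N (v s) (v s)"
    using insert.prems by (simp add: dotV)
  then obtain R where R: "linear_isometry N R" "\<And>i. i < N \<Longrightarrow> R (V (u s)) i = v s i"
    "\<And>x. dot N x (V (u s)) = dot N x (v s) \<Longrightarrow> R x = x"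
    by (rule reflection_exists) blast
  have "linear_isometry N (R \<circ> V)"
    using V R(1) unfolding linear_isometry_def by (simp only: o_def) metis
  moreover have "(R \<circ> V) (u t) i = v t i" if t: "t \<in> insert s S" and i: "i < N" for t i
  proof (cases "t = s")
    case True then show ?thesis using R(2) i by simp
  next
    case False
    with t have t: "t \<in> S" by simp
    have "dot N (V (u t)) (V (u s)) = dot N (v t) (v s)"
      using insert.prems t by (simp add: dotV)
    also have "\<dots> = dot N (V (u t)) (v s)" by (rule dot_cong) (simp_all add: Vu t)
    finally have "R (V (u t)) = V (u t)" by (rule R(3))
    then show ?thesis using Vu t i by simp
  qed
  ultimately show ?case by blast
qed

section \<open>Transfer function realizations from isometries\<close>

definition coords :: "nat set \<Rightarrow> cseq set" where
  "coords S = {x. \<forall>i. i \<notin> S \<longrightarrow> x i = 0}"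

definition unit_seq :: "nat \<Rightarrow> cseq" where
  "unit_seq i = (\<lambda>k. if k = i then 1 else 0)"

lemma coord_space_eq_coords: "coord_space N = coords {..<N}"
  by (auto simp: coord_space_def coords_def)

lemma sum_cseq_apply: "(\<Sum>x\<in>A. F x) (i::nat) = (\<Sum>x\<in>A. F x i :: complex)"
  by (induction A rule: infinite_finite_induct) auto

lemma subspace_coords: "cvec.subspace (coords S)"
  by (auto simp: cvec.subspace_def coords_def cscale_def)

lemma inj_unit_seq: "inj unit_seq"
  by (rule injI) (metis unit_seq_def zero_neq_one)

lemma span_unit_seq:
  assumes "finite S"
  shows "cvec.span (unit_seq ` S) = coords S"
proof
  show "cvec.span (unit_seq ` S) \<subseteq> coords S"
    by (rule cvec.span_minimal[OF _ subspace_coords]) (auto simp: unit_seq_def coords_def)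
  show "coords S \<subseteq> cvec.span (unit_seq ` S)"
  proof
    fix x assume x: "x \<in> coords S"
    have "x = (\<Sum>i\<in>S. cscale (x i) (unit_seq i))"
    proof
      fix k
      have "(\<Sum>i\<in>S. cscale (x i) (unit_seq i) k) = (\<Sum>i\<in>S. if k = i then x i else 0)"
        by (intro sum.cong) (auto simp: cscale_def unit_seq_def)
      then show "x k = (\<Sum>i\<in>S. cscale (x i) (unit_seq i)) k"
        using x assms by (auto simp: sum_cseq_apply coords_def)
    qed
    also have "\<dots> \<in> cvec.span (unit_seq ` S)"
      by (intro cvec.span_sum cvec.span_scale cvec.span_base) auto
    finally show "x \<in> cvec.span (unit_seq ` S)" .
  qed
qed

lemma independent_unit_seq:
  assumes "finite S"
  shows "cvec.independent (unit_seq ` S)"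
proof
  assume "cvec.dependent (unit_seq ` S)"
  then obtain u where u: "\<exists>v\<in>unit_seq ` S. u v \<noteq> 0" "(\<Sum>v\<in>unit_seq ` S. cscale (u v) v) = 0"
    using cvec.dependent_finite[of "unit_seq ` S"] assms by auto
  then obtain i where i: "i \<in> S" "u (unit_seq i) \<noteq> 0" by auto
  have "0 = (\<Sum>v\<in>unit_seq ` S. cscale (u v) v) i" using u(2) by simp
  also have "\<dots> = (\<Sum>k\<in>S. cscale (u (unit_seq k)) (unit_seq k) i)"
    unfolding sum_cseq_apply
    by (rule sum.reindex_cong[of unit_seq]) (use inj_unit_seq in \<open>auto intro: inj_on_subset\<close>)
  also have "\<dots> = (\<Sum>k\<in>S. if k = i then u (unit_seq i) else 0)"
    by (intro sum.cong) (auto simp: cscale_def unit_seq_def)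
  also have "\<dots> = u (unit_seq i)" using i assms by simp
  finally show False using i by simp
qed

lemma dim_coords:
  assumes "finite S"
  shows "cvec.dim (coords S) = card S"
proof -
  have "cvec.dim (cvec.span (unit_seq ` S)) = card (unit_seq ` S)"
    by (rule cvec.dim_span_eq_card_independent[OF independent_unit_seq[OF assms]])
  also have "\<dots> = card S"
    by (rule card_image) (use inj_unit_seq in \<open>auto intro: inj_on_subset\<close>)
  finally show ?thesis by (simp add: span_unit_seq[OF assms])
qed

lemma finite_dimensional_coords:
  "finite S \<Longrightarrow> finite_dimensional (coords S)"
  unfolding finite_dimensional_def using span_unit_seq by blast

text \<open>
Dimension count: the images of the unit vectors are as many independent vectors as the space has
dimensions.
\<close>

lemma injective_imp_surjective_coords:
  assumes S: "finite S" and lin: "Vector_Spaces.linear cscale cscale L"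
    and into: "L ` coords S \<subseteq> coords S" and inj: "inj_on L (coords S)"
  shows "L ` coords S = coords S"
proof (rule antisym[OF into], rule subsetI)
  interpret vs: vector_space_pair cscale cscale ..
  fix y assume y: "y \<in> coords S"
  let ?U = "unit_seq ` S"
  have card_U: "card ?U = card S"
    by (rule card_image) (use inj_unit_seq in \<open>auto intro: inj_on_subset\<close>)
  have sub_U: "?U \<subseteq> coords S"
    by (auto simp: unit_seq_def coords_def)
  have ind: "cvec.independent (L ` ?U)"
    by (rule vs.linear_independent_injective_image[OF lin independent_unit_seq[OF S]])
      (use inj in \<open>simp add: span_unit_seq[OF S]\<close>)
  have card_LU: "card (L ` ?U) = card S"
    using card_image[OF inj_on_subset[OF inj sub_U]] card_U by simp
  have "y \<in> cvec.span (L ` ?U)"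
  proof (rule ccontr)
    assume not: "y \<notin> cvec.span (L ` ?U)"
    then have "cvec.independent (insert y (L ` ?U))"
      using ind by (rule cvec.independent_insertI)
    moreover have "insert y (L ` ?U) \<subseteq> cvec.span ?U"
      using y into sub_U by (auto simp: span_unit_seq[OF S])
    ultimately have "card (insert y (L ` ?U)) \<le> card ?U"
      using cvec.independent_span_bound[of ?U] S by blast
    moreover have "y \<notin> L ` ?U" using not cvec.span_base[of y "L ` ?U"] by argo
    ultimately show False using S card_LU card_U by simp
  qed
  also have "cvec.span (L ` ?U) = L ` coords S"
    using vs.linear_span_image[OF lin, of ?U] by (simp add: span_unit_seq[OF S])
  finally show "y \<in> L ` coords S" .
qed

lemma linear_isometry_zero:
  assumes "linear_isometry K V"
  shows "V 0 = 0"
proof -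
  have "V (cscale 0 0) = cscale 0 (V 0)" using assms unfolding linear_isometry_def by blast
  then show ?thesis by (simp only: cvec.scale_zero_left)
qed

lemma linear_isometry_sum:
  assumes V: "linear_isometry K V"
  shows "V (\<Sum>s\<in>S. cscale (c s) (x s)) = (\<Sum>s\<in>S. cscale (c s) (V (x s)))"
proof -
  have add: "V (x + y) = V x + V y" and scale: "V (cscale b x) = cscale b (V x)" for x y b
    using V unfolding linear_isometry_def by blast+
  show ?thesis
  proof (induction S rule: infinite_finite_induct)
    case (insert s S)
    then show ?case by (simp only: sum.insert[OF insert.hyps] add scale)
  next
    case (infinite S)
    then show ?case by (simp only: sum.infinite[OF infinite] linear_isometry_zero[OF V])
  next
    case empty
    then show ?case by (simp only: sum.empty linear_isometry_zero[OF V])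
  qed
qed

text \<open>
The isometry acts on \<open>\<complex>\<^sup>N \<oplus> \<complex>\<close>, with the scalar summand at position \<open>N\<close>; its four blocks are \<open>A\<close>, \<open>B\<close>, \<open>C\<close> and \<open>D\<close>.
The assumption on \<open>z\<close> says \<open>V (1, E(z) x) = (f(z), x)\<close>, that is \<open>f(z) = A + B E(z) x\<close> and \<open>(I - D E(z)) x = C\<close>. The
operator \<open>I - D E(z)\<close> is injective since \<open>D\<close> is a contraction and \<open>E(z)\<close> strictly decreases the norm of nonzero
vectors, and injective operators in finite dimension are bijective.
\<close>

lemma transfer_realization_of_isometry:
  fixes f :: "complex ^ 'n::finite \<Rightarrow> complex" and blk :: "nat \<Rightarrow> 'n"
  assumes V: "linear_isometry (Suc N) V"
    and model: "\<And>z. z \<in> polydisk \<Longrightarrow> \<exists>x \<in> coord_space N. \<forall>i\<le>N.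
       V (\<lambda>i. if i = N then 1 else z $ blk i * x i) i = (if i = N then f z else x i)"
  shows "\<exists>H ip A B C D. transfer_realization f H ip (\<lambda>j. coords {i. i < N \<and> blk i = j}) A B C D"
proof -
  define H where "H = coord_space N"
  define ip where "ip = mat_ip N (\<lambda>i k. if i = k then 1 else 0)"
  define Hs where "Hs j = coords {i. i < N \<and> blk i = j}" for j
  define cut :: "cseq \<Rightarrow> cseq" where "cut y = (\<lambda>i. if i < N then y i else 0)" for y
  define A where "A = V (unit_seq N) N"
  define B where "B x = V x N" for x
  define C where "C a = cut (V (cscale a (unit_seq N)))" for a
  define D where "D x = cut (V x)" for x
  define E where "E z x = (\<lambda>i. if i < N then z $ blk i * x i else 0)" for z :: "complex ^ 'n" and x :: cseq
  have V_add: "V (x + y) = V x + V y" and V_scale: "V (cscale b x) = cscale b (V x)"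
    and V_dot: "dot (Suc N) (V x) (V y) = dot (Suc N) x y" for x y b
    using V unfolding linear_isometry_def by blast+
  have cut_add: "cut (x + y) = cut x + cut y" for x y
    by (auto simp: cut_def)
  have cut_scale: "cut (cscale b x) = cscale b (cut x)" for b x
    by (auto simp: cut_def cscale_def)
  have cut_H [simp]: "cut x \<in> H" for x by (simp add: cut_def H_def coord_space_def)
  have ip_eq: "ip x y = dot N x y" for x y
  proof -
    have "(\<Sum>k<N. (if i = k then 1 else 0) * x i * cnj (y k)) = (if i < N then x i * cnj (y i) else 0)" for i
    proof -
      have "(\<Sum>k<N. (if i = k then 1 else 0) * x i * cnj (y k)) = (\<Sum>k<N. if i = k then x i * cnj (y k) else 0)"
        by (intro sum.cong) auto
      then show ?thesis by simp
    qed
    then show ?thesis by (simp add: ip_def mat_ip_def dot_def)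
  qed
  have norm_eq: "(ip_norm ip x)\<^sup>2 = (\<Sum>i<N. (cmod (x i))\<^sup>2)" for x
    unfolding ip_norm_def ip_eq dot_self by (simp add: sum_nonneg)
  interpret coord_hilbert N "\<lambda>i k. if i = k then 1 else 0" 1
  proof
    fix x
    show "1 * (\<Sum>i<N. (cmod (x i))\<^sup>2) \<le> Re (mat_ip N (\<lambda>i k. if i = k then 1 else 0) x x)"
      using ip_eq[of x x] unfolding ip_def dot_self by simp
  qed auto
  have isometry: "(cmod (A * a + B x))\<^sup>2 + (ip_norm ip (C a + D x))\<^sup>2 = (cmod a)\<^sup>2 + (ip_norm ip x)\<^sup>2"
    if x: "x \<in> H" for a x
  proof -
    let ?y = "cscale a (unit_seq N) + x"
    have "complex_of_real (\<Sum>i<Suc N. (cmod (V ?y i))\<^sup>2) = complex_of_real (\<Sum>i<Suc N. (cmod (?y i))\<^sup>2)"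
      using V_dot[of ?y ?y] unfolding dot_self .
    then have "(\<Sum>i<Suc N. (cmod (V ?y i))\<^sup>2) = (\<Sum>i<Suc N. (cmod (?y i))\<^sup>2)"
      unfolding of_real_eq_iff .
    moreover have "V ?y N = A * a + B x"
      unfolding V_add V_scale by (simp add: A_def B_def cscale_def mult.commute)
    moreover have "(\<Sum>i<N. (cmod (V ?y i))\<^sup>2) = (ip_norm ip (C a + D x))\<^sup>2"
      unfolding norm_eq C_def D_def V_add V_scale by (simp add: cut_def cscale_def)
    moreover have "(\<Sum>i<N. (cmod (?y i))\<^sup>2) = (ip_norm ip x)\<^sup>2"
      unfolding norm_eq by (intro sum.cong) (auto simp: cscale_def unit_seq_def)
    moreover have "?y N = a" using x by (simp add: cscale_def unit_seq_def H_def coord_space_def)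
    ultimately show ?thesis by simp
  qed
  have D_contr: "(ip_norm ip (D x))\<^sup>2 \<le> (ip_norm ip x)\<^sup>2" if x: "x \<in> H" for x
  proof -
    have "C 0 + D x = D x"
      unfolding C_def V_scale by (rule ext) (simp add: cut_def cscale_def)
    then have "(cmod (B x))\<^sup>2 + (ip_norm ip (D x))\<^sup>2 = (ip_norm ip x)\<^sup>2"
      using isometry[OF x, of 0] by simp
    then show ?thesis using zero_le_power2[of "cmod (B x)"] by linarith
  qed
  have components: "components Hs x = (\<lambda>j i. if i < N \<and> blk i = j then x i else 0)" if x: "x \<in> H" for x
    unfolding components_def
  proof (rule the_equality)
    let ?u = "\<lambda>j i. if i < N \<and> blk i = j then x i else 0"
    have "x i = (\<Sum>j\<in>UNIV. ?u j) i" for i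
    proof -
      have "(\<Sum>j\<in>UNIV. ?u j i) = (\<Sum>j\<in>UNIV. if blk i = j then (if i < N then x i else 0) else 0)"
        by (intro sum.cong) auto
      then show ?thesis using x by (auto simp: sum_cseq_apply H_def coord_space_def)
    qed
    then show "(\<forall>j. ?u j \<in> Hs j) \<and> x = (\<Sum>j\<in>UNIV. ?u j)"
      by (auto simp: Hs_def coords_def)
  next
    fix u assume u: "(\<forall>j. u j \<in> Hs j) \<and> x = (\<Sum>j\<in>UNIV. u j)"
    show "u = (\<lambda>j i. if i < N \<and> blk i = j then x i else 0)"
    proof (intro ext)
      fix j i
      have zero: "u k i = 0" if "\<not> (i < N \<and> blk i = k)" for k
        using u that by (auto simp: Hs_def coords_def)
      have "x i = (\<Sum>k\<in>UNIV. u k) i" using u by simp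
      also have "\<dots> = (\<Sum>k\<in>UNIV. if k = blk i then u (blk i) i else 0)"
        unfolding sum_cseq_apply using zero by (intro sum.cong) auto
      finally have "x i = u (blk i) i" by simp
      then show "u j i = (if i < N \<and> blk i = j then x i else 0)" using zero by auto
    qed
  qed
  have block: "block_diag Hs z x = E z x" if x: "x \<in> H" for z x
  proof
    fix i
    have "block_diag Hs z x i = (\<Sum>j\<in>UNIV. if j = blk i then (if i < N then z $ blk i * x i else 0) else 0)"
      unfolding block_diag_def sum_cseq_apply components[OF x]
      by (intro sum.cong) (auto simp: cscale_def)
    then show "block_diag Hs z x i = E z x i" by (simp add: E_def)
  qed
  have E_H [simp]: "E z x \<in> H" for z x by (simp add: E_def H_def coord_space_def)
  have E_add: "E z (x + y) = E z x + E z y" for z x y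
    by (auto simp: E_def algebra_simps)
  have E_scale: "E z (cscale b x) = cscale b (E z x)" for z b x
    by (auto simp: E_def cscale_def)
  have D_add: "D (x + y) = D x + D y" and D_scale: "D (cscale b x) = cscale b (D x)" for x y b
    by (simp_all only: D_def V_add V_scale cut_add cut_scale)
  define L where "L z x = x - D (E z x)" for z x
  have L_linear: "Vector_Spaces.linear cscale cscale (L z)" for z
  proof (rule Vector_Spaces.linear_iff[THEN iffD2], intro conjI allI)
    show "vector_space cscale" "vector_space cscale" by (rule cvec.vector_space_axioms)+
    show "L z (x + y) = L z x + L z y" for x y
      unfolding L_def E_add D_add by (rule ext) simp
    show "L z (cscale b x) = cscale b (L z x)" for b x
      unfolding L_def E_scale D_scale by (rule ext) (simp add: cscale_def algebra_simps)
  qed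
  have L_H: "L z x \<in> H" if "x \<in> H" for z x
    using cvec.subspace_diff[OF subspace_coord_space, of x N "D (E z x)"] that
    unfolding L_def H_def[symmetric] by (simp add: D_def)
  have L_inj: "inj_on (L z) H" if z: "z \<in> polydisk" for z
  proof (rule inj_onI)
    fix x y assume xy: "x \<in> H" "y \<in> H" "L z x = L z y"
    define w where "w = x - y"
    have wH: "w \<in> H" unfolding w_def H_def
      by (rule cvec.subspace_diff[OF subspace_coord_space]) (use xy in \<open>auto simp: H_def\<close>)
    have "x = w + y" by (simp add: w_def)
    then have "L z x = L z w + L z y"
      using L_linear[of z] by (simp only: Vector_Spaces.linear_iff)
    then have "L z w + L z y = L z y" using xy(3) by argo
    then have "L z w = L z y - L z y" by (metis add_diff_cancel_right')
    then have "L z w = 0" by (simp only: diff_self)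
    then have "w - D (E z w) = 0" by (simp only: L_def)
    then have w: "w = D (E z w)" by (simp only: right_minus_eq)
    then have "(ip_norm ip w)\<^sup>2 \<le> (ip_norm ip (E z w))\<^sup>2"
      using D_contr[OF E_H, of z w] by (simp only: w[symmetric])
    then have le: "(\<Sum>i<N. (cmod (w i))\<^sup>2) \<le> (\<Sum>i<N. (cmod (z $ blk i))\<^sup>2 * (cmod (w i))\<^sup>2)"
      unfolding norm_eq by (simp add: E_def norm_mult power_mult_distrib)
    have z1: "(cmod (z $ j))\<^sup>2 < 1" for j
      using z by (simp add: polydisk_def power_less_one_iff abs_square_less_1)
    have "(\<Sum>i<N. (1 - (cmod (z $ blk i))\<^sup>2) * (cmod (w i))\<^sup>2) \<le> 0"
      using le by (simp add: left_diff_distrib sum_subtractf)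
    moreover have nonneg: "0 \<le> (1 - (cmod (z $ blk i))\<^sup>2) * (cmod (w i))\<^sup>2" for i
      using z1[of "blk i"] by (intro mult_nonneg_nonneg) auto
    ultimately have "(\<Sum>i<N. (1 - (cmod (z $ blk i))\<^sup>2) * (cmod (w i))\<^sup>2) = 0"
      by (intro antisym sum_nonneg)
    then have "(1 - (cmod (z $ blk i))\<^sup>2) * (cmod (w i))\<^sup>2 = 0" if "i < N" for i
      using that nonneg by (simp add: sum_nonneg_eq_0_iff)
    then have "w i = 0" if "i < N" for i
      using that z1[of "blk i"] by (metis mult_eq_0_iff norm_eq_zero power_eq_0_iff less_irrefl right_minus_eq)
    then have "w i = 0" for i using wH by (cases "i < N") (auto simp: H_def coord_space_def)
    then show "x = y" by (auto simp: w_def fun_eq_iff)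
  qed
  have L_bij: "bij_betw (L z) H H" if z: "z \<in> polydisk" for z
  proof -
    have "L z ` coords {..<N} = coords {..<N}"
      by (rule injective_imp_surjective_coords[OF _ L_linear])
        (use L_H L_inj[OF z] in \<open>auto simp: H_def coord_space_eq_coords\<close>)
    then show ?thesis using L_inj[OF z] by (simp add: bij_betw_def H_def coord_space_eq_coords)
  qed
  have "transfer_realization f H ip Hs A B C D"
    unfolding transfer_realization_def
  proof (intro conjI allI ballI)
    show "hilbert_space H ip" unfolding H_def ip_def by (rule hilbert_space_coord_space)
    show "orthogonal_decomposition H ip Hs"
      unfolding orthogonal_decomposition_def
    proof (intro conjI allI ballI impI)
      show "cvec.subspace (Hs j)" for j unfolding Hs_def by (rule subspace_coords)
      show "Hs j \<subseteq> H" for j by (auto simp: Hs_def H_def coords_def coord_space_def)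
      show "ip x y = 0" if "i \<noteq> j" "x \<in> Hs i" "y \<in> Hs j" for i j x y
        unfolding ip_eq dot_def
      proof (rule sum.neutral, intro ballI)
        fix k
        have "x k = 0 \<or> y k = 0" using that by (auto simp: Hs_def coords_def)
        then show "x k * cnj (y k) = 0" by auto
      qed
      show "\<exists>u. (\<forall>j. u j \<in> Hs j) \<and> x = (\<Sum>j\<in>UNIV. u j)" if x: "x \<in> H" for x
      proof (intro exI conjI allI)
        let ?u = "\<lambda>j i. if i < N \<and> blk i = j then x i else 0"
        show "?u j \<in> Hs j" for j by (simp add: Hs_def coords_def)
        show "x = (\<Sum>j\<in>UNIV. ?u j)"
        proof
          fix i
          have "(\<Sum>j\<in>UNIV. ?u j i) = (\<Sum>j\<in>UNIV. if blk i = j then (if i < N then x i else 0) else 0)"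
            by (intro sum.cong) auto
          then show "x i = (\<Sum>j\<in>UNIV. ?u j) i"
            using x by (auto simp: sum_cseq_apply H_def coord_space_def)
        qed
      qed
    qed
    show "B (x + y) = B x + B y" for x y by (simp add: B_def V_add)
    show "B (cscale c x) = c * B x" for c x by (simp add: B_def V_scale) (simp add: cscale_def)
    show "C a \<in> H" for a by (simp add: C_def)
    have "cscale (a + b) (unit_seq N) = cscale a (unit_seq N) + cscale b (unit_seq N)" for a b
      by (rule cvec.scale_left_distrib)
    then show "C (a + b) = C a + C b" for a b by (simp only: C_def V_add cut_add)
    have "cscale (c * a) (unit_seq N) = cscale c (cscale a (unit_seq N))" for c a
      by (simp add: cscale_def mult.assoc)
    then show "C (c * a) = cscale c (C a)" for c a by (simp only: C_def V_scale cut_scale)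
    show "linear_op H D"
      unfolding linear_op_def by (intro conjI ballI allI D_add D_scale) (simp add: D_def)
    show "(cmod (A * a + B x))\<^sup>2 + (ip_norm ip (C a + D x))\<^sup>2 = (cmod a)\<^sup>2 + (ip_norm ip x)\<^sup>2"
      if "x \<in> H" for a x using that by (rule isometry)
  next
    fix z :: "complex ^ 'n" assume z: "z \<in> polydisk"
    have L_eq: "x - D (block_diag Hs z x) = L z x" if "x \<in> H" for x
      by (simp only: L_def block[OF that])
    show "bij_betw (\<lambda>x. x - D (block_diag Hs z x)) H H"
      using L_bij[OF z] bij_betw_cong[of H "\<lambda>x. x - D (block_diag Hs z x)" "L z" H] L_eq by blast
    have inj: "inj_on (\<lambda>x. x - D (block_diag Hs z x)) H"
      using L_inj[OF z] inj_on_cong[of H "\<lambda>x. x - D (block_diag Hs z x)" "L z"] L_eq by blast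
    obtain x where x: "x \<in> H" and Vx: "\<And>i. i \<le> N \<Longrightarrow>
        V (\<lambda>i. if i = N then 1 else z $ blk i * x i) i = (if i = N then f z else x i)"
      using model[OF z] unfolding H_def by blast
    have split: "(\<lambda>i. if i = N then 1 else z $ blk i * x i) = unit_seq N + E z x"
      using x by (auto simp: unit_seq_def E_def H_def coord_space_def)
    have f_eq: "f z = A + B (E z x)"
      using Vx[of N] unfolding split V_add A_def B_def by simp
    have "L z x = C 1"
    proof
      fix i
      have one: "cscale 1 (unit_seq N) = unit_seq N" by (simp add: cscale_def)
      show "L z x i = C 1 i"
      proof (cases "i < N")
        case True
        then show ?thesis
          using Vx[of i] unfolding split V_add L_def D_def C_def one
          by (auto simp: cut_def algebra_simps)
      next
        case False
        then show ?thesis using x by (simp add: L_def D_def C_def cut_def H_def coord_space_def)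
      qed
    qed
    then have "x - D (block_diag Hs z x) = C 1" using L_eq[OF x] by simp
    then have "inv_into H (\<lambda>x. x - D (block_diag Hs z x)) (C 1) = x"
      using inv_into_f_f[OF inj x] by simp
    then show "f z = A + B (block_diag Hs z (inv_into H (\<lambda>x. x - D (block_diag Hs z x)) (C 1)))"
      using f_eq block[OF x] by simp
  qed
  then show ?thesis unfolding Hs_def[abs_def] by blast
qed

section \<open>Assembling the decomposition\<close>

lemma peval_shift:
  assumes "Poly_Mapping.keys P \<subseteq> index_box b" "\<And>m. m \<in> index_box b \<Longrightarrow> m + unit_index j \<in> index_box c"
  shows "(\<Sum>m\<in>index_box c. monomial_at z m * shift j (cf P) m) = z $ j * peval P z"
proof -
  let ?Q = "Poly_Mapping.single (unit_index j) 1 * P"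
  have Q: "cf ?Q m = shift j (cf P) m" for m
    by (simp add: lookup_unit_index_times shift_def)
  have "Poly_Mapping.keys ?Q \<subseteq> index_box c"
  proof
    fix m assume "m \<in> Poly_Mapping.keys ?Q"
    then have "0 < cf m j" "m - unit_index j \<in> Poly_Mapping.keys P"
      unfolding in_keys_iff Q by (auto simp: shift_def split: if_splits)
    then show "m \<in> index_box c"
      using assms unit_index_diff_add by (metis subsetD)
  qed
  then have "peval ?Q z = (\<Sum>m\<in>index_box c. cf ?Q m * monomial_at z m)"
    by (intro peval_superset) auto
  then show ?thesis unfolding Q by (simp add: peval_mult mult.commute)
qed

text \<open>
The lurking isometry argument on coefficient vectors. For each multi-index \<open>m\<close> in the box let \<open>u m\<close> collect the
\<open>m\<close>-th coefficients of \<open>p\<close> and of all \<open>z\<^sub>j P\<^sub>j\<^sub>k\<close>, and \<open>v m\<close> those of \<open>q\<close> and of all \<open>P\<^sub>j\<^sub>k\<close>. The defect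
equation is equality of their Gram matrices. An isometry with \<open>V (u m) = v m\<close> maps \<open>\<Sum> z\<^sup>m u m\<close> to \<open>\<Sum> z\<^sup>m v m\<close> for every \<open>z\<close>,
because no coefficient of \<open>z\<^sub>j P\<^sub>j\<^sub>k\<close> lies outside the box. The bijection \<open>\<beta>\<close> arranges the pairs \<open>(j, k)\<close> in a single list.
\<close>

lemma exists_isometric_colligation:
  fixes f :: "complex ^ 'n::{finite,linorder} \<Rightarrow> complex" and d :: "'n \<Rightarrow> nat"
  defines "I \<equiv> index_box (\<lambda>i. d i + 1)"
    and "n \<equiv> \<lambda>j. d j * (\<Prod>k\<in>UNIV - {j}. (d k + 1))"
  defines "N \<equiv> (\<Sum>j\<in>UNIV. n j)"
  assumes agler: "agler_class f"
    and p_nz: "\<forall>z\<in>polydisk. peval p z \<noteq> 0"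
    and f_eq: "\<forall>z\<in>polydisk. f z = peval q z / peval p z"
    and norms: "(\<Sum>m\<in>I. (cmod (cf p m))\<^sup>2) = (\<Sum>m\<in>I. (cmod (cf q m))\<^sup>2)"
    and keys: "Poly_Mapping.keys p \<subseteq> I" "Poly_Mapping.keys q \<subseteq> I"
  obtains \<beta> P V where "bij_betw \<beta> {..<N} (SIGMA j:UNIV. {..<n j})"
    and "linear_isometry (Suc N) V"
    and "\<And>z i. i \<le> N \<Longrightarrow>
      V (\<lambda>i. if i = N then peval p z else if i < N then z $ fst (\<beta> i) * peval (P (\<beta> i)) z else 0) i =
      (if i = N then peval q z else peval (P (\<beta> i)) z)"
proof -
  have fin: "finite I" by (simp add: I_def)
  obtain G where psd: "\<And>j. psd_on I (G j)"
    and G: "\<And>m l. m \<in> I \<Longrightarrow> l \<in> I \<Longrightarrow> defect G m l = cf p m * cnj (cf p l) - cf q m * cnj (cf q l)"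
    using exists_agler_kernels[OF agler p_nz f_eq norms[unfolded I_def]] unfolding I_def by metis
  have trace: "(\<Sum>m\<in>I. defect G m m) = 0"
  proof -
    have "(\<Sum>m\<in>I. defect G m m) =
        complex_of_real (\<Sum>m\<in>I. (cmod (cf p m))\<^sup>2) - complex_of_real (\<Sum>m\<in>I. (cmod (cf q m))\<^sup>2)"
      by (simp only: of_real_sum complex_norm_square sum_subtractf[symmetric] G cong: sum.cong)
    then show ?thesis by (simp only: norms diff_self)
  qed
  define M where "M j = index_box ((\<lambda>i. d i + 1)(j := d j))" for j
  have M_eq: "M j = {m \<in> I. cf m j \<noteq> d j}" for j
  proof (intro set_eqI iffI)
    fix m assume "m \<in> M j"
    then have m: "cf m i < ((\<lambda>i. d i + 1)(j := d j)) i" for i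
      unfolding M_def index_box_def by blast
    have "cf m i < d i + 1" for i using m[of i] by (cases "i = j") auto
    moreover have "cf m j \<noteq> d j" using m[of j] by simp
    ultimately show "m \<in> {m \<in> I. cf m j \<noteq> d j}" by (simp add: I_def index_box_def)
  next
    fix m assume "m \<in> {m \<in> I. cf m j \<noteq> d j}"
    then have "cf m i < d i + 1" "cf m j \<noteq> d j" for i by (simp_all add: I_def index_box_def)
    then have "cf m i < ((\<lambda>i. d i + 1)(j := d j)) i" for i
      by (cases "i = j") (auto simp: less_Suc_eq)
    then show "m \<in> M j" by (simp add: M_def index_box_def)
  qed
  have M_sub: "M j \<subseteq> I" for j by (auto simp: M_eq)
  have M_iff: "m \<in> M j \<longleftrightarrow> cf m j \<noteq> d j" if "m \<in> I" for m j
    using that by (simp add: M_eq)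
  have card_M: "card (M j) = n j" for j
  proof -
    have "card (M j) = (\<Prod>i\<in>UNIV. ((\<lambda>i. d i + 1)(j := d j)) i)"
      unfolding M_def by (rule card_index_box)
    also have "\<dots> = d j * (\<Prod>i\<in>UNIV - {j}. ((\<lambda>i. d i + 1)(j := d j)) i)"
      by (subst prod.remove[of _ j]) auto
    also have "\<dots> = n j" unfolding n_def by (intro arg_cong2[where f = "(*)"] prod.cong) auto
    finally show ?thesis .
  qed
  have "\<exists>a. \<forall>m\<in>M j. \<forall>l\<in>M j. G j m l = (\<Sum>k<card (M j). a k m * cnj (a k l))" for j
    by (rule psd_on_gram) (use psd_on_subset[OF psd M_sub fin] in \<open>auto simp: M_def\<close>)
  then have "\<forall>j. \<exists>a. \<forall>m\<in>M j. \<forall>l\<in>M j. G j m l = (\<Sum>k<n j. a k m * cnj (a k l))"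
    unfolding card_M by blast
  from choice[OF this] obtain a where
    a: "\<And>j m l. m \<in> M j \<Longrightarrow> l \<in> M j \<Longrightarrow> G j m l = (\<Sum>k<n j. a j k m * cnj (a j k l))"
    by blast
  define P where "P = (\<lambda>(j, k). \<Sum>m\<in>M j. Poly_Mapping.single m (a j k m))"
  have P: "cf (P (j, k)) m = (if m \<in> M j then a j k m else 0)" for j k m
    by (simp add: P_def lookup_sum lookup_single when_def M_def)
  have keys_P: "Poly_Mapping.keys (P x) \<subseteq> M (fst x)" for x
    by (cases x) (auto simp: in_keys_iff P split: if_splits)
  have gram: "G j m l = (\<Sum>k<n j. cf (P (j, k)) m * cnj (cf (P (j, k)) l))" if ml: "m \<in> I" "l \<in> I" for j m l
  proof (cases "m \<in> M j \<and> l \<in> M j")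
    case True
    then show ?thesis by (simp add: P a)
  next
    case False
    then have "cf m j = d j \<or> cf l j = d j" using M_iff ml by blast
    then have "G j m l = 0"
      using psd trace ml unfolding I_def by (intro kernels_vanish_on_top_layer) auto
    then show ?thesis using False by (auto simp: P)
  qed
  have "card (SIGMA j:UNIV. {..<n j}) = N" by (simp add: N_def)
  then obtain \<beta> where \<beta>: "bij_betw \<beta> {..<N} (SIGMA j:UNIV. {..<n j})"
    using ex_bij_betw_nat_finite[of "SIGMA j:UNIV. {..<n j}"] by (auto simp: atLeast0LessThan)
  have sum_\<beta>: "(\<Sum>i<N. F (\<beta> i)) = (\<Sum>j\<in>UNIV. \<Sum>k<n j. F (j, k))" for F :: "'n \<times> nat \<Rightarrow> complex"
    using sum.reindex_bij_betw[OF \<beta>, of F] by (simp add: sum.Sigma)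
  define u where "u m = (\<lambda>i. if i = N then cf p m
      else if i < N then shift (fst (\<beta> i)) (cf (P (\<beta> i))) m else 0)" for m
  define v where "v m = (\<lambda>i. if i = N then cf q m else cf (P (\<beta> i)) m)" for m
  have "dot (Suc N) (u m) (u l) = dot (Suc N) (v m) (v l)" if ml: "m \<in> I" "l \<in> I" for m l
  proof -
    have mem: "m - k \<in> I" "l - k \<in> I" for k
      using ml unfolding I_def by (simp_all only: index_box_diff)
    have "dot (Suc N) (u m) (u l) = (\<Sum>i<N. shift (fst (\<beta> i)) (cf (P (\<beta> i))) m *
            cnj (shift (fst (\<beta> i)) (cf (P (\<beta> i))) l)) + cf p m * cnj (cf p l)"
      by (simp add: dot_def u_def)
    also have "(\<Sum>i<N. shift (fst (\<beta> i)) (cf (P (\<beta> i))) m * cnj (shift (fst (\<beta> i)) (cf (P (\<beta> i))) l)) =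
        (\<Sum>j\<in>UNIV. if 0 < cf m j \<and> 0 < cf l j then G j (m - unit_index j) (l - unit_index j) else 0)"
      unfolding sum_\<beta>[of "\<lambda>x. shift (fst x) (cf (P x)) m * cnj (shift (fst x) (cf (P x)) l)"]
      by (intro sum.cong) (auto simp: shift_def gram mem)
    finally have left: "dot (Suc N) (u m) (u l) =
        (\<Sum>j\<in>UNIV. if 0 < cf m j \<and> 0 < cf l j then G j (m - unit_index j) (l - unit_index j) else 0) +
        cf p m * cnj (cf p l)" .
    have "dot (Suc N) (v m) (v l) = (\<Sum>i<N. cf (P (\<beta> i)) m * cnj (cf (P (\<beta> i)) l)) + cf q m * cnj (cf q l)"
      by (simp add: dot_def v_def)
    also have "(\<Sum>i<N. cf (P (\<beta> i)) m * cnj (cf (P (\<beta> i)) l)) = (\<Sum>j\<in>UNIV. G j m l)"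
      unfolding sum_\<beta>[of "\<lambda>x. cf (P x) m * cnj (cf (P x) l)"] using ml by (simp add: gram)
    finally have right: "dot (Suc N) (v m) (v l) = (\<Sum>j\<in>UNIV. G j m l) + cf q m * cnj (cf q l)" .
    have "(\<Sum>j\<in>UNIV. G j m l) -
        (\<Sum>j\<in>UNIV. if 0 < cf m j \<and> 0 < cf l j then G j (m - unit_index j) (l - unit_index j) else 0) =
        cf p m * cnj (cf p l) - cf q m * cnj (cf q l)"
      using G[OF ml] unfolding defect_def sum_subtractf .
    then show ?thesis unfolding left right by (simp add: algebra_simps)
  qed
  then obtain V where V: "linear_isometry (Suc N) V"
    and Vu: "\<And>m i. m \<in> I \<Longrightarrow> i < Suc N \<Longrightarrow> V (u m) i = v m i"
    using isometry_from_equal_gram[OF fin] by metis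
  show ?thesis
  proof (rule that[OF \<beta> V])
    fix z :: "complex ^ 'n::{finite,linorder}" and i assume i: "i \<le> N"
    have "(\<Sum>m\<in>I. cscale (monomial_at z m) (u m)) =
        (\<lambda>i. if i = N then peval p z else if i < N then z $ fst (\<beta> i) * peval (P (\<beta> i)) z else 0)"
    proof
      fix i
      have "(\<Sum>m\<in>I. cscale (monomial_at z m) (u m)) i = (\<Sum>m\<in>I. monomial_at z m * u m i)"
        by (simp add: sum_cseq_apply cscale_def)
      also have "\<dots> = (if i = N then peval p z else if i < N then z $ fst (\<beta> i) * peval (P (\<beta> i)) z else 0)"
      proof -
        \<comment> \<open>This is where the vanishing of the kernels on the top layer enters: \<open>z\<^sub>j P\<^sub>j\<^sub>k\<close> stays in the box.\<close>
        have step: "m + unit_index j \<in> I" if "m \<in> M j" for m j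
          using that unfolding M_def I_def index_box_def
          by (auto simp: lookup_add lookup_unit_index split: if_splits)
        have "(\<Sum>m\<in>I. monomial_at z m * shift (fst (\<beta> i)) (cf (P (\<beta> i))) m) = z $ fst (\<beta> i) * peval (P (\<beta> i)) z"
          unfolding I_def
          by (rule peval_shift[OF keys_P[of "\<beta> i", unfolded M_def] step[unfolded M_def I_def]])
        then show ?thesis
          using peval_superset[OF fin keys(1), of z] by (simp add: u_def mult.commute)
      qed
      finally show "(\<Sum>m\<in>I. cscale (monomial_at z m) (u m)) i = \<dots>" .
    qed
    then have "V (\<lambda>i. if i = N then peval p z else if i < N then z $ fst (\<beta> i) * peval (P (\<beta> i)) z else 0) i =
        (\<Sum>m\<in>I. cscale (monomial_at z m) (V (u m))) i"
      using linear_isometry_sum[OF V, of "monomial_at z" u I] by simp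
    also have "\<dots> = (\<Sum>m\<in>I. monomial_at z m * v m i)"
      using i by (simp add: sum_cseq_apply cscale_def Vu)
    also have "\<dots> = (if i = N then peval q z else peval (P (\<beta> i)) z)"
    proof -
      have "Poly_Mapping.keys (P (\<beta> i)) \<subseteq> I" using keys_P M_sub by blast
      then show ?thesis
        using peval_superset[OF fin keys(2), of z] peval_superset[OF fin, of "P (\<beta> i)" z]
        by (simp add: v_def mult.commute)
    qed
    finally show "V (\<lambda>i. if i = N then peval p z else if i < N then z $ fst (\<beta> i) * peval (P (\<beta> i)) z else 0) i =
        (if i = N then peval q z else peval (P (\<beta> i)) z)" .
  qed
qed

lemma deg_in_le_iff: "deg_in i P \<le> ereal c \<longleftrightarrow> (\<forall>m\<in>Poly_Mapping.keys P. real (cf m i) \<le> c)"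
  by (simp add: deg_in_def SUP_le_iff)

text \<open>
All existence claims come from a single colligation with exactly \<open>d\<^sub>j \<Prod>\<^sub>k\<^sub>\<noteq>\<^sub>j (d\<^sub>k + 1)\<close> polynomials \<open>P\<^sub>j\<^sub>k\<close> for each \<open>j\<close>, some
of which may be zero. The blocks therefore have exactly these dimensions, and one realization
serves for both the bounds and the total size.
\<close>

theorem theorem2p10:
  fixes f :: "complex ^ 'n::{finite,linorder} \<Rightarrow> complex"
    and p q :: "'n cpoly"
    and d :: "'n \<Rightarrow> nat"
  assumes inner: "rational_inner f"
    and agler: "agler_class f"
    and p_nz: "\<forall>z\<in>polydisk. peval p z \<noteq> 0"
    and f_eq: "\<forall>z\<in>polydisk. f z = peval q z / peval p z"
    and deg_q: "\<forall>j. deg_in j q \<le> ereal (real (d j))"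
    and deg_p: "\<forall>j. deg_in j p \<le> ereal (real (d j))"
  shows
    "(\<forall>N A. sos_decomposition p q N A \<longrightarrow>
        (\<forall>j. \<forall>k\<in>{1..N j}. \<forall>i.
           deg_in i (A j k) \<le> (if i \<noteq> j then ereal (real (d i)) else ereal (real (d i) - 1))))
   \<and> (\<exists>N A. sos_decomposition p q N A \<and>
        (\<forall>j. N j \<le> d j * (\<Prod>k\<in>UNIV - {j}. (d k + 1))))
   \<and> (\<exists>H ip Hs A B C D. transfer_realization f H ip Hs A B C D \<and>
        (\<forall>j. finite_dimensional (Hs j) \<and>
             cvec.dim (Hs j) \<le> d j * (\<Prod>k\<in>UNIV - {j}. (d k + 1))))
   \<and> (\<exists>H ip Hs A B C D. transfer_realization f H ip Hs A B C D \<and>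
        (\<forall>j. finite_dimensional (Hs j)) \<and>
        (\<Sum>j\<in>UNIV. cvec.dim (Hs j)) = (\<Sum>j\<in>UNIV. d j * (\<Prod>k\<in>UNIV - {j}. (d k + 1))))"
proof -
  define I where "I = index_box (\<lambda>i. d i + 1)"
  define n where "n j = d j * (\<Prod>k\<in>UNIV - {j}. (d k + 1))" for j
  define N where "N = (\<Sum>j\<in>UNIV. n j)"
  have keys: "Poly_Mapping.keys p \<subseteq> I" "Poly_Mapping.keys q \<subseteq> I"
    using deg_p deg_q by (auto simp: deg_in_le_iff I_def index_box_def less_Suc_eq_le)
  have norms: "(\<Sum>m\<in>I. (cmod (cf p m))\<^sup>2) = (\<Sum>m\<in>I. (cmod (cf q m))\<^sup>2)"
    by (rule inner_coefficient_norms_eq[OF inner p_nz f_eq keys]) (simp add: I_def)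

  have bounds: "deg_in i (A j k) \<le> (if i \<noteq> j then ereal (real (d i)) else ereal (real (d i) - 1))"
    if sos: "sos_decomposition p q K A" and k: "k \<in> {1..K j}" for K A j k i
  proof -
    define g where "g j m = (\<Sum>k=1..K j. (cmod (cf (A j k) m))\<^sup>2)" for j m
    have bound: "cf m i < (if i = j then d i else d i + 1)" if m: "m \<in> Poly_Mapping.keys (A j k)" for m
    proof (rule degree_bounds_of_diagonal[where g = g and d = d and c = "\<lambda>m. (cmod (cf p m))\<^sup>2 - (cmod (cf q m))\<^sup>2"])
      show "0 \<le> g j m" for j m unfolding g_def by (intro sum_nonneg) auto
      have "{m. \<exists>j. g j m \<noteq> 0} \<subseteq> (\<Union>j\<in>UNIV. \<Union>k\<in>{1..K j}. Poly_Mapping.keys (A j k))"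
      proof
        fix m assume "m \<in> {m. \<exists>j. g j m \<noteq> 0}"
        then obtain j where "g j m \<noteq> 0" by blast
        then obtain k where "k \<in> {1..K j}" "cf (A j k) m \<noteq> 0"
          unfolding g_def by (metis (no_types, lifting) norm_zero sum.neutral zero_power2)
        then show "m \<in> (\<Union>j\<in>UNIV. \<Union>k\<in>{1..K j}. Poly_Mapping.keys (A j k))"
          using in_keys_iff[of m "A j k"] by blast
      qed
      then show "finite {m. \<exists>j. g j m \<noteq> 0}" by (rule finite_subset) auto
      show "(cmod (cf p m))\<^sup>2 - (cmod (cf q m))\<^sup>2 =
          (\<Sum>j\<in>UNIV. g j m - (if 0 < cf m j then g j (m - unit_index j) else 0))" for m
        unfolding g_def by (rule sos_decomposition_diagonal_coeffs[OF sos])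
      show "m \<in> index_box (\<lambda>i. d i + 1)" if "(cmod (cf p m))\<^sup>2 - (cmod (cf q m))\<^sup>2 \<noteq> 0" for m
      proof -
        have "cf p m \<noteq> 0 \<or> cf q m \<noteq> 0" using that by auto
        then show ?thesis
          unfolding I_def[symmetric] using keys in_keys_iff[of m p] in_keys_iff[of m q] by blast
      qed
      show "(\<Sum>m\<in>index_box (\<lambda>i. d i + 1). (cmod (cf p m))\<^sup>2 - (cmod (cf q m))\<^sup>2) = 0"
        using norms unfolding I_def by (simp add: sum_subtractf)
      have "0 < (cmod (cf (A j k) m))\<^sup>2" using m by (simp add: in_keys_iff)
      also have "\<dots> \<le> g j m" unfolding g_def using k by (intro member_le_sum) auto
      finally show "g j m \<noteq> 0" by simp
    qed
    show ?thesis
    proof (cases "i = j")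
      case True
      have "real (cf m i) \<le> real (d i) - 1" if "m \<in> Poly_Mapping.keys (A j k)" for m
        using bound[OF that] True by simp
      then show ?thesis using True by (simp add: deg_in_le_iff)
    next
      case False
      have "real (cf m i) \<le> real (d i)" if "m \<in> Poly_Mapping.keys (A j k)" for m
        using bound[OF that] False by simp
      then show ?thesis using False by (simp add: deg_in_le_iff)
    qed
  qed

  obtain \<beta> P V where \<beta>: "bij_betw \<beta> {..<N} (SIGMA j:UNIV. {..<n j})"
    and V: "linear_isometry (Suc N) V"
    and VP: "\<And>z i. i \<le> N \<Longrightarrow>
      V (\<lambda>i. if i = N then peval p z else if i < N then z $ fst (\<beta> i) * peval (P (\<beta> i)) z else 0) i =
      (if i = N then peval q z else peval (P (\<beta> i)) z)"
    by (rule exists_isometric_colligation[OF agler p_nz f_eq norms[unfolded I_def] keys[unfolded I_def],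
          folded n_def, folded N_def]) (rule that)
  have sum_\<beta>: "(\<Sum>i<N. F (\<beta> i)) = (\<Sum>j\<in>UNIV. \<Sum>k<n j. F (j, k))" for F :: "'n \<times> nat \<Rightarrow> real"
    using sum.reindex_bij_betw[OF \<beta>, of F] by (simp add: sum.Sigma)

  have sos: "sos_decomposition p q n (\<lambda>j k. P (j, k - 1))"
    unfolding sos_decomposition_def
  proof
    fix z :: "complex ^ 'n::{finite,linorder}"
    let ?U = "\<lambda>i. if i = N then peval p z else if i < N then z $ fst (\<beta> i) * peval (P (\<beta> i)) z else 0"
    have "dot (Suc N) (V ?U) (V ?U) = dot (Suc N) ?U ?U"
      using V unfolding linear_isometry_def by blast
    then have "(\<Sum>i<Suc N. (cmod (V ?U i))\<^sup>2) = (\<Sum>i<Suc N. (cmod (?U i))\<^sup>2)"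
      unfolding dot_self of_real_eq_iff .
    moreover have "(\<Sum>i<Suc N. (cmod (V ?U i))\<^sup>2) = (\<Sum>i<N. (cmod (peval (P (\<beta> i)) z))\<^sup>2) + (cmod (peval q z))\<^sup>2"
      by (simp add: VP)
    moreover have "(\<Sum>i<Suc N. (cmod (?U i))\<^sup>2) =
        (\<Sum>i<N. (cmod (z $ fst (\<beta> i)))\<^sup>2 * (cmod (peval (P (\<beta> i)) z))\<^sup>2) + (cmod (peval p z))\<^sup>2"
      by (simp add: norm_mult power_mult_distrib)
    ultimately have "(cmod (peval p z))\<^sup>2 - (cmod (peval q z))\<^sup>2 =
        (\<Sum>i<N. (1 - (cmod (z $ fst (\<beta> i)))\<^sup>2) * (cmod (peval (P (\<beta> i)) z))\<^sup>2)"
      by (simp add: left_diff_distrib sum_subtractf)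
    also have "\<dots> = (\<Sum>j\<in>UNIV. (1 - (cmod (z $ j))\<^sup>2) * (\<Sum>k<n j. (cmod (peval (P (j, k)) z))\<^sup>2))"
      unfolding sum_\<beta>[of "\<lambda>x. (1 - (cmod (z $ fst x))\<^sup>2) * (cmod (peval (P x) z))\<^sup>2"]
      by (simp add: sum_distrib_left)
    also have "(\<lambda>j. \<Sum>k<n j. (cmod (peval (P (j, k)) z))\<^sup>2) = (\<lambda>j. \<Sum>k=1..n j. (cmod (peval (P (j, k - 1)) z))\<^sup>2)"
    proof
      fix j
      show "(\<Sum>k<n j. (cmod (peval (P (j, k)) z))\<^sup>2) = (\<Sum>k=1..n j. (cmod (peval (P (j, k - 1)) z))\<^sup>2)"
        by (rule sum.reindex_bij_witness[where i = "\<lambda>k. k - 1" and j = Suc]) auto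
    qed
    finally show "(cmod (peval p z))\<^sup>2 - (cmod (peval q z))\<^sup>2 =
        (\<Sum>j\<in>UNIV. (1 - (cmod (z $ j))\<^sup>2) * (\<Sum>k=1..n j. (cmod (peval (P (j, k - 1)) z))\<^sup>2))" .
  qed

  let ?Hs = "\<lambda>j. coords {i. i < N \<and> fst (\<beta> i) = j}"
  have "\<exists>H ip A B C D. transfer_realization f H ip ?Hs A B C D"
  proof (rule transfer_realization_of_isometry[OF V])
    fix z :: "complex ^ 'n::{finite,linorder}" assume z: "z \<in> polydisk"
    define x where "x = (\<lambda>i. if i < N then peval (P (\<beta> i)) z / peval p z else 0)"
    let ?U = "\<lambda>i. if i = N then peval p z else if i < N then z $ fst (\<beta> i) * peval (P (\<beta> i)) z else 0"
    have "(\<lambda>i. if i = N then 1 else z $ fst (\<beta> i) * x i) = cscale (1 / peval p z) ?U"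
      using z p_nz by (auto simp: cscale_def x_def)
    moreover have "V (cscale (1 / peval p z) ?U) = cscale (1 / peval p z) (V ?U)"
      using V unfolding linear_isometry_def by blast
    ultimately have "V (\<lambda>i. if i = N then 1 else z $ fst (\<beta> i) * x i) i = (if i = N then f z else x i)"
      if "i \<le> N" for i
      using VP[OF that, of z] that z f_eq by (simp add: cscale_def x_def)
    then show "\<exists>x\<in>coord_space N. \<forall>i\<le>N. V (\<lambda>i. if i = N then 1 else z $ fst (\<beta> i) * x i) i =
        (if i = N then f z else x i)"
      by (intro bexI[of _ x]) (auto simp: x_def coord_space_def)
  qed
  then obtain H ip A B C D where realization: "transfer_realization f H ip ?Hs A B C D" by blast
  have fin_dim: "finite_dimensional (?Hs j)" for j
    by (rule finite_dimensional_coords) simp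
  have dim: "cvec.dim (?Hs j) = n j" for j
  proof -
    have range: "\<beta> ` {..<N} = (SIGMA j:UNIV. {..<n j})"
      by (rule bij_betw_imp_surj_on[OF \<beta>])
    have "\<beta> ` {i. i < N \<and> fst (\<beta> i) = j} = {j} \<times> {..<n j}"
    proof (intro equalityI subsetI)
      fix x assume "x \<in> \<beta> ` {i. i < N \<and> fst (\<beta> i) = j}"
      then have "x \<in> \<beta> ` {..<N}" "fst x = j" by auto
      then show "x \<in> {j} \<times> {..<n j}" unfolding range by auto
    next
      fix x assume x: "x \<in> {j} \<times> {..<n j}"
      then have "x \<in> \<beta> ` {..<N}" unfolding range by auto
      then obtain i where "i < N" "x = \<beta> i" by auto
      moreover have "fst x = j" using x by auto
      ultimately show "x \<in> \<beta> ` {i. i < N \<and> fst (\<beta> i) = j}" by auto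
    qed
    then have "bij_betw \<beta> {i. i < N \<and> fst (\<beta> i) = j} ({j} \<times> {..<n j})"
      by (rule bij_betw_subset[OF \<beta>, rotated]) auto
    from bij_betw_same_card[OF this] have "card {i. i < N \<and> fst (\<beta> i) = j} = n j" by simp
    then show ?thesis by (subst dim_coords) simp_all
  qed
  show ?thesis
    unfolding n_def[symmetric]
  proof (intro conjI)
    show "\<exists>H ip Hs A B C D. transfer_realization f H ip Hs A B C D \<and>
        (\<forall>j. finite_dimensional (Hs j) \<and> cvec.dim (Hs j) \<le> n j)"
      by (rule exI[of _ H], rule exI[of _ ip], rule exI[of _ ?Hs], rule exI[of _ A], rule exI[of _ B],
          rule exI[of _ C], rule exI[of _ D]) (simp only: realization fin_dim dim order_refl simp_thms)
    show "\<exists>H ip Hs A B C D. transfer_realization f H ip Hs A B C D \<and>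
        (\<forall>j. finite_dimensional (Hs j)) \<and> (\<Sum>j\<in>UNIV. cvec.dim (Hs j)) = (\<Sum>j\<in>UNIV. n j)"
      by (rule exI[of _ H], rule exI[of _ ip], rule exI[of _ ?Hs], rule exI[of _ A], rule exI[of _ B],
          rule exI[of _ C], rule exI[of _ D]) (simp only: realization fin_dim dim simp_thms)
  qed (use bounds sos in blast)+
qed

end
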